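(* For each real $\beta>0$ and each integer $d\ge 0$ there is an $n_0$ such that the following holds. Let $p$ be a prime and let $A$ be a subset of $\mathbb{Z}_p$ with $n_0 \le |A|=n < (1-\beta)p/2$. For each $a\in A$ let $F_a\subset A$ be a set of $d$ elements of $A$. Then the restricted sumset $$\{a+b : a\in A,\ b\in A\setminus F_a\}$$ has size at least $2n-1-2d$.
   Context: $\mathbb{Z}_p$ is the cyclic group of prime order $p$. (So all sums $a+b$ with $a,b\in A$ are formed, except that for each $a\in A$ there is a set $F_a$ of $d$ values in $A$ that are not allowed to be taken as $b$.) *)

theory Defs
  imports "HOL-Algebra.Elementary_Groups" "HOL-Computational_Algebra.Primes" Complex_Main
begin

(* HOL-Algebra writes groups multiplicatively: for G = integer_mod_group p, whose elements
   are the integers 0, ..., p - 1, the operation below is addition modulo p. *)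
definition restricted_sumset :: "('a, 'm) monoid_scheme \<Rightarrow> 'a set \<Rightarrow> ('a \<Rightarrow> 'a set) \<Rightarrow> 'a set" where
  "restricted_sumset G A F = {a \<otimes>\<^bsub>G\<^esub> b | a b. a \<in> A \<and> b \<in> A - F a}"

end

theory Submission
  imports Defs "HOL-Number_Theory.Cong"
begin

text \<open>Let \<open>R\<close> be the restricted sumset and suppose that \<open>|R| \<le> 2n - 2 - 2d\<close>. The set \<open>S = -(complement of R)\<close>
  then has at least \<open>p - 2n\<close> elements, and \<open>x + y + z = 0\<close> has at most \<open>dn\<close> solutions in \<open>A \<times> A \<times> S\<close>.
  Call a triple of sets with few solutions and total size close to \<open>p\<close> critical. Pollard's theorem
  says that the total size of a triple with few solutions cannot exceed \<open>p\<close> by much; hence replacing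
  \<open>(X, B, Z)\<close> by \<open>(X \<inter> (X + h), B, Z \<union> (Z - h))\<close> keeps a triple critical, with a bounded loss, and one of
  the sets can be shrunk to a small \<open>X\<close> with \<open>(X, A, Z)\<close> critical. Differences of elements of \<open>X\<close> are then
  almost periods of \<open>A\<close>, and of the other sets of the critical triples that contain \<open>A\<close>. As one of these
  sets has a large nontrivial Fourier coefficient, \<open>X\<close> lies, after a dilation, in an arc that is short
  but in which \<open>X\<close> is dense.

  Criticality of \<open>(X, A, Z)\<close> now forces \<open>A\<close> to lie, up to a small part, in one arc on which its local
  density is about that of \<open>X\<close>. If the arc is longer than half of the circle, almost every residue is
  a sum in many ways, so \<open>R\<close> is too large. Otherwise an element of \<open>A\<close> outside the arc would
  contribute too many new sums, so all of \<open>A\<close> lies in an arc of length at most \<open>p/2\<close>, where the sums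
  with the smallest and with the largest element of \<open>A\<close> already give \<open>2n - 1 - 2d\<close> elements of \<open>R\<close>.\<close>

section \<open>Residues as periodic sets of integers\<close>

text \<open>The argument closes because \<pi> > 3. If a set of a critical triple has a Fourier
  coefficient of size \<open>M\<close> and the differences of \<open>X\<close> are its almost
  periods, a dilation brings \<open>X\<close> into an arc of length \<open>p / N\<close> with
  \<open>N * sz X\<close> close to \<pi>M. The triples are arranged so that \<open>M\<close> is at
  least nearly \<open>p / 6\<close>, or \<open>2 n / 3\<close> if n is at most \<open>p / 4\<close>.
  In the first case \<open>X\<close> has density above 1/2 in its arc, just enough for pieces of
  \<open>A\<close> and reflected pieces of \<open>A\<close> to overlap. In the second,
  \<open>N * sz X\<close> exceeds \<open>2 n\<close>, so \<open>A\<close> is too small to fill half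
  of the circle at that density. In both, \<open>N * sz X\<close> exceeds n, which forces a gap in
  \<open>A\<close>. All losses are measured on one scale \<open>e\<close>: at most
  \<open>e * (e - 1)\<close> solutions allow a total size of at most \<open>p + 2 * e\<close>. Each
  shrinking step doubles the bounds on solutions and deficit, so the number of steps has to depend
  on \<beta> alone. Then \<open>e\<close> can be a small fixed multiple of n, with
  \<open>d * n\<close> far below \<open>e * e\<close> for large n, while \<open>X\<close> keeps a
  fixed proportion of n and so dominates every loss.\<close>

declare sum_of_bool_eq [simp del] sum_mult_of_bool_eq [simp del] sum_of_bool_mult_eq [simp del]

locale prime_modulus =
  fixes p :: int
  assumes prime_p: "Factorial_Ring.prime p"
begin

lemma p_gt_1: "1 < p"
  using prime_p by (simp add: prime_gt_1_int)

lemma p_pos: "0 < p"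
  using p_gt_1 by simp

text \<open>A subset of \<open>\<int>/p\<close> is represented by its preimage in \<open>\<int>\<close>, a set \<open>A\<close> with \<open>per A\<close>, and \<open>sz\<close> is its
  cardinality in \<open>\<int>/p\<close>.\<close>

definition per :: "int set \<Rightarrow> bool" where
  "per A \<longleftrightarrow> (\<forall>x. x + p \<in> A \<longleftrightarrow> x \<in> A)"

definition sz :: "int set \<Rightarrow> real" where
  "sz A = (\<Sum>x\<in>{0..<p}. of_bool (x \<in> A))"

definition shift :: "int \<Rightarrow> int set \<Rightarrow> int set" where
  "shift h A = {x. x - h \<in> A}"

definition triples :: "int set \<Rightarrow> int set \<Rightarrow> int set \<Rightarrow> real" where
  "triples A B C = (\<Sum>x\<in>{0..<p}. \<Sum>y\<in>{0..<p}. of_bool (x \<in> A) * of_bool (y \<in> B) * of_bool (- x - y \<in> C))"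

definition cor :: "int set \<Rightarrow> int \<Rightarrow> real" where
  "cor A h = sz (A \<inter> shift h A)"

definition conv :: "int set \<Rightarrow> int set \<Rightarrow> int \<Rightarrow> real" where
  "conv A B z = (\<Sum>x\<in>{0..<p}. of_bool (x \<in> A) * of_bool (z - x \<in> B))"

lemma mem_shift [simp]: "x \<in> shift h A \<longleftrightarrow> x - h \<in> A"
  by (simp add: shift_def)

lemma periodic_mult:
  fixes F :: "int \<Rightarrow> 'b"
  assumes "\<And>x. F (x + p) = F x"
  shows "F (x + p * m) = F x"
proof -
  have nat: "F (x + p * int k) = F x" for k x
  proof (induction k)
    case (Suc k)
    have "F (x + p * int (Suc k)) = F ((x + p * int k) + p)" by (simp add: algebra_simps)
    also have "\<dots> = F x" using assms Suc by simp
    finally show ?case .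
  qed simp
  show ?thesis
  proof (cases "0 \<le> m")
    case True
    then show ?thesis using nat[of x "nat m"] by simp
  next
    case False
    then show ?thesis using nat[of "x + p * m" "nat (- m)"] by (simp add: algebra_simps)
  qed
qed

lemma periodic_mod:
  fixes F :: "int \<Rightarrow> 'b"
  assumes "\<And>x. F (x + p) = F x"
  shows "F (x mod p) = F x"
  using periodic_mult[of F "x mod p" "x div p", OF assms] by (simp add: algebra_simps)

lemma periodic_cong:
  fixes F :: "int \<Rightarrow> 'b"
  assumes "\<And>x. F (x + p) = F x" and "x mod p = y mod p"
  shows "F x = F y"
  using periodic_mod[of F, OF assms(1)] assms(2) by metis

lemma per_cong: "per A \<Longrightarrow> x mod p = y mod p \<Longrightarrow> x \<in> A \<longleftrightarrow> y \<in> A"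
  using periodic_cong[of "\<lambda>x. x \<in> A" x y] by (simp add: per_def)

lemma per_mult: "per A \<Longrightarrow> x + p * m \<in> A \<longleftrightarrow> x \<in> A"
  by (rule per_cong) auto

text \<open>An injective map of the residues permutes them, so sums over one period admit
  translations, reflections and dilations as substitutions. Only the dilations rely on
  \<open>p\<close> being prime.\<close>

lemma sum_subst:
  fixes F :: "int \<Rightarrow> 'b :: comm_monoid_add"
  assumes per: "\<And>x. F (x + p) = F x" and inj: "inj_on (\<lambda>x. \<phi> x mod p) {0..<p}"
  shows "(\<Sum>x\<in>{0..<p}. F (\<phi> x)) = (\<Sum>x\<in>{0..<p}. F x)"
proof -
  have "(\<lambda>x. \<phi> x mod p) ` {0..<p} = {0..<p}"
    by (rule endo_inj_surj) (use inj p_pos in auto)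
  then have "(\<Sum>x\<in>{0..<p}. F x) = (\<Sum>x\<in>{0..<p}. F (\<phi> x mod p))"
    using sum.reindex[OF inj, of F] by (simp add: o_def)
  then show ?thesis by (simp add: periodic_mod[of F, OF per])
qed

lemma eq_of_cong: "\<lbrakk>x \<in> {0..<p}; y \<in> {0..<p}; p dvd x - y\<rbrakk> \<Longrightarrow> x = y"
  by (metis atLeastLessThan_iff mod_eq_dvd_iff mod_pos_pos_trivial)

lemma sum_add:
  fixes F :: "int \<Rightarrow> 'b :: comm_monoid_add"
  assumes "\<And>x. F (x + p) = F x"
  shows "(\<Sum>x\<in>{0..<p}. F (x + h)) = (\<Sum>x\<in>{0..<p}. F x)"
  by (rule sum_subst[of F "\<lambda>x. x + h", OF assms])
     (auto intro!: inj_onI eq_of_cong simp: mod_eq_dvd_iff)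

lemma sum_diff:
  fixes F :: "int \<Rightarrow> 'b :: comm_monoid_add"
  assumes "\<And>x. F (x + p) = F x"
  shows "(\<Sum>x\<in>{0..<p}. F (h - x)) = (\<Sum>x\<in>{0..<p}. F x)"
  by (rule sum_subst[of F "\<lambda>x. h - x", OF assms])
     (auto intro!: inj_onI eq_of_cong simp: mod_eq_dvd_iff dvd_diff_commute)

lemma sum_mult:
  fixes F :: "int \<Rightarrow> 'b :: comm_monoid_add"
  assumes "\<And>x. F (x + p) = F x" and "\<not> p dvd k"
  shows "(\<Sum>x\<in>{0..<p}. F (k * x)) = (\<Sum>x\<in>{0..<p}. F x)"
proof (rule sum_subst[of F "\<lambda>x. k * x", OF assms(1)])
  show "inj_on (\<lambda>x. k * x mod p) {0..<p}"
  proof (intro inj_onI)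
    fix x y assume xy: "x \<in> {0..<p}" "y \<in> {0..<p}" "k * x mod p = k * y mod p"
    then have "p dvd k * (x - y)" by (simp add: mod_eq_dvd_iff algebra_simps)
    then have "p dvd x - y" using assms(2) prime_p prime_dvd_mult_iff by blast
    then show "x = y" using xy eq_of_cong by blast
  qed
qed

lemma perD: "per A \<Longrightarrow> x + p \<in> A \<longleftrightarrow> x \<in> A"
  by (simp add: per_def)

lemma perD_minus: "per A \<Longrightarrow> x - p \<in> A \<longleftrightarrow> x \<in> A"
  using perD[of A "x - p"] by simp

lemma per_shift [simp, intro]: "per A \<Longrightarrow> per (shift h A)"
  using perD[of A "_ - h"] by (simp add: per_def algebra_simps)

lemma per_Int [simp, intro]: "per A \<Longrightarrow> per B \<Longrightarrow> per (A \<inter> B)"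
  by (auto simp: per_def)

lemma per_Un [simp, intro]: "per A \<Longrightarrow> per B \<Longrightarrow> per (A \<union> B)"
  by (auto simp: per_def)

lemma per_Diff [simp, intro]: "per A \<Longrightarrow> per B \<Longrightarrow> per (A - B)"
  by (auto simp: per_def)

lemma per_Compl [simp, intro]: "per A \<Longrightarrow> per (- A)"
  by (auto simp: per_def)

lemma per_diff_left [simp, intro]:
  assumes "per A"
  shows "per {x. c - x \<in> A}"
  using perD_minus[OF assms, of "c - _"] by (simp add: per_def algebra_simps)

lemma per_uminus [simp, intro]: "per A \<Longrightarrow> per {x. - x \<in> A}"
  using per_diff_left[of A 0] by simp

lemma sz_card: "sz A = real (card (A \<inter> {0..<p}))"
  by (simp add: sz_def sum_of_bool_eq Int_commute)

lemma sz_nonneg [simp]: "0 \<le> sz A"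
  by (simp add: sz_card)

lemma sz_mono: "A \<subseteq> B \<Longrightarrow> sz A \<le> sz B"
  unfolding sz_card by (intro of_nat_mono card_mono) auto

lemma sz_Un_Int: "sz (A \<union> B) + sz (A \<inter> B) = sz A + sz B"
  unfolding sz_def sum.distrib[symmetric] by (intro sum.cong) auto

lemma sz_Int_Diff: "sz A = sz (A \<inter> B) + sz (A - B)"
  unfolding sz_def sum.distrib[symmetric] by (intro sum.cong) auto

lemma sz_Compl: "sz (- A) = p - sz A"
proof -
  have "sz (- A) + sz A = (\<Sum>x\<in>{0..<p}. 1)"
    unfolding sz_def sum.distrib[symmetric] by (intro sum.cong) auto
  then show ?thesis using p_pos by simp
qed

lemma sz_shift [simp]: "per A \<Longrightarrow> sz (shift h A) = sz A"
  unfolding sz_def using sum_add[of "\<lambda>x. of_bool (x \<in> A)" "- h"] by (simp add: perD)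

lemma sz_reflect [simp]: "per A \<Longrightarrow> sz {x. c - x \<in> A} = sz A"
  unfolding sz_def using sum_diff[of "\<lambda>x. of_bool (x \<in> A)" c] by (simp add: perD perD_minus flip: diff_diff_eq)

lemma sz_uminus [simp]: "per A \<Longrightarrow> sz {x. - x \<in> A} = sz A"
  using sz_reflect[of A 0] by simp

lemma shift_zero [simp]: "shift 0 A = A"
  by auto

section \<open>Numbers of representations of a sum\<close>

lemma triples_conv:
  assumes "per B" "per C"
  shows "triples A B C = (\<Sum>z\<in>{0..<p}. of_bool (- z \<in> C) * conv A B z)"
proof -
  have "(\<Sum>y\<in>{0..<p}. of_bool (x \<in> A) * of_bool (y \<in> B) * of_bool (- x - y \<in> C) :: real)
      = (\<Sum>z\<in>{0..<p}. of_bool (- z \<in> C) * (of_bool (x \<in> A) * of_bool (z - x \<in> B)))" for x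
  proof -
    define F :: "int \<Rightarrow> real" where
      "F = (\<lambda>z. of_bool (x \<in> A) * of_bool (z - x \<in> B) * of_bool (- x - (z - x) \<in> C))"
    have "F (z + p) = F z" for z
      using perD[OF assms(1), of "z - x"] perD[OF assms(2), of "- z - p"]
      by (simp add: F_def diff_add_eq)
    note sum = sum_add[of F x, OF this]
    have "of_bool (x \<in> A) * of_bool (y \<in> B) * of_bool (- x - y \<in> C) = F (y + x)" for y
      by (simp only: F_def add_diff_cancel_right')
    note eq = this
    show ?thesis unfolding eq sum by (intro sum.cong refl) (simp add: F_def)
  qed
  then have "triples A B C =
      (\<Sum>x\<in>{0..<p}. \<Sum>z\<in>{0..<p}. of_bool (- z \<in> C) * (of_bool (x \<in> A) * of_bool (z - x \<in> B)))"
    by (simp only: triples_def)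
  also have "\<dots> = (\<Sum>z\<in>{0..<p}. of_bool (- z \<in> C) * conv A B z)"
    unfolding conv_def sum_distrib_left by (rule sum.swap)
  finally show ?thesis .
qed

lemma conv_add_p: "per B \<Longrightarrow> conv A B (z + p) = conv A B z"
  using perD[of B "z - _"] by (simp add: conv_def diff_add_eq)

lemma sum_shift_set: "per B \<Longrightarrow> (\<Sum>z\<in>{0..<p}. of_bool (z - x \<in> B)) = sz B"
  using sz_shift[of B x] by (simp add: sz_def)

lemma sum_reflect_set: "per B \<Longrightarrow> (\<Sum>z\<in>{0..<p}. of_bool (x - z \<in> B)) = sz B"
  using sz_reflect[of B x] by (simp add: sz_def)

lemma conv_sum: "per B \<Longrightarrow> (\<Sum>z\<in>{0..<p}. conv A B z) = sz A * sz B"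
  unfolding conv_def
  by (subst sum.swap) (simp add: sum_shift_set sz_def flip: sum_distrib_left sum_distrib_right)

lemma conv_le_right:
  assumes "per B"
  shows "conv A B z \<le> sz B"
proof -
  have "conv A B z \<le> (\<Sum>x\<in>{0..<p}. of_bool (z - x \<in> B))"
    unfolding conv_def by (intro sum_mono) auto
  then show ?thesis using sum_reflect_set[OF assms] by simp
qed

lemma conv_nonneg [simp]: "0 \<le> conv A B z"
  unfolding conv_def by (intro sum_nonneg) auto

lemma conv_split_right: "conv A B z = conv A (B \<inter> D) z + conv A (B - D) z"
  unfolding conv_def sum.distrib[symmetric] by (intro sum.cong) auto

lemma conv_split_left: "conv A B z = conv (A \<inter> D) B z + conv (A - D) B z"
  unfolding conv_def sum.distrib[symmetric] by (intro sum.cong) auto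

section \<open>Pollard's theorem\<close>

text \<open>The Dyson transform preserves the number of representations up to the leftover pairs,
  because a pair \<open>(x, z - x)\<close> with \<open>x \<in> (B + e) - A\<close> can be exchanged for \<open>(z + e - x, x - e)\<close>.\<close>

lemma conv_dyson:
  assumes "per A" "per B"
  shows "conv A B z = conv (A \<union> shift e B) (B \<inter> shift (- e) A) z
    + conv (A - shift e B) (B - shift (- e) A) z"
proof -
  let ?B' = "B \<inter> shift (- e) A" and ?B'' = "B - shift (- e) A"
  define F :: "int \<Rightarrow> real" where
    "F = (\<lambda>x. of_bool (x \<in> shift e B - A) * of_bool (z - x \<in> ?B'))"
  have "F (x + p) = F x" for x
  proof -
    have "x + p \<in> shift e B - A \<longleftrightarrow> x \<in> shift e B - A"
      using perD[of "shift e B - A" x] assms by blast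
    moreover have "z - (x + p) \<in> ?B' \<longleftrightarrow> z - x \<in> ?B'"
      using perD_minus[of ?B' "z - x"] assms by (simp only: diff_diff_eq per_Int per_shift)
    ultimately show ?thesis unfolding F_def by simp
  qed
  from sum_diff[of F "z + e", OF this]
  have swap0: "(\<Sum>x\<in>{0..<p}. F (z + e - x)) = (\<Sum>x\<in>{0..<p}. F x)" .
  have swap: "conv (shift e B - A) ?B' z = conv (A \<inter> shift e B) ?B'' z"
  proof -
    have "z + e - x - e = z - x" "z - (z + e - x) = x - e" for x by simp_all
    then have "F (z + e - x) = of_bool (x \<in> A \<inter> shift e B) * of_bool (z - x \<in> ?B'')" for x
      by (auto simp: F_def diff_add_eq)
    with swap0 show ?thesis unfolding conv_def by (simp add: F_def)
  qed
  have "conv (A \<union> shift e B) ?B' z = conv A ?B' z + conv (shift e B - A) ?B' z"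
    unfolding conv_def sum.distrib[symmetric] by (intro sum.cong) auto
  then show ?thesis
    using swap conv_split_right[of A B z "shift (- e) A"] conv_split_left[of A ?B'' z "shift e B"]
    by simp
qed

text \<open>A nonzero residue is invertible modulo a prime, so the multiples of \<open>h\<close>,
  added to \<open>a\<close>, reach every class. In this form the absence of proper subgroups enters
  Pollard's theorem, the search for partial overlaps and the balancing of triples.\<close>

lemma closed_imp_UNIV:
  assumes "per A" "a \<in> A" and step: "\<And>x. x \<in> A \<Longrightarrow> x + h \<in> A" and nd: "\<not> p dvd h"
  shows "A = UNIV"
proof -
  have iter: "a + h * int k \<in> A" for k
  proof (induction k)
    case (Suc k)
    have eq: "a + h * int (Suc k) = a + h * int k + h" by (simp add: algebra_simps)
    show ?case unfolding eq by (rule step[OF Suc])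
  qed (simp add: assms)
  have "coprime h p" using nd prime_p by (metis coprime_commute prime_imp_coprime)
  then obtain u where u: "[h * u = 1] (mod p)" using cong_solve_coprime_int by blast
  have "x \<in> A" for x
  proof -
    define k where "k = nat ((u * (x - a)) mod p)"
    have k: "int k = (u * (x - a)) mod p" using p_pos by (simp add: k_def)
    have "[a + h * int k = a + h * (u * (x - a))] (mod p)"
      unfolding k by (intro cong_add cong_mult cong_refl) (simp add: cong_def)
    also have "a + h * (u * (x - a)) = a + (h * u) * (x - a)" by (simp add: mult.assoc)
    also have "[a + (h * u) * (x - a) = a + 1 * (x - a)] (mod p)"
      by (intro cong_add cong_mult cong_refl u)
    finally have "(a + h * int k) mod p = x mod p" by (simp add: cong_def)
    then show ?thesis using per_cong[OF assms(1)] iter by blast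
  qed
  then show ?thesis by blast
qed

text \<open>Induction on the size of \<open>B\<close>, with a Dyson transform that makes
  \<open>B\<close> smaller but not empty. If \<open>B'\<close> still has \<open>s\<close> elements,
  the transformed pair suffices, as it represents no sum more often. Otherwise each of its sums has
  at most \<open>sz B'\<close> representations, which all count, and the leftover pair supplies the
  remaining level \<open>s - sz B'\<close>.\<close>

theorem pollard:
  assumes "per A" "per B" and "real s \<le> sz A" "real s \<le> sz B" and "sz A + sz B \<le> p + s"
  shows "s * (sz A + sz B - s) \<le> (\<Sum>z\<in>{0..<p}. min (real s) (conv A B z))"
  using assms
proof (induction "card (B \<inter> {0..<p})" arbitrary: A B s rule: less_induct)
  case less
  note [simp] = less.prems(1,2)
  consider "s = 0" | "real s = sz B" | "0 < s" "real s < sz B"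
    using less.prems by linarith
  then show ?case
  proof cases
    case 1
    then show ?thesis by (auto intro!: sum_nonneg)
  next
    case 2
    then have "(\<Sum>z\<in>{0..<p}. min (real s) (conv A B z)) = sz A * sz B"
      using conv_le_right[OF less.prems(2)] by (simp add: min_absorb2 conv_sum)
    then show ?thesis using 2 by (simp add: algebra_simps)
  next
    case 3
    have "sz A < p" using 3 less.prems(5) by simp
    then have "sz (- A) > 0" by (simp add: sz_Compl)
    have "1 < card (B \<inter> {0..<p})" using 3 by (simp add: sz_card)
    then have "\<not> card (B \<inter> {0..<p}) \<le> Suc 0" by simp
    then obtain b b' where b: "b \<in> B" "b' \<in> B" "b \<noteq> b'" "b \<in> {0..<p}" "b' \<in> {0..<p}"
      by (subst (asm) card_le_Suc0_iff_eq) auto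
    then have nd: "\<not> p dvd b' - b" using eq_of_cong[of b' b] by blast
    have "A \<inter> {0..<p} \<noteq> {}" using 3 less.prems(3) by (auto simp: sz_card)
    then obtain a0 where "a0 \<in> A" by blast
    \<comment> \<open>With \<open>e = a - b\<close> the element \<open>b\<close> survives in
      \<open>B'\<close> and \<open>b'\<close> does not. Such an \<open>a\<close> exists because
      \<open>A\<close> is neither empty nor everything.\<close>
    have "\<exists>a. a \<in> A \<and> a + (b' - b) \<notin> A"
    proof (rule ccontr)
      assume "\<not> ?thesis"
      then have "A = UNIV"
        using closed_imp_UNIV[OF less.prems(1) \<open>a0 \<in> A\<close> _ nd] by blast
      then show False using \<open>sz (- A) > 0\<close> by (simp add: sz_def)
    qed
    then obtain a where a: "a \<in> A" "a + (b' - b) \<notin> A" by blast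
    define e where "e = a - b"
    define B' where "B' = B \<inter> shift (- e) A"
    have perB': "per B'" by (simp add: B'_def)
    have "b \<in> B'" using a b by (simp add: B'_def e_def)
    have "b' - - e = a + (b' - b)" by (simp add: e_def)
    then have "b' \<notin> B'" using a(2) unfolding B'_def Int_iff mem_shift by (simp only:) blast
    have lt: "card (B' \<inter> {0..<p}) < card (B \<inter> {0..<p})"
      by (rule psubset_card_mono) (use b \<open>b' \<notin> B'\<close> in \<open>auto simp: B'_def\<close>)
    have ne: "card (B' \<inter> {0..<p}) > 0"
      using b \<open>b \<in> B'\<close> by (auto simp: card_gt_0_iff)
    have "A \<inter> shift e B = shift e B'" by (auto simp: B'_def)
    then have AB: "sz (A \<inter> shift e B) = sz B'" by (simp add: B'_def)
    have sA': "sz (A \<union> shift e B) = sz A + sz B - sz B'"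
      using sz_Un_Int[of A "shift e B"] AB by simp
    have sA'': "sz (A - shift e B) = sz A - sz B'"
      using sz_Int_Diff[of A "shift e B"] AB by simp
    have sB'': "sz (B - shift (- e) A) = sz B - sz B'"
      using sz_Int_Diff[of B "shift (- e) A"] by (simp add: B'_def)
    note dyson = conv_dyson[OF less.prems(1,2), of _ e, folded B'_def]
    show ?thesis
    proof (cases "s \<le> sz B'")
      case True
      have "s * (sz (A \<union> shift e B) + sz B' - s) \<le> (\<Sum>z\<in>{0..<p}. min (real s) (conv (A \<union> shift e B) B' z))"
        by (rule less.hyps[OF lt]) (use True 3 less.prems sA' lt in \<open>auto simp: B'_def sz_card\<close>)
      also have "\<dots> \<le> (\<Sum>z\<in>{0..<p}. min (real s) (conv A B z))"
        by (intro sum_mono min.mono) (auto simp: dyson)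
      finally show ?thesis using sA' by simp
    next
      case False
      define I where "I = card (B' \<inter> {0..<p})"
      have I: "sz B' = real I" by (simp add: I_def sz_card)
      have Is: "I < s" using False I by simp
      have c: "card ((B - shift (- e) A) \<inter> {0..<p}) < card (B \<inter> {0..<p})"
        using sB'' ne I by (simp add: sz_card I_def)
      have "real (s - I) * (sz (A - shift e B) + sz (B - shift (- e) A) - real (s - I)) \<le>
          (\<Sum>z\<in>{0..<p}. min (real (s - I)) (conv (A - shift e B) (B - shift (- e) A) z))"
        by (rule less.hyps[OF c]) (use Is 3 less.prems sA'' sB'' I in auto)
      then have "(s - I) * (sz A + sz B - I - s) + (sz A + sz B - I) * I \<le>
          (\<Sum>z\<in>{0..<p}. conv (A \<union> shift e B) B' z
            + min (real (s - I)) (conv (A - shift e B) (B - shift (- e) A) z))"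
        using conv_sum[OF perB', of "A \<union> shift e B"] Is
        by (simp add: sum.distrib sA' sA'' sB'' I algebra_simps)
      also have "\<dots> \<le> (\<Sum>z\<in>{0..<p}. min (real s) (conv A B z))"
      proof (intro sum_mono)
        fix z
        have "conv (A \<union> shift e B) B' z \<le> I"
          using conv_le_right[OF perB', of "A \<union> shift e B" z] I by simp
        moreover have "real (s - I) = real s - real I" using Is by simp
        moreover have "0 \<le> conv (A - shift e B) (B - shift (- e) A) z" by simp
        ultimately show "conv (A \<union> shift e B) B' z
            + min (real (s - I)) (conv (A - shift e B) (B - shift (- e) A) z) \<le> min (real s) (conv A B z)"
          unfolding dyson[of z] min_def by (auto split: if_splits)
      qed
      finally show ?thesis using Is by (simp add: algebra_simps)
    qed
  qed
qed

lemma triples_nonneg [simp]: "0 \<le> triples A B C"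
  unfolding triples_def by (intro sum_nonneg) auto

text \<open>In Pollard's sum a residue whose negative is outside \<open>C\<close> contributes at
  most \<open>s\<close>, and the others together contribute at most the number of solutions.\<close>

lemma critical_le_nat:
  assumes per: "per A" "per B" "per C" and s: "0 < s" "real s \<le> sz A" "real s \<le> sz B"
    and le: "sz A + sz B \<le> p + s"
  shows "sz A + sz B + sz C \<le> p + s + triples A B C / s"
proof -
  have "s * (sz A + sz B - s) \<le> (\<Sum>z\<in>{0..<p}. min (real s) (conv A B z))"
    using pollard per s le by blast
  also have "\<dots> \<le> (\<Sum>z\<in>{0..<p}. s * of_bool (- z \<in> - C) + of_bool (- z \<in> C) * conv A B z)"
    by (intro sum_mono) (auto simp: of_bool_def)
  also have "\<dots> = s * (p - sz C) + triples A B C"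
    using sum_reflect_set[of "- C" 0] per
    by (simp add: sum.distrib triples_conv sz_Compl flip: sum_distrib_left)
  finally have "s * (sz A + sz B + sz C - p - s) \<le> triples A B C"
    by (simp add: algebra_simps)
  then have "sz A + sz B + sz C - p - s \<le> triples A B C / s"
    using s by (simp add: pos_le_divide_eq mult.commute)
  then show ?thesis by simp
qed

text \<open>The level is \<open>e\<close> rounded up. Having \<open>e * (e - 1)\<close> rather than
  \<open>e * e\<close> pays for the rounding: the level costs at most \<open>e + 1\<close> and the
  solutions cost at most \<open>e - 1\<close>.\<close>

lemma critical_le:
  fixes e :: real
  assumes per: "per A" "per B" "per C" and e: "1 \<le> e" "triples A B C \<le> e * (e - 1)"
    and big: "2 * e \<le> sz A" "2 * e \<le> sz B" and le: "sz A + sz B \<le> p"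
  shows "sz A + sz B + sz C \<le> p + 2 * e"
proof -
  define s where "s = nat \<lceil>e\<rceil>"
  have s: "e \<le> s" "s \<le> e + 1" "0 < s"
    using e by (auto simp: s_def)
  have "sz A + sz B + sz C \<le> p + s + triples A B C / s"
    by (rule critical_le_nat) (use assms s in auto)
  moreover have "triples A B C / s \<le> triples A B C / e"
    using s e by (intro divide_left_mono) auto
  moreover have "triples A B C / e \<le> e - 1"
    using e by (simp add: pos_divide_le_eq mult.commute)
  ultimately show ?thesis using s by linarith
qed


section \<open>Critical triples and almost periods\<close>

lemma triples_swap12: "triples A B C = triples B A C"
proof -
  have "- x - y = - y - x" for x y :: int by simp
  then have "of_bool (x \<in> A) * of_bool (y \<in> B) * of_bool (- x - y \<in> C) =
      (of_bool (y \<in> B) * of_bool (x \<in> A) * of_bool (- y - x \<in> C) :: real)" for x y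
    by (metis mult.commute)
  then show ?thesis unfolding triples_def by (subst sum.swap) (simp only:)
qed

lemma triples_swap23:
  assumes "per B" "per C"
  shows "triples A B C = triples A C B"
proof -
  have "(\<Sum>y\<in>{0..<p}. of_bool (x \<in> A) * of_bool (y \<in> B) * of_bool (- x - y \<in> C) :: real)
      = (\<Sum>y\<in>{0..<p}. of_bool (x \<in> A) * of_bool (y \<in> C) * of_bool (- x - y \<in> B))" for x
  proof -
    define F :: "int \<Rightarrow> real" where
      "F = (\<lambda>y. of_bool (x \<in> A) * of_bool (y \<in> C) * of_bool (- x - y \<in> B))"
    have "F (y + p) = F y" for y
      using perD[OF assms(2), of y] perD_minus[OF assms(1), of "- x - y"] by (simp add: F_def diff_diff_eq)
    from sum_diff[of F "- x", OF this] show ?thesis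
      by (simp add: F_def mult_ac)
  qed
  then show ?thesis unfolding triples_def by (rule sum.cong[OF refl])
qed

lemma triples_shift:
  assumes "per A" "per C"
  shows "triples (shift h A) B (shift (- h) C) = triples A B C"
proof -
  define F :: "int \<Rightarrow> real" where
    "F = (\<lambda>x. \<Sum>y\<in>{0..<p}. of_bool (x \<in> A) * of_bool (y \<in> B) * of_bool (- x - y \<in> C))"
  have "- (x + p) - y = - x - y - p" for x y by simp
  then have "F (x + p) = F x" for x
    unfolding F_def using perD[OF assms(1), of x] perD_minus[OF assms(2), of "- x - _"] by presburger
  from sum_add[of F "- h", OF this]
  have "(\<Sum>x\<in>{0..<p}. F (x - h)) = triples A B C"
    by (simp add: F_def triples_def)
  moreover have "- x - y - - h = - (x - h) - y" for x y :: int by simp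
  ultimately show ?thesis
    by (simp only: triples_def F_def mem_shift)
qed

text \<open>A solution with third entry in \<open>C\<close> is charged to the first triple, one with
  third entry in \<open>C'\<close> to the second; its first entry lies in both \<open>A\<close> and
  \<open>A'\<close>.\<close>

lemma triples_Int_Un: "triples (A \<inter> A') B (C \<union> C') \<le> triples A B C + triples A' B C'"
  unfolding triples_def sum.distrib[symmetric] by (intro sum_mono) auto

lemma triples_Un_Int: "triples (A \<union> A') B (C \<inter> C') \<le> triples A B C + triples A' B C'"
  unfolding triples_def sum.distrib[symmetric] by (intro sum_mono) auto

lemma triples_mono:
  "\<lbrakk>A \<subseteq> A'; B \<subseteq> B'; C \<subseteq> C'\<rbrakk> \<Longrightarrow> triples A B C \<le> triples A' B' C'"
  unfolding triples_def by (intro sum_mono) auto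

text \<open>The number of elements lost under a translation. It is a pseudonorm on the residues,
  being symmetric, subadditive and periodic, and the almost periods are the residues where it is
  small.\<close>

definition defect :: "int set \<Rightarrow> int \<Rightarrow> real" where
  "defect A h = sz (A - shift h A)"

lemma cor_defect: "cor A h = sz A - defect A h"
  using sz_Int_Diff[of A "shift h A"] by (simp add: cor_def defect_def)

lemma defect_nonneg [simp]: "0 \<le> defect A h"
  by (simp add: defect_def)

lemma defect_le: "defect A h \<le> sz A"
  unfolding defect_def by (rule sz_mono) auto

lemma sz_Un_shift: "per A \<Longrightarrow> sz (A \<union> shift h A) = sz A + defect A h"
  using sz_Un_Int[of A "shift h A"] sz_Int_Diff[of A "shift h A"] by (simp add: defect_def)

lemma sz_shift_Diff: "per A \<Longrightarrow> sz (shift h A - A) = defect A h"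
  using sz_Un_Int[of A "shift h A"] sz_Int_Diff[of A "shift h A"] sz_Int_Diff[of "shift h A" A]
  by (simp add: defect_def Int_commute)

lemma defect_uminus: "per A \<Longrightarrow> defect A (- h) = defect A h"
proof -
  assume A: "per A"
  have "shift h (A - shift (- h) A) = shift h A - A" by auto
  then have "sz (A - shift (- h) A) = sz (shift h A - A)"
    using sz_shift[of "A - shift (- h) A" h] A by simp
  then show ?thesis using sz_shift_Diff[OF A, of h] by (simp add: defect_def)
qed

lemma defect_add: "per A \<Longrightarrow> defect A (g + h) \<le> defect A g + defect A h"
proof -
  assume A: "per A"
  have "A - shift (g + h) A \<subseteq> (A - shift g A) \<union> shift g (A - shift h A)"
    by (auto simp: algebra_simps)
  then have "defect A (g + h) \<le> sz ((A - shift g A) \<union> shift g (A - shift h A))"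
    unfolding defect_def by (rule sz_mono)
  also have "\<dots> \<le> sz (A - shift g A) + sz (shift g (A - shift h A))"
    using sz_Un_Int[of "A - shift g A" "shift g (A - shift h A)"] sz_nonneg by smt
  finally show ?thesis using A by (simp add: defect_def)
qed

lemma defect_add_p: "per A \<Longrightarrow> defect A (h + p) = defect A h"
  using perD_minus[of A "_ - h"] by (simp add: defect_def sz_def diff_diff_eq)

lemma defect_zero [simp]: "defect A 0 = 0"
  by (simp add: defect_def sz_def)

text \<open>\<open>cor\<close> counts each ordered pair of elements of \<open>A\<close> at exactly
  one difference. The total rules out that all defects are small.\<close>

lemma defect_sum: "per A \<Longrightarrow> (\<Sum>h\<in>{0..<p}. defect A h) = sz A * (p - sz A)"
proof -
  assume A: "per A"
  have "(\<Sum>h\<in>{0..<p}. cor A h) =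
      (\<Sum>h\<in>{0..<p}. \<Sum>x\<in>{0..<p}. of_bool (x \<in> A) * of_bool (x - h \<in> A))"
    unfolding cor_def sz_def by (intro sum.cong) auto
  also have "\<dots> = (\<Sum>x\<in>{0..<p}. \<Sum>h\<in>{0..<p}. of_bool (x \<in> A) * of_bool (x - h \<in> A))"
    by (rule sum.swap)
  also have "\<dots> = sz A * sz A"
    using sum_reflect_set[OF A] by (simp add: sz_def flip: sum_distrib_left sum_distrib_right)
  finally show ?thesis
    using p_pos by (simp add: cor_defect sum_subtractf algebra_simps)
qed

text \<open>Submodularity: intersecting a critical triple with a translate of itself gives a critical
  triple again, because Pollard's theorem bounds the complementary triple formed by the unions.\<close>

lemma critical_shrink:
  fixes e m :: real
  assumes per: "per X" "per B" "per Z" and e: "1 \<le> e" "2 * triples X B Z \<le> e * (e - 1)"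
    and big: "2 * e \<le> sz X" "2 * e \<le> sz B" and le: "sz X + defect X h + sz B \<le> p"
    and crit: "p - m \<le> sz X + sz B + sz Z"
  defines "X' \<equiv> X \<inter> shift h X" and "Z' \<equiv> Z \<union> shift (- h) Z"
  shows "triples X' B Z' \<le> 2 * triples X B Z" and "p - 2 * m - 2 * e \<le> sz X' + sz B + sz Z'"
proof -
  show "triples X' B Z' \<le> 2 * triples X B Z"
    using triples_Int_Un[of X "shift h X" B Z "shift (- h) Z"] triples_shift[of X Z h B] per
    by (simp add: X'_def Z'_def)
  have "triples (X \<union> shift h X) B (Z \<inter> shift (- h) Z) \<le> 2 * triples X B Z"
    using triples_Un_Int[of X "shift h X" B Z "shift (- h) Z"] triples_shift[of X Z h B] per
    by simp
  then have "sz (X \<union> shift h X) + sz B + sz (Z \<inter> shift (- h) Z) \<le> p + 2 * e"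
  proof (intro critical_le)
    show "2 * e \<le> sz (X \<union> shift h X)"
      using big sz_Un_shift[OF per(1), of h] defect_nonneg[of X h] by linarith
  qed (use per e big le sz_Un_shift[of X h] in auto)
  then show "p - 2 * m - 2 * e \<le> sz X' + sz B + sz Z'"
    using sz_Un_Int[of X "shift h X"] sz_Un_Int[of Z "shift (- h) Z"] per crit
    by (simp add: X'_def Z'_def)
qed

text \<open>Intersecting \<open>A\<close> with its translate loses \<open>defect A h\<close>
  elements, while the union on the side of \<open>C\<close> gains \<open>defect C h\<close> and the
  solutions at most double. Since \<open>critical_le\<close> caps the total, the gain exceeds the
  loss by at most \<open>m + 2 * e\<close>. Thus almost periods pass from one set of a critical
  triple to another.\<close>

lemma critical_defect:
  fixes e m :: real
  assumes per: "per A" "per B" "per C" and e: "1 \<le> e" "2 * triples A B C \<le> e * (e - 1)"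
    and big: "2 * e + defect A h \<le> sz A" "2 * e \<le> sz B" and le: "sz A + sz B \<le> p"
    and crit: "p - m \<le> sz A + sz B + sz C"
  shows "defect C h \<le> defect A h + m + 2 * e"
proof -
  have "triples (A \<inter> shift h A) B (C \<union> shift (- h) C) \<le> 2 * triples A B C"
    using triples_Int_Un[of A "shift h A" B C "shift (- h) C"] triples_shift[of A C h B] per
    by simp
  then have "sz (A \<inter> shift h A) + sz B + sz (C \<union> shift (- h) C) \<le> p + 2 * e"
  proof (intro critical_le)
    show "sz (A \<inter> shift h A) + sz B \<le> p"
      using le cor_defect[of A h] defect_nonneg[of A h] unfolding cor_def by linarith
  qed (use per e big cor_defect[of A h, unfolded cor_def] in auto)
  then show ?thesis
    using sz_Un_shift[of C "- h"] defect_uminus[of C h] cor_defect[of A h] per crit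
    unfolding cor_def by simp
qed

text \<open>The additive energy, grouped by the two elements of \<open>A\<close>: the translates of
  \<open>X\<close> by \<open>x\<close> and \<open>y\<close> share \<open>cor X (x - y)\<close>
  elements.\<close>

lemma conv_square_sum:
  assumes "per X"
  shows "(\<Sum>z\<in>{0..<p}. (conv A X z)\<^sup>2) =
    (\<Sum>x\<in>{0..<p}. \<Sum>y\<in>{0..<p}. of_bool (x \<in> A) * of_bool (y \<in> A) * cor X (x - y))"
proof -
  have inner: "(\<Sum>z\<in>{0..<p}. of_bool (z - x \<in> X) * of_bool (z - y \<in> X)) = cor X (x - y)" for x y
  proof -
    have "shift x X \<inter> shift y X = shift y (X \<inter> shift (x - y) X)" by auto
    then have "sz (shift x X \<inter> shift y X) = cor X (x - y)"
      using sz_shift[of "X \<inter> shift (x - y) X" y] assms by (simp add: cor_def)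
    then show ?thesis by (simp add: sz_def of_bool_conj)
  qed
  have "(\<Sum>z\<in>{0..<p}. (conv A X z)\<^sup>2) = (\<Sum>z\<in>{0..<p}. \<Sum>x\<in>{0..<p}. \<Sum>y\<in>{0..<p}.
      of_bool (x \<in> A) * of_bool (y \<in> A) * (of_bool (z - x \<in> X) * of_bool (z - y \<in> X)))"
    unfolding conv_def power2_eq_square sum_product by (intro sum.cong refl) simp
  also have "\<dots> = (\<Sum>x\<in>{0..<p}. \<Sum>z\<in>{0..<p}. \<Sum>y\<in>{0..<p}.
      of_bool (x \<in> A) * of_bool (y \<in> A) * (of_bool (z - x \<in> X) * of_bool (z - y \<in> X)))"
    by (rule sum.swap)
  also have "\<dots> = (\<Sum>x\<in>{0..<p}. \<Sum>y\<in>{0..<p}. \<Sum>z\<in>{0..<p}.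
      of_bool (x \<in> A) * of_bool (y \<in> A) * (of_bool (z - x \<in> X) * of_bool (z - y \<in> X)))"
    by (intro sum.cong refl sum.swap)
  finally show ?thesis
    by (simp only: inner flip: sum_distrib_left)
qed

text \<open>Otherwise the near-periods of \<open>X\<close> form a subgroup, hence are trivial, and then the
  additive energy of \<open>(A, X)\<close> is too small for almost all sums to lie in a set of size \<open>3|A|\<close>.\<close>

lemma exists_partial_overlap:
  assumes per: "per X" "per A" "per Z" and tri: "triples X A Z \<le> sz X * sz A / 4"
    and small: "p - sz Z \<le> 3 * sz A" and X: "8 < sz X" "sz X \<le> sz A" "4 * sz X \<le> 3 * p"
  shows "\<exists>h. (sz X)\<^sup>2 / (16 * sz A) \<le> cor X h \<and> cor X h \<le> 3 / 4 * sz X"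
proof (rule ccontr)
  define t where "t = (sz X)\<^sup>2 / (16 * sz A)"
  assume "\<not> ?thesis"
  then have gap: "cor X h < t \<or> 3 / 4 * sz X < cor X h" for h
    unfolding t_def by (meson linorder_not_less)
  have t: "t \<le> sz X / 16"
    using X by (auto simp: t_def power2_eq_square field_simps)
  \<comment> \<open>By \<open>gap\<close> an overlap of at least \<open>t\<close> already exceeds
    three quarters of \<open>X\<close>. The sum of two elements of \<open>H\<close> loses less than
    half of \<open>X\<close>, so its overlap is still above \<open>t\<close> and it lies in
    \<open>H\<close> again.\<close>
  define H where "H = {h. defect X h < sz X / 4}"
  have H: "h \<in> H" if "t \<le> cor X h" for h
    using gap[of h] that by (auto simp: H_def cor_defect)
  have triv: "cor X h < t" if "\<not> p dvd h" for h
  proof (rule ccontr)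
    assume "\<not> cor X h < t"
    then have h: "h \<in> H" by (intro H) simp
    have "x + h \<in> H" if "x \<in> H" for x
      using defect_add[OF per(1), of x h] that h X t by (intro H) (simp add: H_def cor_defect)
    moreover have "per H" unfolding per_def H_def using defect_add_p[OF per(1)] by simp
    moreover have "0 \<in> H" using X by (simp add: H_def)
    ultimately have "H = UNIV" using closed_imp_UNIV that by blast
    then have "defect X h < sz X / 4" for h by (auto simp: H_def)
    then have "(\<Sum>h\<in>{0..<p}. defect X h) < (\<Sum>h\<in>{0..<p}. sz X / 4)"
      using p_pos by (intro sum_strict_mono) auto
    then have "sz X * (p - sz X) < sz X * (p / 4)"
      using p_pos by (simp add: defect_sum[OF per(1)] mult.commute)
    then have "p - sz X < p / 4" using X by simp
    then show False using X by simp
  qed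
  have "(\<Sum>z\<in>{0..<p}. (conv A X z)\<^sup>2) \<le> (\<Sum>x\<in>{0..<p}. \<Sum>y\<in>{0..<p}.
      of_bool (x \<in> A) * of_bool (x = y) * sz X + of_bool (x \<in> A) * of_bool (y \<in> A) * t)"
    unfolding conv_square_sum[OF per(1)]
  proof (intro sum_mono)
    fix x y assume xy: "x \<in> {0..<p}" "y \<in> {0..<p}"
    show "of_bool (x \<in> A) * of_bool (y \<in> A) * cor X (x - y) \<le>
        of_bool (x \<in> A) * of_bool (x = y) * sz X + of_bool (x \<in> A) * of_bool (y \<in> A) * t"
    proof (cases "x = y")
      case True
      moreover have "0 \<le> t" by (simp add: t_def)
      ultimately show ?thesis by (simp add: cor_defect)
    next
      case False
      then have "cor X (x - y) < t" using triv eq_of_cong[OF xy] by blast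
      then show ?thesis using False by (auto simp: of_bool_def)
    qed
  qed
  also have "\<dots> = sz A * sz X + (sz A)\<^sup>2 * t"
  proof -
    have "(\<Sum>x\<in>{0..<p}. \<Sum>y\<in>{0..<p}. of_bool (x \<in> A) * of_bool (x = y) * sz X) = sz A * sz X"
    proof -
      have "(\<Sum>y\<in>{0..<p}. of_bool (x \<in> A) * of_bool (x = y) * sz X) = of_bool (x \<in> A) * sz X"
        if "x \<in> {0..<p}" for x
        using that by (simp add: of_bool_def if_distrib[of "\<lambda>u. u * _"] cong: if_cong)
      then have "(\<Sum>x\<in>{0..<p}. \<Sum>y\<in>{0..<p}. of_bool (x \<in> A) * of_bool (x = y) * sz X) =
          (\<Sum>x\<in>{0..<p}. of_bool (x \<in> A) * sz X)"
        by (rule sum.cong[OF refl])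
      then show ?thesis by (simp add: sz_def[of A] sum_distrib_right)
    qed
    moreover have "(\<Sum>x\<in>{0..<p}. \<Sum>y\<in>{0..<p}. of_bool (x \<in> A) * of_bool (y \<in> A) * t) = (sz A)\<^sup>2 * t"
      by (simp add: sz_def power2_eq_square sum_product flip: sum_distrib_right)
    ultimately show ?thesis by (simp add: sum.distrib)
  qed
  also have "(sz A)\<^sup>2 * t = (sz X)\<^sup>2 * sz A / 16"
    using X by (simp add: t_def power2_eq_square)
  finally have upper: "(\<Sum>z\<in>{0..<p}. (conv A X z)\<^sup>2) \<le> sz A * sz X + (sz X)\<^sup>2 * sz A / 16" .
  \<comment> \<open>At least three quarters of the pairs have their sum among at most
    \<open>3 * sz A\<close> residues, so \<open>c\<close> is a lower bound for the mean number of
    representations there. The tangent to the square at \<open>c\<close> takes the place of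
    Cauchy-Schwarz.\<close>
  define c where "c = sz X / 4"
  have sqr: "2 * c * r - c\<^sup>2 \<le> r\<^sup>2" for r :: real
    using zero_le_power2[of "r - c"] by (simp add: power2_diff algebra_simps)
  have "2 * c * (sz A * sz X - triples A X Z) - c\<^sup>2 * (p - sz Z) =
      (\<Sum>z\<in>{0..<p}. of_bool (- z \<in> - Z) * (2 * c * conv A X z - c\<^sup>2))"
  proof -
    have "(\<Sum>z\<in>{0..<p}. of_bool (- z \<in> - Z) * conv A X z) = sz A * sz X - triples A X Z"
    proof -
      have "(\<Sum>z\<in>{0..<p}. of_bool (- z \<in> - Z) * conv A X z) + triples A X Z = (\<Sum>z\<in>{0..<p}. conv A X z)"
        unfolding triples_conv[OF per(1,3)] sum.distrib[symmetric] by (intro sum.cong) auto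
      then show ?thesis using conv_sum[OF per(1), of A] by simp
    qed
    moreover have "(\<Sum>z\<in>{0..<p}. of_bool (- z \<in> - Z)) = p - sz Z"
      using sum_reflect_set[of "- Z" 0] per by (simp add: sz_Compl)
    moreover have "(\<Sum>z\<in>{0..<p}. of_bool (- z \<in> - Z) * (2 * c * conv A X z - c\<^sup>2)) =
        2 * c * (\<Sum>z\<in>{0..<p}. of_bool (- z \<in> - Z) * conv A X z)
          - c\<^sup>2 * (\<Sum>z\<in>{0..<p}. of_bool (- z \<in> - Z))"
      unfolding sum_distrib_left sum_subtractf[symmetric] by (intro sum.cong refl) (simp add: algebra_simps)
    ultimately show ?thesis by simp
  qed
  also have "\<dots> \<le> (\<Sum>z\<in>{0..<p}. (conv A X z)\<^sup>2)"
    using sqr by (intro sum_mono) (auto simp: of_bool_def)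
  finally have lower: "2 * c * (sz A * sz X - triples A X Z) - c\<^sup>2 * (p - sz Z)
      \<le> (\<Sum>z\<in>{0..<p}. (conv A X z)\<^sup>2)" .
  have "2 * c * (3 / 4 * (sz X * sz A)) \<le> 2 * c * (sz A * sz X - triples A X Z)"
    using tri triples_swap12[of A X Z] X by (intro mult_left_mono) (auto simp: c_def algebra_simps)
  moreover have "c\<^sup>2 * (p - sz Z) \<le> c\<^sup>2 * (3 * sz A)"
    using small by (intro mult_left_mono) auto
  ultimately have "2 * c * (3 / 4 * (sz X * sz A)) - c\<^sup>2 * (3 * sz A) \<le>
      sz A * sz X + (sz X)\<^sup>2 * sz A / 16"
    using lower upper by linarith
  then have "sz A * sz X * (sz X / 8) \<le> sz A * sz X * 1"
    by (simp add: c_def power2_eq_square algebra_simps)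
  then have "sz X / 8 \<le> 1" using X mult_le_cancel_left_pos[of "sz A * sz X"] by simp
  then show False using X by simp
qed

text \<open>Each round keeps at most 3/4 of \<open>X\<close> and doubles both the bound on the
  solutions and \<open>m + 2 * e\<close>; hence the powers of 4/3 and 2. \<open>X\<close> cannot
  collapse, because a round only starts above \<open>\<tau> * sz A\<close> and so keeps at least
  \<open>(\<tau> * sz A)\<^sup>2 / (16 * sz A)\<close> elements.\<close>

lemma exists_small_critical:
  fixes e \<tau> m :: real
  assumes per: "per X" "per A" "per Z" and e: "1 \<le> e" "2 ^ i * triples X A Z \<le> e * (e - 1)"
    and \<tau>: "0 < \<tau>" "8 \<le> \<tau> * sz A" "2 * e \<le> \<tau>\<^sup>2 / 16 * sz A"
    and X: "sz X \<le> \<tau> * sz A * (4 / 3) ^ i" "\<tau>\<^sup>2 / 16 * sz A \<le> sz X" "sz X \<le> sz A" "2 * sz X + sz A \<le> p"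
    and m: "0 \<le> m" "2 ^ i * (m + 2 * e) \<le> sz A" "p - m \<le> sz X + sz A + sz Z"
  shows "\<exists>X' Z'. per X' \<and> per Z' \<and> \<tau>\<^sup>2 / 16 * sz A \<le> sz X' \<and> sz X' \<le> \<tau> * sz A \<and>
    triples X' A Z' \<le> 2 ^ i * triples X A Z \<and> p - 2 ^ i * (m + 2 * e) \<le> sz X' + sz A + sz Z'"
  using per(1,3) e(2) X m
proof (induction i arbitrary: X Z m)
  case 0
  show ?case by (rule exI[of _ X], rule exI[of _ Z]) (use 0 e in auto)
next
  case (Suc i)
  have pow: "1 \<le> (2::real) ^ i" by simp
  show ?case
  proof (cases "sz X \<le> \<tau> * sz A")
    case True
    have le: "1 * triples X A Z \<le> 2 ^ Suc i * triples X A Z" "1 * (m + 2 * e) \<le> 2 ^ Suc i * (m + 2 * e)"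
      using pow Suc.prems(8) e one_le_power[of "2 :: real" "Suc i"]
      by (intro mult_right_mono; simp)+
    have "p - 2 ^ Suc i * (m + 2 * e) \<le> sz X + sz A + sz Z"
    proof -
      have "m \<le> 1 * (m + 2 * e)" using e by simp
      then have "m \<le> 2 ^ Suc i * (m + 2 * e)" using le(2) by (rule order_trans)
      from diff_left_mono[OF this] show ?thesis using Suc.prems(10) by (rule order_trans)
    qed
    then show ?thesis using True Suc.prems le(1) by (metis mult_1)
  next
    case False
    have m: "m + 2 * e \<le> sz A" "m \<le> sz A"
    proof -
      have "1 * (m + 2 * e) \<le> 2 ^ Suc i * (m + 2 * e)"
        using Suc.prems(8) e one_le_power[of "2 :: real" "Suc i"] by (intro mult_right_mono) auto
      then show "m + 2 * e \<le> sz A" using Suc.prems(9) by simp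
      then show "m \<le> sz A" using e by simp
    qed
    have big: "2 * e \<le> sz X" "2 * e \<le> sz A" using \<tau> Suc.prems m by linarith+
    have T2: "2 * triples X A Z \<le> 2 ^ Suc i * triples X A Z"
      using pow by (intro mult_right_mono) auto
    then have T: "2 * triples X A Z \<le> e * (e - 1)" using Suc.prems(3) by linarith
    have "e * e \<le> (sz X / 2) * (sz A / 2)"
      using big e by (intro mult_mono) auto
    moreover have "e * (e - 1) \<le> e * e" using e by (intro mult_left_mono) auto
    moreover have "0 \<le> e * e" by simp
    ultimately have tri: "triples X A Z \<le> sz X * sz A / 4"
      using T by linarith
    have "\<exists>h. (sz X)\<^sup>2 / (16 * sz A) \<le> cor X h \<and> cor X h \<le> 3 / 4 * sz X"
    proof (rule exists_partial_overlap)
      show "p - sz Z \<le> 3 * sz A" using Suc.prems(6,10) m by linarith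
      show "8 < sz X" using False \<tau> by linarith
      show "4 * sz X \<le> 3 * p" using Suc.prems(6,7) p_pos by simp
    qed (use tri Suc.prems per in auto)
    then obtain h where h: "(sz X)\<^sup>2 / (16 * sz A) \<le> cor X h" "cor X h \<le> 3 / 4 * sz X" by blast
    define X' Z' where "X' = X \<inter> shift h X" and "Z' = Z \<union> shift (- h) Z"
    have szX': "sz X' = cor X h" by (simp add: X'_def cor_def)
    have "sz X + defect X h + sz A \<le> p" using defect_le[of X h] Suc.prems(7) by simp
    note step = critical_shrink[OF Suc.prems(1) per(2) Suc.prems(2) e(1) T big this Suc.prems(10),
        folded X'_def Z'_def]
    have T': "2 ^ i * triples X' A Z' \<le> 2 ^ Suc i * triples X A Z"
      using mult_left_mono[OF step(1), of "2 ^ i"] by (simp add: mult_ac)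
    have "(\<tau> * sz A)\<^sup>2 / (16 * sz A) \<le> (sz X)\<^sup>2 / (16 * sz A)"
      using False \<tau> by (intro divide_right_mono power_mono) auto
    moreover have "(\<tau> * sz A)\<^sup>2 / (16 * sz A) = \<tau>\<^sup>2 / 16 * sz A"
      using big e by (simp add: power2_eq_square)
    ultimately have lowX': "\<tau>\<^sup>2 / 16 * sz A \<le> sz X'" using h szX' by simp
    have "\<exists>X'' Z''. per X'' \<and> per Z'' \<and> \<tau>\<^sup>2 / 16 * sz A \<le> sz X'' \<and> sz X'' \<le> \<tau> * sz A \<and>
        triples X'' A Z'' \<le> 2 ^ i * triples X' A Z' \<and>
        p - 2 ^ i * ((2 * m + 2 * e) + 2 * e) \<le> sz X'' + sz A + sz Z''"
    proof (rule Suc.IH)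
      show "2 ^ i * triples X' A Z' \<le> e * (e - 1)" using T' Suc.prems(3) by (rule order_trans)
      show "sz X' \<le> \<tau> * sz A * (4 / 3) ^ i" using h szX' Suc.prems(4) by simp
      have "sz X' \<le> sz X" by (rule sz_mono) (auto simp: X'_def)
      then show "sz X' \<le> sz A" "2 * sz X' + sz A \<le> p" using Suc.prems(6,7) by linarith+
      show "2 ^ i * (2 * m + 2 * e + 2 * e) \<le> sz A" using Suc.prems(9) by (simp add: algebra_simps)
      show "p - (2 * m + 2 * e) \<le> sz X' + sz A + sz Z'" using step(2) by simp
    qed (use lowX' Suc.prems e in \<open>auto simp: X'_def Z'_def\<close>)
    then obtain X'' Z'' where XZ: "per X''" "per Z''" "\<tau>\<^sup>2 / 16 * sz A \<le> sz X''" "sz X'' \<le> \<tau> * sz A"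
        "triples X'' A Z'' \<le> 2 ^ i * triples X' A Z'"
        "p - 2 ^ i * ((2 * m + 2 * e) + 2 * e) \<le> sz X'' + sz A + sz Z''" by blast
    have "triples X'' A Z'' \<le> 2 ^ Suc i * triples X A Z"
      using XZ(5) T' by (rule order_trans)
    moreover have "p - 2 ^ Suc i * (m + 2 * e) \<le> sz X'' + sz A + sz Z''"
      using XZ(6) by (simp add: algebra_simps)
    ultimately show ?thesis using XZ(1-4) by blast
  qed
qed

text \<open>Discarding the \<open>x\<close> that occur in more than \<open>e\<close> solutions costs
  at most \<open>e - 1\<close> elements. For the others the translate of \<open>A\<close> by
  \<open>x\<close> lies, up to \<open>e\<close> elements, in the set of \<open>z\<close> with
  \<open>- z\<close> outside \<open>Z\<close>, which is larger than \<open>A\<close> by at most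
  \<open>sz X + m\<close>. Two translates confined to such a set overlap almost completely.\<close>

lemma critical_near_periods:
  fixes e m :: real
  assumes per: "per X" "per A" "per Z" and e: "1 \<le> e" "triples X A Z \<le> e * (e - 1)"
    and crit: "p - m \<le> sz X + sz A + sz Z"
  shows "\<exists>X'\<subseteq>X. per X' \<and> sz X - e \<le> sz X' \<and>
    (\<forall>x\<in>X'. \<forall>y\<in>X'. defect A (x - y) \<le> sz X + m + 2 * e)"
proof -
  define row where "row x = sz (A \<inter> {y. - x - y \<in> Z})" for x
  define X' where "X' = {x \<in> X. row x \<le> e}"
  have "- (x + p) - y = - x - y - p" for x y by simp
  then have "row (x + p) = row x" for x
    using perD_minus[OF per(3)] by (simp only: row_def)
  then have perX': "per X'" using perD[OF per(1)] by (simp add: per_def X'_def)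
  have "e * sz (X - X') = (\<Sum>x\<in>{0..<p}. of_bool (x \<in> X - X') * e)"
    by (simp add: sz_def sum_distrib_left mult.commute)
  also have "\<dots> \<le> (\<Sum>x\<in>{0..<p}. of_bool (x \<in> X) * row x)"
    by (intro sum_mono) (auto simp: X'_def row_def)
  also have "\<dots> = triples X A Z"
    unfolding triples_def row_def sz_def sum_distrib_left
    by (intro sum.cong refl) (auto simp: of_bool_def)
  finally have "sz (X - X') \<le> e - 1" using e by (smt (verit) mult_le_cancel_left)
  moreover have "sz X = sz X' + sz (X - X')"
    using sz_Int_Diff[of X X'] by (simp add: X'_def Int_def)
  ultimately have "sz X - e \<le> sz X'" by simp
  moreover have "defect A (x - y) \<le> sz X + m + 2 * e" if "x \<in> X'" "y \<in> X'" for x y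
  proof -
    have row: "sz (shift x A \<inter> {z. - z \<in> Z}) = row x" for x
    proof -
      have "shift x A \<inter> {z. - z \<in> Z} = shift x (A \<inter> {y. - x - y \<in> Z})"
        by (auto simp: algebra_simps)
      then show ?thesis using sz_shift[of "A \<inter> {y. - x - y \<in> Z}" x] per by (simp add: row_def)
    qed
    have "shift x A \<union> shift y A = shift y (A \<union> shift (x - y) A)" by auto
    then have "sz A + defect A (x - y) = sz (shift x A \<union> shift y A)"
      using sz_shift[of "A \<union> shift (x - y) A" y] sz_Un_shift per by simp
    also have "\<dots> \<le> sz ({z. - z \<in> - Z} \<union> (shift x A \<inter> {z. - z \<in> Z} \<union> shift y A \<inter> {z. - z \<in> Z}))"
      by (rule sz_mono) auto
    also have "\<dots> \<le> sz {z. - z \<in> - Z} + (row x + row y)"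
      using sz_Un_Int[of "{z. - z \<in> - Z}" "shift x A \<inter> {z. - z \<in> Z} \<union> shift y A \<inter> {z. - z \<in> Z}"]
        sz_Un_Int[of "shift x A \<inter> {z. - z \<in> Z}" "shift y A \<inter> {z. - z \<in> Z}"]
        row[of x] row[of y] sz_nonneg by smt
    also have "\<dots> \<le> (p - sz Z) + 2 * e"
      using that sz_uminus[of "- Z"] per by (simp add: sz_Compl X'_def)
    finally show ?thesis using crit by simp
  qed
  ultimately show ?thesis using perX' by (intro exI[of _ X']) (auto simp: X'_def)
qed


text \<open>The almost period \<open>g\<close> of \<open>B\<close> is also one of \<open>A\<close>,
  so the defect of \<open>A\<close> changes slowly along the multiples of \<open>g\<close>. Its mean
  is large, hence it crosses \<delta>p somewhere. Shrinking at the crossing removes between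
  \<delta>p and 2\<delta>p elements, so \<open>p / 3\<close> is not undershot by more than
  2\<delta>p.\<close>

lemma critical_balance:
  fixes e m \<delta> :: real
  assumes per: "per A" "per B" "per C" and e: "1 \<le> e" "2 ^ i * triples A B C \<le> e * (e - 1)"
    and \<delta>: "0 < \<delta>" "\<delta> \<le> 1 / 100" and g: "\<not> p dvd g" "defect B g \<le> \<delta> * p / 2"
    and A: "sz A \<le> p / 3 + i * (\<delta> * p)" "p / 3 - 2 * \<delta> * p \<le> sz A" "sz A \<le> p / 2"
    and B: "p / 4 \<le> sz B" "sz A + sz B + 2 * \<delta> * p \<le> p"
    and m: "0 \<le> m" "2 ^ i * (m + 2 * e) \<le> \<delta> * p / 2" "p - m \<le> sz A + sz B + sz C"
  shows "\<exists>A' C'. per A' \<and> per C' \<and> p / 3 - 2 * \<delta> * p \<le> sz A' \<and> sz A' \<le> p / 3 \<and>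
    triples A' B C' \<le> 2 ^ i * triples A B C \<and> p - 2 ^ i * (m + 2 * e) \<le> sz A' + sz B + sz C'"
  using per(1,3) e(2) A B(2) m
proof (induction i arbitrary: A C m)
  case 0
  show ?case by (rule exI[of _ A], rule exI[of _ C]) (use 0 e in auto)
next
  case (Suc i)
  show ?case
  proof (cases "sz A \<le> p / 3")
    case True
    have le: "1 * triples A B C \<le> 2 ^ Suc i * triples A B C" "1 * (m + 2 * e) \<le> 2 ^ Suc i * (m + 2 * e)"
      using Suc.prems(8) e one_le_power[of "2 :: real" "Suc i"] by (intro mult_right_mono; simp)+
    have "p - 2 ^ Suc i * (m + 2 * e) \<le> sz A + sz B + sz C"
    proof -
      have "m \<le> 1 * (m + 2 * e)" using e by simp
      then have "m \<le> 2 ^ Suc i * (m + 2 * e)" using le(2) by (rule order_trans)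
      from diff_left_mono[OF this] show ?thesis using Suc.prems(10) by (rule order_trans)
    qed
    then show ?thesis using True Suc.prems le(1) by (metis mult_1)
  next
    case False
    have "1 * (m + 2 * e) \<le> 2 ^ Suc i * (m + 2 * e)"
      using Suc.prems(8) e one_le_power[of "2 :: real" "Suc i"] by (intro mult_right_mono) auto
    then have m: "m + 2 * e \<le> \<delta> * p / 2" using Suc.prems(9) by simp
    have dp: "\<delta> * p \<le> p / 100" "0 < \<delta> * p"
      using \<delta> p_pos mult_right_mono[of \<delta> "1 / 100" p] by auto
    have big: "2 * e \<le> sz A" "2 * e + defect B g \<le> sz B" "2 * e \<le> sz C" "2 * e \<le> sz B"
      using m False dp B(1) g(2) Suc.prems by (simp_all add: algebra_simps)
    have "1 * (2 * triples A B C) \<le> 2 ^ i * (2 * triples A B C)"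
      by (intro mult_right_mono) auto
    then have T: "2 * triples A B C \<le> e * (e - 1)" using Suc.prems(3) by simp
    have "sz A + sz B + sz C \<le> p + 2 * e"
    proof (rule critical_le)
      show "triples A B C \<le> e * (e - 1)" using T triples_nonneg[of A B C] by linarith
    qed (use big e Suc.prems per dp in auto)
    then have BC: "sz B + sz C \<le> p" using big by simp
    have "defect A g \<le> defect B g + m + 2 * e"
    proof (rule critical_defect[where B = C])
      show "2 * triples B C A \<le> e * (e - 1)"
        using T triples_swap12[of A B C] triples_swap23[of A C B] Suc.prems per by simp
    qed (use per Suc.prems e big BC in auto)
    then have g': "defect A g \<le> \<delta> * p" using g m by simp
    have "\<exists>x. defect A x \<le> \<delta> * p \<and> \<delta> * p < defect A (x + g)"
    proof (rule ccontr)
      assume neg: "\<not> ?thesis"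
      define H where "H = {h. defect A h \<le> \<delta> * p}"
      have "per H" unfolding per_def H_def using defect_add_p[OF Suc.prems(1)] by simp
      moreover have "0 \<in> H" using \<delta> p_pos by (simp add: H_def)
      moreover have "x + g \<in> H" if "x \<in> H" for x using neg that by (auto simp: H_def not_less)
      ultimately have "H = UNIV" using closed_imp_UNIV g(1) by blast
      then have "defect A h \<le> \<delta> * p" for h by (auto simp: H_def)
      then have "(\<Sum>h\<in>{0..<p}. defect A h) \<le> (\<Sum>h\<in>{0..<p}. \<delta> * p)"
        by (intro sum_mono) auto
      then have "sz A * (p - sz A) \<le> p * (\<delta> * p)"
        using p_pos by (simp add: defect_sum[OF Suc.prems(1)])
      also have "\<dots> \<le> p * (p / 100)" using dp p_pos by (intro mult_left_mono) auto
      finally have "sz A * (p - sz A) \<le> p * (p / 100)" .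
      moreover have "p / 3 * (p / 2) \<le> sz A * (p - sz A)"
        using False Suc.prems(6) p_pos by (intro mult_mono) auto
      ultimately have "(1 / 6 - 1 / 100) * (real_of_int p * real_of_int p) \<le> 0"
        by (simp add: algebra_simps)
      then show False using p_pos by (simp add: mult_le_0_iff)
    qed
    then obtain x where x: "defect A x \<le> \<delta> * p" "\<delta> * p < defect A (x + g)" by blast
    define h where "h = x + g"
    have h: "\<delta> * p < defect A h" "defect A h \<le> 2 * (\<delta> * p)"
      using x g' defect_add[OF Suc.prems(1), of x g] by (simp_all add: h_def)
    define A' C' where "A' = A \<inter> shift h A" and "C' = C \<union> shift (- h) C"
    have szA': "sz A' = sz A - defect A h" using cor_defect[of A h] by (simp add: A'_def cor_def)
    have "sz A + defect A h + sz B \<le> p" using h Suc.prems(7) by simp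
    note step = critical_shrink[OF Suc.prems(1) per(2) Suc.prems(2) e(1) T big(1,4) this Suc.prems(10),
        folded A'_def C'_def]
    have T': "2 ^ i * triples A' B C' \<le> 2 ^ Suc i * triples A B C"
      using mult_left_mono[OF step(1), of "2 ^ i"] by (simp add: mult_ac)
    have "\<exists>A'' C''. per A'' \<and> per C'' \<and> p / 3 - 2 * \<delta> * p \<le> sz A'' \<and> sz A'' \<le> p / 3 \<and>
        triples A'' B C'' \<le> 2 ^ i * triples A' B C' \<and>
        p - 2 ^ i * ((2 * m + 2 * e) + 2 * e) \<le> sz A'' + sz B + sz C''"
    proof (rule Suc.IH)
      show "2 ^ i * triples A' B C' \<le> e * (e - 1)" using T' Suc.prems(3) by (rule order_trans)
      show "sz A' \<le> p / 3 + i * (\<delta> * p)" using szA' h Suc.prems(4) by (simp add: algebra_simps)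
      show "2 ^ i * (2 * m + 2 * e + 2 * e) \<le> \<delta> * p / 2" using Suc.prems(9) by (simp add: algebra_simps)
      show "p / 3 - 2 * \<delta> * p \<le> sz A'" using szA' h False by simp
      show "sz A' \<le> p / 2" "sz A' + sz B + 2 * \<delta> * p \<le> p" using szA' h dp Suc.prems(6,7) by linarith+
      show "p - (2 * m + 2 * e) \<le> sz A' + sz B + sz C'" using step(2) by simp
    qed (use Suc.prems e in \<open>auto simp: A'_def C'_def\<close>)
    then obtain A'' C'' where AC: "per A''" "per C''" "p / 3 - 2 * \<delta> * p \<le> sz A''" "sz A'' \<le> p / 3"
        "triples A'' B C'' \<le> 2 ^ i * triples A' B C'"
        "p - 2 ^ i * ((2 * m + 2 * e) + 2 * e) \<le> sz A'' + sz B + sz C''" by blast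
    have "triples A'' B C'' \<le> 2 ^ Suc i * triples A B C" using AC(5) T' by (rule order_trans)
    moreover have "p - 2 ^ Suc i * (m + 2 * e) \<le> sz A'' + sz B + sz C''"
      using AC(6) by (simp add: algebra_simps)
    ultimately show ?thesis using AC(1-4) by blast
  qed
qed

section \<open>Fourier coefficients\<close>

lemma of_real_of_bool [simp]: "of_real (of_bool b) = of_bool b"
  by (cases b) simp_all

definition chi :: "int \<Rightarrow> complex" where
  "chi k = cis (2 * pi * k / p)"

definition ft :: "int set \<Rightarrow> int \<Rightarrow> complex" where
  "ft A k = (\<Sum>x\<in>{0..<p}. of_bool (x \<in> A) * chi (k * x))"

lemma chi_add: "chi (a + b) = chi a * chi b"
  by (simp add: chi_def cis_mult ring_distribs add_divide_distrib)

lemma chi_zero [simp]: "chi 0 = 1"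
  by (simp add: chi_def)

lemma norm_chi [simp]: "norm (chi k) = 1"
  by (simp add: chi_def)

lemma chi_p_mult [simp]: "chi (p * k) = 1"
proof -
  have "2 * pi * real_of_int (p * k) / real_of_int p = 2 * pi * real_of_int k"
    using p_pos by simp
  then show ?thesis by (simp only: chi_def cis_multiple_2pi Ints_of_int)
qed

lemma chi_minus: "chi (- k) = cnj (chi k)"
  by (simp add: chi_def cis_cnj)

lemma chi_add_p: "chi (k * (x + p)) = chi (k * x)"
  using chi_p_mult[of k] by (simp add: ring_distribs chi_add mult.commute)

lemma chi_neq_1: "\<not> p dvd k \<Longrightarrow> chi k \<noteq> 1"
proof
  assume nd: "\<not> p dvd k" and "chi k = 1"
  then have "cos (2 * pi * k / p) = 1" by (simp add: chi_def complex_eq_iff)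
  then obtain n :: int where "2 * pi * k / p = real_of_int n * 2 * pi"
    by (auto simp: cos_one_2pi_int)
  then have "real_of_int k = real_of_int n * p" using p_pos by (simp add: field_simps)
  then have "k = n * p" by (metis of_int_eq_iff of_int_mult)
  then show False using nd by simp
qed

lemma chi_sum: "(\<Sum>k\<in>{0..<p}. chi (k * m)) = (if p dvd m then of_int p else 0)"
proof (cases "p dvd m")
  case True
  then obtain n where n: "m = p * n" by blast
  have "chi (k * m) = 1" for k using chi_p_mult[of "k * n"] by (simp add: n mult.left_commute)
  then show ?thesis using p_pos True by simp
next
  case False
  have "(\<Sum>k\<in>{0..<p}. chi ((k + 1) * m)) = (\<Sum>k\<in>{0..<p}. chi (k * m))"
    by (rule sum_add[of "\<lambda>k. chi (k * m)"]) (metis chi_add_p mult.commute)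
  then have "(\<Sum>k\<in>{0..<p}. chi (k * m)) * (chi m - 1) = 0"
    by (simp add: ring_distribs chi_add sum_distrib_right)
  then show ?thesis using chi_neq_1[OF False] False by simp
qed

lemma fourier_inversion:
  fixes f :: "int \<Rightarrow> complex"
  assumes "\<And>x. f (x + p) = f x"
  shows "(\<Sum>k\<in>{0..<p}. (\<Sum>x\<in>{0..<p}. f x * chi (k * x)) * chi (- (k * m))) = p * f m"
proof -
  define F where "F x = f x * (if p dvd x - m then of_int p else 0)" for x
  have perF: "F (x + p) = F x" for x
  proof -
    have "p dvd x + p - m \<longleftrightarrow> p dvd x - m"
      using dvd_add_left_iff[of p p "x - m"] by (simp add: algebra_simps)
    then show ?thesis using assms by (simp add: F_def)
  qed
  have chi: "chi (k * x) * chi (- (k * m)) = chi (k * (x - m))" for k x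
    by (simp add: algebra_simps flip: chi_add)
  have "(\<Sum>k\<in>{0..<p}. (\<Sum>x\<in>{0..<p}. f x * chi (k * x)) * chi (- (k * m))) =
      (\<Sum>k\<in>{0..<p}. \<Sum>x\<in>{0..<p}. f x * chi (k * (x - m)))"
    by (simp only: sum_distrib_right mult.assoc chi)
  also have "\<dots> = (\<Sum>x\<in>{0..<p}. \<Sum>k\<in>{0..<p}. f x * chi (k * (x - m)))"
    by (rule sum.swap)
  also have "\<dots> = (\<Sum>x\<in>{0..<p}. F x)"
    by (simp only: F_def chi_sum flip: sum_distrib_left)
  also have "\<dots> = (\<Sum>x\<in>{0..<p}. F (x + m))"
    using sum_add[of F m, OF perF] by simp
  also have "\<dots> = (\<Sum>x\<in>{0..<p}. if x = 0 then F m else 0)"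
    using eq_of_cong[of _ 0] p_pos by (intro sum.cong) (auto simp: F_def)
  also have "\<dots> = F m" using p_pos by simp
  finally show ?thesis by (simp add: F_def mult.commute)
qed

lemma ft_mult:
  assumes "per B"
  shows "ft A k * ft B k = (\<Sum>z\<in>{0..<p}. of_real (conv A B z) * chi (k * z))"
proof -
  have inner: "(\<Sum>z\<in>{0..<p}. of_bool (z - x \<in> B) * chi (k * z)) = chi (k * x) * ft B k" for x
  proof -
    have "(\<Sum>z\<in>{0..<p}. of_bool (z + x - x \<in> B) * chi (k * (z + x))) =
        (\<Sum>z\<in>{0..<p}. of_bool (z - x \<in> B) * chi (k * z))"
      by (rule sum_add[of "\<lambda>z. of_bool (z - x \<in> B) * chi (k * z)"])
         (use perD[OF assms, of "_ - x"] in \<open>simp add: diff_add_eq chi_add_p\<close>)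
    then show ?thesis by (simp add: ft_def ring_distribs chi_add sum_distrib_left mult_ac)
  qed
  have "(\<Sum>z\<in>{0..<p}. of_real (conv A B z) * chi (k * z)) = (\<Sum>z\<in>{0..<p}. \<Sum>x\<in>{0..<p}.
      of_bool (x \<in> A) * (of_bool (z - x \<in> B) * chi (k * z)))"
    by (simp add: conv_def sum_distrib_right mult.assoc)
  also have "\<dots> = (\<Sum>x\<in>{0..<p}. \<Sum>z\<in>{0..<p}.
      of_bool (x \<in> A) * (of_bool (z - x \<in> B) * chi (k * z)))"
    by (rule sum.swap)
  also have "\<dots> = ft A k * ft B k"
    by (simp add: inner ft_def sum_distrib_right mult.assoc flip: sum_distrib_left)
  finally show ?thesis by simp
qed

lemma ft_triples:
  assumes "per A" "per B" "per C"
  shows "(\<Sum>k\<in>{0..<p}. ft A k * ft B k * ft C k) = of_real (p * triples A B C)"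
proof -
  have S: "(\<Sum>z\<in>{0..<p}. of_bool (z \<in> C) * conv A B (- z)) = triples A B C"
  proof -
    define F :: "int \<Rightarrow> real" where "F z = of_bool (- z \<in> C) * conv A B z" for z
    have "F (z + p) = F z" for z
      using conv_add_p[OF assms(2), of A z] perD_minus[OF assms(3), of "- z"] by (simp add: F_def)
    from sum_diff[of F 0, OF this] show ?thesis
      by (simp add: triples_conv assms F_def)
  qed
  have "(\<Sum>k\<in>{0..<p}. ft A k * ft B k * ft C k) = (\<Sum>k\<in>{0..<p}. \<Sum>z\<in>{0..<p}.
      of_bool (z \<in> C) * ((\<Sum>x\<in>{0..<p}. of_real (conv A B x) * chi (k * x)) * chi (- (k * (- z)))))"
    unfolding ft_mult[OF assms(2)] ft_def[of C] sum_distrib_left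
    by (intro sum.cong refl) (simp add: mult_ac)
  also have "\<dots> = (\<Sum>z\<in>{0..<p}. \<Sum>k\<in>{0..<p}.
      of_bool (z \<in> C) * ((\<Sum>x\<in>{0..<p}. of_real (conv A B x) * chi (k * x)) * chi (- (k * (- z)))))"
    by (rule sum.swap)
  also have "\<dots> = (\<Sum>z\<in>{0..<p}. of_bool (z \<in> C) * (complex_of_int p * complex_of_real (conv A B (- z))))"
    using conv_add_p[OF assms(2)]
    by (simp only: fourier_inversion[of "\<lambda>x. of_real (conv A B x)"] flip: sum_distrib_left)
  also have "\<dots> = of_real (p * triples A B C)"
    unfolding S[symmetric] by (simp add: sum_distrib_left mult_ac)
  finally show ?thesis .
qed

lemma parseval:
  assumes "per A"
  shows "(\<Sum>k\<in>{0..<p}. (norm (ft A k))\<^sup>2) = p * sz A"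
proof -
  have "complex_of_real (\<Sum>k\<in>{0..<p}. (norm (ft A k))\<^sup>2) = (\<Sum>k\<in>{0..<p}. ft A k * cnj (ft A k))"
    by (simp only: of_real_sum complex_norm_square)
  also have "\<dots> = (\<Sum>k\<in>{0..<p}. \<Sum>z\<in>{0..<p}.
      of_bool (z \<in> A) * ((\<Sum>x\<in>{0..<p}. of_bool (x \<in> A) * chi (k * x)) * chi (- (k * z))))"
  proof (intro sum.cong refl)
    fix k
    have "cnj (ft A k) = (\<Sum>z\<in>{0..<p}. of_bool (z \<in> A) * chi (- (k * z)))"
      by (auto simp: ft_def chi_minus of_bool_def intro!: sum.cong)
    then show "ft A k * cnj (ft A k) = (\<Sum>z\<in>{0..<p}.
      of_bool (z \<in> A) * ((\<Sum>x\<in>{0..<p}. of_bool (x \<in> A) * chi (k * x)) * chi (- (k * z))))"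
      by (simp add: ft_def[of A k] sum_distrib_left mult_ac)
  qed
  also have "\<dots> = (\<Sum>z\<in>{0..<p}. \<Sum>k\<in>{0..<p}.
      of_bool (z \<in> A) * ((\<Sum>x\<in>{0..<p}. of_bool (x \<in> A) * chi (k * x)) * chi (- (k * z))))"
    by (rule sum.swap)
  also have "\<dots> = (\<Sum>z\<in>{0..<p}. of_bool (z \<in> A) * (complex_of_int p * of_bool (z \<in> A)))"
    using perD[OF assms]
    by (simp only: fourier_inversion[of "\<lambda>x. of_bool (x \<in> A)"] flip: sum_distrib_left)
  also have "\<dots> = of_real (p * sz A)"
    by (simp add: sz_def sum_distrib_left of_bool_def if_distrib cong: if_cong)
  finally show ?thesis by (simp only: of_real_eq_iff)
qed

lemma ft_zero: "ft A 0 = of_real (sz A)"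
  by (simp add: ft_def sz_def)

text \<open>The trivial character contributes \<open>sz A * sz B * sz C\<close>, and whatever this
  has beyond \<open>p * triples A B C\<close> must be cancelled by the other characters. There the
  factor of \<open>C\<close> is at most its maximum, and the product of the other two is at most the
  mean of their squares, which Parseval evaluates.\<close>

lemma large_fourier_coefficient:
  assumes per: "per A" "per B" "per C"
  shows "\<exists>k. \<not> p dvd k \<and> sz A * sz B * sz C - p * triples A B C \<le>
    norm (ft C k) * ((sz A * (p - sz A) + sz B * (p - sz B)) / 2)"
proof -
  define M where "M = Max ((\<lambda>k. norm (ft C k)) ` {1..<p})"
  have ne: "(\<lambda>k. norm (ft C k)) ` {1..<p} \<noteq> {}" using p_gt_1 by simp
  then have "M \<in> (\<lambda>k. norm (ft C k)) ` {1..<p}" unfolding M_def by (intro Max_in) auto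
  then obtain k where k: "k \<in> {1..<p}" "M = norm (ft C k)" by blast
  have M: "norm (ft C j) \<le> M" if "j \<in> {1..<p}" for j
    unfolding M_def using that by (intro Max_ge) auto
  have split: "sum f {0..<p} = f 0 + sum f {1..<p}" for f :: "int \<Rightarrow> 'b :: comm_monoid_add"
  proof -
    have "{0..<p} = insert 0 {1..<p}" using p_pos by auto
    then show ?thesis by simp
  qed
  have sq: "(\<Sum>j\<in>{1..<p}. (norm (ft D j))\<^sup>2) = sz D * (p - sz D)" if "per D" for D
    using parseval[OF that] split[of "\<lambda>j. (norm (ft D j))\<^sup>2"]
    by (simp add: ft_zero power2_eq_square algebra_simps)
  have "sz A * sz B * sz C - p * triples A B C \<le> norm (of_real (sz A * sz B * sz C - p * triples A B C) :: complex)"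
    by (simp only: norm_of_real abs_ge_self)
  also have "of_real (sz A * sz B * sz C - p * triples A B C) = - (\<Sum>j\<in>{1..<p}. ft A j * ft B j * ft C j)"
    using ft_triples[OF per] split[of "\<lambda>j. ft A j * ft B j * ft C j"]
    by (simp add: ft_zero algebra_simps eq_neg_iff_add_eq_0)
  also have "norm \<dots> \<le> (\<Sum>j\<in>{1..<p}. norm (ft A j * ft B j * ft C j))"
    by (simp add: norm_sum)
  also have "\<dots> \<le> (\<Sum>j\<in>{1..<p}. M * (((norm (ft A j))\<^sup>2 + (norm (ft B j))\<^sup>2) / 2))"
  proof (intro sum_mono)
    fix j assume j: "j \<in> {1..<p}"
    have "0 \<le> (norm (ft A j) - norm (ft B j))\<^sup>2" by simp
    then have "norm (ft A j) * norm (ft B j) \<le> ((norm (ft A j))\<^sup>2 + (norm (ft B j))\<^sup>2) / 2"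
      by (simp add: power2_diff)
    then have "norm (ft C j) * (norm (ft A j) * norm (ft B j)) \<le>
        M * (((norm (ft A j))\<^sup>2 + (norm (ft B j))\<^sup>2) / 2)"
      using M[OF j] by (intro mult_mono) (auto intro: order_trans[OF norm_ge_zero])
    then show "norm (ft A j * ft B j * ft C j) \<le> M * (((norm (ft A j))\<^sup>2 + (norm (ft B j))\<^sup>2) / 2)"
      by (simp add: norm_mult mult_ac)
  qed
  also have "\<dots> = M * ((sz A * (p - sz A) + sz B * (p - sz B)) / 2)"
    using sq[OF per(1)] sq[OF per(2)]
    by (simp add: sum.distrib flip: sum_distrib_left sum_divide_distrib)
  finally have "sz A * sz B * sz C - p * triples A B C \<le>
      norm (ft C k) * ((sz A * (p - sz A) + sz B * (p - sz B)) / 2)" using k by simp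
  moreover have "\<not> p dvd k" using k zdvd_not_zless by auto
  ultimately show ?thesis by blast
qed

text \<open>Translation by \<open>h\<close> multiplies the coefficient by \<open>chi (k * h)\<close>
  but alters \<open>C\<close> in only \<open>2 * defect C h\<close> residues, and
  \<open>chi (k * h)\<close> has distance twice the sine from 1.\<close>

lemma ft_near_period:
  assumes "per C"
  shows "norm (ft C k) * \<bar>sin (pi * of_int (k * h) / p)\<bar> \<le> defect C h"
proof -
  have "(\<Sum>x\<in>{0..<p}. of_bool (x + h - h \<in> C) * chi (k * (x + h))) =
      (\<Sum>x\<in>{0..<p}. of_bool (x - h \<in> C) * chi (k * x))"
    by (rule sum_add[of "\<lambda>x. of_bool (x - h \<in> C) * chi (k * x)"])
       (use perD[OF assms, of "_ - h"] in \<open>simp add: diff_add_eq chi_add_p\<close>)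
  then have "ft C k * chi (k * h) = (\<Sum>x\<in>{0..<p}. of_bool (x - h \<in> C) * chi (k * x))"
    by (simp add: ft_def ring_distribs chi_add sum_distrib_right mult.assoc)
  then have "ft C k * (1 - chi (k * h)) =
      (\<Sum>x\<in>{0..<p}. (of_bool (x \<in> C) - of_bool (x - h \<in> C)) * chi (k * x))"
    by (simp add: ring_distribs ft_def[of C k] left_diff_distrib sum_subtractf)
  then have "norm (ft C k) * norm (1 - chi (k * h)) =
      norm (\<Sum>x\<in>{0..<p}. (of_bool (x \<in> C) - of_bool (x - h \<in> C)) * chi (k * x))"
    by (metis norm_mult)
  also have "\<dots> \<le> (\<Sum>x\<in>{0..<p}. norm ((of_bool (x \<in> C) - of_bool (x - h \<in> C)) * chi (k * x)))"
    by (rule norm_sum)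
  also have "\<dots> \<le> (\<Sum>x\<in>{0..<p}. of_bool (x \<in> C - shift h C) + of_bool (x \<in> shift h C - C))"
    by (intro sum_mono) (auto simp: norm_mult)
  also have "\<dots> = 2 * defect C h"
    using sz_shift_Diff[OF assms, of h] by (simp add: sum.distrib sz_def defect_def)
  finally have *: "norm (ft C k) * norm (1 - chi (k * h)) \<le> 2 * defect C h" .
  define t where "t = pi * of_int (k * h) / p"
  have "(norm (1 - chi (k * h)))\<^sup>2 = (1 - cos (2 * t))\<^sup>2 + (sin (2 * t))\<^sup>2"
    by (simp add: chi_def cmod_def t_def mult.assoc)
  also have "\<dots> = 2 - 2 * cos (2 * t)"
    using sin_cos_squared_add[of "2 * t"] by (simp add: power2_diff)
  also have "\<dots> = (2 * \<bar>sin t\<bar>)\<^sup>2"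
    by (simp add: cos_double_sin power_mult_distrib)
  finally have "(norm (1 - chi (k * h)))\<^sup>2 = (2 * \<bar>sin t\<bar>)\<^sup>2" .
  then have "norm (1 - chi (k * h)) = 2 * \<bar>sin t\<bar>"
    by (rule power2_eq_imp_eq) simp_all
  then show ?thesis using * by (simp add: t_def)
qed

end

section \<open>Sumsets with a dense subset of a short arc\<close>

text \<open>The situation after rectification: \<open>X\<close> lies in the arc from 0 to
  \<open>p / N\<close>, \<open>e\<close> is the scale of the solution count and \<open>m\<close> the
  deficit of the triple.\<close>

locale arc_critical = prime_modulus +
  fixes X A Z :: "int set" and e m :: real and N :: int
  assumes per_X: "per X" and per_A: "per A" and per_Z: "per Z"
    and e_ge_1: "1 \<le> e" and few_triples: "triples X A Z \<le> e * (e - 1)"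
    and critical: "p - m \<le> sz X + sz A + sz Z"
    and N_gt_1: "1 < N" and X_arc: "x \<in> X \<Longrightarrow> (x mod p) * N \<le> p"
    and X_big: "2 * e \<le> sz X" and XA_le: "sz X + sz A \<le> p"
begin

text \<open>The circle is cut into \<open>N\<close> windows of length \<open>p/N\<close>, starting at \<open>v/N\<close>; adding an element of \<open>X\<close>
  moves a point by at most one window.\<close>

definition idx :: "int \<Rightarrow> int \<Rightarrow> int" where
  "idx v x = ((x * N - v) div p) mod N"

definition win :: "int \<Rightarrow> int \<Rightarrow> real" where
  "win v i = sz {a \<in> A. idx v a = i}"

lemma idx_range: "0 \<le> idx v x" "idx v x < N"
  using N_gt_1 by (simp_all add: idx_def)

lemma idx_add_p: "idx v (x + p) = idx v x"
proof -
  have eq: "(x + p) * N - v = (x * N - v) + N * p" by (simp add: algebra_simps)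
  show ?thesis unfolding idx_def eq using p_pos by simp
qed

lemma idx_shift: "idx (v + k * p) x = (idx v x - k) mod N"
proof -
  have "x * N - (v + k * p) = (x * N - v) + (- k) * p" by (simp add: algebra_simps)
  then have "(x * N - (v + k * p)) div p = - k + (x * N - v) div p"
    using p_pos by (simp only: div_mult_self1)
  then show ?thesis by (simp add: idx_def mod_diff_left_eq)
qed

lemma idx_step:
  assumes "x \<in> X"
  shows "idx v (x + y) = idx v y \<or> idx v (x + y) = (idx v y + 1) mod N"
proof -
  define r where "r = (x mod p) * N"
  have r: "0 \<le> r" "r \<le> p" using X_arc[OF assms] p_pos N_gt_1 by (simp_all add: r_def)
  define q where "q = (y * N - v) div p"
  have "(y * N - v) = p * q + (y * N - v) mod p" by (simp add: q_def)
  moreover have "0 \<le> (y * N - v) mod p" "(y * N - v) mod p < p" using p_pos by simp_all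
  ultimately have b: "p * q \<le> y * N - v + r" "y * N - v + r < p * (q + 2)"
    using r by (simp_all add: algebra_simps)
  have "q \<le> (y * N - v + r) div p"
    using b(1) p_pos by (metis nonzero_mult_div_cancel_left order_less_irrefl zdiv_mono1)
  moreover have "(y * N - v + r) div p < q + 2"
  proof -
    have "p * ((y * N - v + r) div p) < p * (q + 2)"
      using b(2) p_pos mult_div_mod_eq[of p "y * N - v + r"] pos_mod_sign[of p "y * N - v + r"]
      by linarith
    then show ?thesis using p_pos by simp
  qed
  ultimately have *: "(y * N - v + r) div p = q \<or> (y * N - v + r) div p = q + 1" by linarith
  have "(x + y) * N - v = (y * N - v + r) + (x div p * N) * p"
  proof -
    obtain c t where ct: "x div p = c" "x mod p = t" by blast
    then have "x = p * c + t" using mult_div_mod_eq[of p x] by simp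
    then show ?thesis unfolding r_def ct by (simp add: algebra_simps)
  qed
  note eq = this
  have "idx v (x + y) = ((y * N - v + r) div p) mod N"
    unfolding idx_def eq using p_pos by simp
  then show ?thesis using * by (auto simp: idx_def q_def mod_add_left_eq)
qed

lemma per_idx: "per {x. P (idx v x)}"
  by (simp add: per_def idx_add_p)

lemma per_idx_Int: "per B \<Longrightarrow> per {x \<in> B. P (idx v x)}"
  by (simp add: per_def idx_add_p)

text \<open>A local Cauchy-Davenport bound. Sums of \<open>X\<close> and \<open>A'\<close> only fall
  into windows from \<open>I\<close>, so adding the negatives of all other windows to
  \<open>Z\<close> creates no solution that was not there, and \<open>critical_le\<close> bounds the
  enlarged set.\<close>

lemma piece:
  assumes A': "A' \<subseteq> A" "per A'" "2 * e \<le> sz A'"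
    and I: "\<And>a. a \<in> A' \<Longrightarrow> idx v a \<in> I \<and> (idx v a + 1) mod N \<in> I"
  shows "sz X + sz A' - 2 * e \<le> sz {y. - y \<notin> Z \<and> idx v y \<in> I}"
proof -
  define C where "C = Z \<union> {c. idx v (- c) \<notin> I}"
  have "per {c. idx v (- c) \<notin> I}"
    using per_uminus[OF per_idx[of "\<lambda>i. i \<notin> I" v]] by simp
  then have perC: "per C" using per_Z by (simp add: C_def)
  have "triples X A' C \<le> triples X A Z"
    unfolding triples_def
  proof (intro sum_mono)
    fix x y
    have "- x - y \<in> Z" if "x \<in> X" "y \<in> A'" "- x - y \<in> C"
    proof -
      have "idx v (x + y) \<in> I" using idx_step[OF that(1), of v y] I[OF that(2)] by auto
      moreover have "x + y = - (- x - y)" by simp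
      ultimately have "idx v (- (- x - y)) \<in> I" by (simp only:)
      then show ?thesis using that(3) unfolding C_def by blast
    qed
    then show "of_bool (x \<in> X) * of_bool (y \<in> A') * of_bool (- x - y \<in> C) \<le>
        (of_bool (x \<in> X) * of_bool (y \<in> A) * of_bool (- x - y \<in> Z) :: real)"
      using A'(1) by (auto simp: of_bool_def)
  qed
  then have "sz X + sz A' + sz C \<le> p + 2 * e"
    using few_triples e_ge_1 X_big A' XA_le sz_mono[OF A'(1)] per_X perC
    by (intro critical_le) auto
  moreover have "sz {y. - y \<notin> Z \<and> idx v y \<in> I} = p - sz C"
  proof -
    have "{y. - y \<notin> Z \<and> idx v y \<in> I} = {y. - y \<in> - C}" by (auto simp: C_def)
    then show ?thesis by (simp only: sz_uminus[OF per_Compl[OF perC]] sz_Compl)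
  qed
  ultimately show ?thesis by simp
qed

lemma sz_partition: "finite I \<Longrightarrow> sz {x \<in> B. f x \<in> I} = (\<Sum>i\<in>I. sz {x \<in> B. f x = i})"
proof -
  assume I: "finite I"
  have "(\<Sum>i\<in>I. sz {x \<in> B. f x = i}) = (\<Sum>x\<in>{0..<p}. \<Sum>i\<in>I. of_bool (x \<in> B \<and> f x = i))"
    unfolding sz_def by (subst sum.swap) simp
  also have "\<dots> = sz {x \<in> B. f x \<in> I}"
    unfolding sz_def
  proof (intro sum.cong refl)
    show "(\<Sum>i\<in>I. of_bool (x \<in> B \<and> f x = i)) = (of_bool (x \<in> {x \<in> B. f x \<in> I}) :: real)" for x
      by (cases "x \<in> B") (use I in \<open>simp_all add: of_bool_def\<close>)
  qed
  finally show ?thesis by simp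
qed

lemma win_sum: "(\<Sum>i\<in>{0..<N}. win v i) = sz A"
  using sz_partition[of "{0..<N}" A "idx v"] idx_range by (simp add: win_def)

lemma sz_Y: "sz {y. - y \<notin> Z} \<le> sz X + sz A + m"
  using sz_uminus[of "- Z"] per_Z critical by (simp add: sz_Compl)

text \<open>If all windows were rich, each would gain \<open>sz X - 2 * e\<close> by
  \<open>piece\<close>. Every residue is counted for at most two windows, so the sums would number
  about \<open>(N * sz X + sz A) / 2\<close>, but criticality leaves room for only
  \<open>sz X + sz A + m\<close>.\<close>

lemma thin_window:
  assumes "sz A + 2 * sz X + 2 * m + 2 * N * e < N * sz X"
  shows "\<exists>i\<in>{0..<N}. win v i < 2 * e"
proof (rule ccontr)
  assume "\<not> ?thesis"
  then have rich: "2 * e \<le> win v i" if "i \<in> {0..<N}" for i using that by force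
  define Y where "Y = {y. - y \<notin> Z}"
  have "(\<Sum>i\<in>{0..<N}. sz X + win v i - 2 * e) \<le>
      (\<Sum>i\<in>{0..<N}. sz {y. - y \<notin> Z \<and> idx v y \<in> {i, (i + 1) mod N}})"
  proof (intro sum_mono)
    fix i assume "i \<in> {0..<N}"
    then show "sz X + win v i - 2 * e \<le> sz {y. - y \<notin> Z \<and> idx v y \<in> {i, (i + 1) mod N}}"
      unfolding win_def
      by (intro piece) (use rich per_idx_Int[OF per_A, of "\<lambda>j. j = i" v] in \<open>auto simp: win_def\<close>)
  qed
  also have "\<dots> = (\<Sum>y\<in>{0..<p}. \<Sum>i\<in>{0..<N}. of_bool (y \<in> Y) * of_bool (idx v y \<in> {i, (i + 1) mod N}))"
    unfolding sz_def Y_def by (subst sum.swap) (auto intro!: sum.cong)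
  also have "\<dots> \<le> (\<Sum>y\<in>{0..<p}. 2 * of_bool (y \<in> Y))"
  proof (intro sum_mono)
    fix y
    have "{0..<N} \<inter> {i. idx v y \<in> {i, (i + 1) mod N}} \<subseteq> {idx v y, (idx v y - 1) mod N}"
      using N_gt_1 by (auto simp: mod_diff_left_eq)
    then have "card ({0..<N} \<inter> {i. idx v y \<in> {i, (i + 1) mod N}}) \<le> card {idx v y, (idx v y - 1) mod N}"
      by (intro card_mono) auto
    also have "\<dots> \<le> 2" by (simp add: card_insert_le_m1)
    finally have "real (card ({0..<N} \<inter> {i. idx v y \<in> {i, (i + 1) mod N}})) \<le> 2" by simp
    moreover have "(\<Sum>i\<in>{0..<N}. of_bool (idx v y \<in> {i, (i + 1) mod N})) =
        real (card ({0..<N} \<inter> {i. idx v y \<in> {i, (i + 1) mod N}}))"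
      by (rule sum_of_bool_eq) simp_all
    ultimately have le2: "(\<Sum>i\<in>{0..<N}. of_bool (idx v y \<in> {i, (i + 1) mod N})) \<le> (2 :: real)"
      by linarith
    have "(\<Sum>i\<in>{0..<N}. of_bool (y \<in> Y) * of_bool (idx v y \<in> {i, (i + 1) mod N}) :: real) =
        of_bool (y \<in> Y) * (\<Sum>i\<in>{0..<N}. of_bool (idx v y \<in> {i, (i + 1) mod N}))"
      by (rule sum_distrib_left[symmetric])
    also have "\<dots> \<le> of_bool (y \<in> Y) * 2" by (rule mult_left_mono[OF le2]) simp
    finally show "(\<Sum>i\<in>{0..<N}. of_bool (y \<in> Y) * of_bool (idx v y \<in> {i, (i + 1) mod N})) \<le> (2 * of_bool (y \<in> Y) :: real)"
      by simp
  qed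
  also have "\<dots> = 2 * sz Y" by (simp add: sz_def sum_distrib_left)
  finally have "N * sz X + sz A - 2 * N * e \<le> 2 * sz Y"
    using N_gt_1 win_sum[of v] by (simp add: sum.distrib sum_subtractf algebra_simps)
  then show False using sz_Y assms by (simp add: Y_def)
qed

text \<open>Cutting at the thin window 0 and at window \<open>j\<close> leaves two pieces whose sums
  with \<open>X\<close> are in disjoint windows. Each piece gains about \<open>sz X\<close>,
  criticality grants this only once, and so window \<open>j\<close> must have held the
  difference.\<close>

lemma two_cuts:
  assumes thin: "win v 0 < 2 * e" and j: "0 < j" "j < N"
    and rich: "2 * e \<le> sz {a \<in> A. 0 < idx v a \<and> idx v a < j}" "2 * e \<le> sz {a \<in> A. j < idx v a}"
  shows "sz X - 6 * e - m \<le> win v j"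
proof -
  let ?A' = "{a \<in> A. 0 < idx v a \<and> idx v a < j}" and ?A'' = "{a \<in> A. j < idx v a}"
  have "sz X + sz ?A' - 2 * e \<le> sz {y. - y \<notin> Z \<and> idx v y \<in> {1..j}}"
    by (rule piece) (use rich j per_idx_Int[OF per_A, of "\<lambda>i. 0 < i \<and> i < j" v] in auto)
  moreover have "sz X + sz ?A'' - 2 * e \<le> sz {y. - y \<notin> Z \<and> idx v y \<in> - {1..j}}"
  proof (rule piece)
    \<comment> \<open>Sums from the last window can wrap round to window 0, which the first piece
      does not reach.\<close>
    show "idx v a \<in> - {1..j} \<and> (idx v a + 1) mod N \<in> - {1..j}" if "a \<in> ?A''" for a
    proof (cases "idx v a + 1 = N")
      case False
      then have "(idx v a + 1) mod N = idx v a + 1"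
        using idx_range[of v a] by (intro mod_pos_pos_trivial) auto
      then show ?thesis using that by auto
    qed (use that in auto)
  qed (use rich per_idx_Int[OF per_A, of "\<lambda>i. j < i" v] in auto)
  moreover have "sz {y. - y \<notin> Z \<and> idx v y \<in> {1..j}} + sz {y. - y \<notin> Z \<and> idx v y \<in> - {1..j}} = sz {y. - y \<notin> Z}"
    unfolding sz_def sum.distrib[symmetric] by (intro sum.cong) auto
  moreover have "sz A = win v 0 + win v j + sz ?A' + sz ?A''"
  proof -
    have "(of_bool (a \<in> A) :: real) = of_bool (a \<in> {a \<in> A. idx v a = 0}) + of_bool (a \<in> {a \<in> A. idx v a = j})
        + of_bool (a \<in> ?A') + of_bool (a \<in> ?A'')" for a
      using idx_range[of v a] j by (auto simp: of_bool_def)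
    then show ?thesis unfolding win_def sz_def by (simp add: sum.distrib)
  qed
  ultimately show ?thesis using sz_Y thin by linarith
qed

text \<open>After a rotation that puts a thin window first, the arc runs from the first rich window
  to the last, so only poor windows lie outside. Strictly between its ends there is a rich window on
  either side, as \<open>two_cuts\<close> requires; this is why the density bound leaves out both
  end windows.\<close>

lemma arc_structure:
  assumes gap: "sz A + 2 * sz X + 2 * m + 2 * N * e < N * sz X" and A: "2 * N * e < sz A"
  shows "\<exists>v L. 1 \<le> L \<and> L < N \<and> sz {a \<in> A. L \<le> idx v a} \<le> 2 * N * e \<and>
    (\<forall>j. 0 < j \<and> j < L - 1 \<longrightarrow> sz X - 6 * e - m \<le> win v j)"
proof -
  obtain i0 where i0: "i0 \<in> {0..<N}" "win 0 i0 < 2 * e" using thin_window[OF gap] by blast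
  define v0 where "v0 = 0 + i0 * p"
  have "win v0 0 = win 0 i0"
  proof -
    have "(idx 0 x - i0) mod N = 0 \<longleftrightarrow> idx 0 x = i0" for x
      using i0(1) idx_range[of 0 x]
      by (metis atLeastLessThan_iff mod_pos_pos_trivial mod_eq_dvd_iff dvd_eq_mod_eq_0)
    then show ?thesis unfolding win_def v0_def idx_shift by simp
  qed
  then have thin: "win v0 0 < 2 * e" using i0 by simp
  define J where "J = {j \<in> {0..<N}. 2 * e \<le> win v0 j}"
  have finJ: "finite J" by (rule finite_subset[of _ "{0..<N}"]) (auto simp: J_def)
  have poor: "(\<Sum>i\<in>{0..<N} - J. win v0 i) \<le> 2 * N * e"
  proof -
    have "(\<Sum>i\<in>{0..<N} - J. win v0 i) \<le> (\<Sum>i\<in>{0..<N} - J. 2 * e)"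
      by (intro sum_mono) (auto simp: J_def)
    also have "\<dots> \<le> (\<Sum>i\<in>{0..<N}. 2 * e)"
      using e_ge_1 by (intro sum_mono2) auto
    also have "\<dots> = 2 * N * e" using N_gt_1 by simp
    finally show ?thesis .
  qed
  have "J \<noteq> {}"
  proof
    assume "J = {}"
    then show False using poor A win_sum[of v0] by simp
  qed
  define i1 i2 where "i1 = Min J" and "i2 = Max J"
  have i12: "i1 \<in> J" "i2 \<in> J" "i1 \<le> i2" "\<And>j. j \<in> J \<Longrightarrow> i1 \<le> j \<and> j \<le> i2"
    using finJ \<open>J \<noteq> {}\<close> by (auto simp: i1_def i2_def)
  have "0 \<notin> J" using thin by (simp add: J_def)
  then have i1: "0 < i1" "i2 < N" using i12(1,2) by (auto simp: J_def order_le_less)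
  define v L where "v = v0 + i1 * p" and "L = i2 - i1 + 1"
  have idx: "idx v x = (idx v0 x - i1) mod N" for x unfolding v_def by (rule idx_shift)
  have idx_in: "idx v x = idx v0 x - i1" if "i1 \<le> idx v0 x" for x
    using that idx_range[of v0 x] i1 unfolding idx by (intro mod_pos_pos_trivial) auto
  have idx_out: "idx v x = idx v0 x - i1 + N" if "idx v0 x < i1" for x
  proof -
    have "(idx v0 x - i1) mod N = (idx v0 x - i1 + N) mod N" by simp
    also have "\<dots> = idx v0 x - i1 + N"
      using that idx_range[of v0 x] i1 i12(3) by (intro mod_pos_pos_trivial) auto
    finally show ?thesis unfolding idx .
  qed
  have "1 \<le> L" "L < N" using i12(3) i1 by (simp_all add: L_def)
  moreover have "sz {a \<in> A. L \<le> idx v a} \<le> 2 * N * e"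
  proof -
    have "sz {a \<in> A. L \<le> idx v a} \<le> sz {a \<in> A. idx v0 a \<in> {0..<N} - J}"
    proof (rule sz_mono, rule subsetI)
      fix a assume a: "a \<in> {a \<in> A. L \<le> idx v a}"
      have "idx v0 a \<notin> J"
      proof
        assume "idx v0 a \<in> J"
        then show False using a i12(4)[of "idx v0 a"] idx_in[of a] by (simp add: L_def)
      qed
      then show "a \<in> {a \<in> A. idx v0 a \<in> {0..<N} - J}" using a idx_range by simp
    qed
    also have "\<dots> = (\<Sum>i\<in>{0..<N} - J. win v0 i)"
      unfolding win_def by (rule sz_partition) simp
    finally show ?thesis using poor by simp
  qed
  moreover have "sz X - 6 * e - m \<le> win v j" if "0 < j" "j < L - 1" for j
  proof -
    have "sz X - 6 * e - m \<le> win v0 (i1 + j)"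
    proof (rule two_cuts[OF thin])
      have "2 * e \<le> win v0 i1" "2 * e \<le> win v0 i2" using i12 by (simp_all add: J_def)
      moreover have "win v0 i1 \<le> sz {a \<in> A. 0 < idx v0 a \<and> idx v0 a < i1 + j}"
        unfolding win_def using that i1 by (intro sz_mono) auto
      moreover have "win v0 i2 \<le> sz {a \<in> A. i1 + j < idx v0 a}"
        unfolding win_def using that by (intro sz_mono) (auto simp: L_def)
      ultimately show "2 * e \<le> sz {a \<in> A. 0 < idx v0 a \<and> idx v0 a < i1 + j}"
        "2 * e \<le> sz {a \<in> A. i1 + j < idx v0 a}" by linarith+
    qed (use that i1 in \<open>auto simp: L_def\<close>)
    moreover have "win v0 (i1 + j) \<le> win v j"
      unfolding win_def using that idx_in by (intro sz_mono) auto
    ultimately show ?thesis by simp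
  qed
  ultimately show ?thesis by blast
qed

end

section \<open>Doubling a set concentrated on an arc\<close>

lemma le_div_iff_mult_le:
  fixes a c q :: int
  assumes "0 < q"
  shows "c \<le> a div q \<longleftrightarrow> c * q \<le> a"
proof
  assume "c \<le> a div q"
  then have "c * q \<le> (a div q) * q" using assms by (intro mult_right_mono) auto
  also have "\<dots> \<le> a" using assms div_mult_mod_eq[of a q] pos_mod_sign[of q a] by linarith
  finally show "c * q \<le> a" .
next
  assume "c * q \<le> a"
  then have "(c * q) div q \<le> a div q" using assms by (intro zdiv_mono1)
  then show "c \<le> a div q" using assms by simp
qed

context prime_modulus
begin

text \<open>The residues of the integers from \<open>s\<close> to \<open>t - 1\<close>, for
  \<open>t\<close> between \<open>s\<close> and \<open>s + p\<close>. Integer endpoints allow sums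
  to be compared in the order of the integers.\<close>

definition arc :: "int \<Rightarrow> int \<Rightarrow> int set" where
  "arc s t = {x. (x - s) mod p < t - s}"

lemma per_arc [simp, intro]: "per (arc s t)"
proof -
  have "(x + p - s) mod p = (x - s) mod p" for x
    using mod_add_self2[of "x - s" p] by (simp add: algebra_simps)
  then show ?thesis by (simp add: per_def arc_def)
qed

lemma sum_window:
  fixes F :: "int \<Rightarrow> 'b :: comm_monoid_add"
  assumes "\<And>x. F (x + p) = F x"
  shows "(\<Sum>x\<in>{s..<s + p}. F x) = (\<Sum>x\<in>{0..<p}. F x)"
proof -
  have "{s..<s + p} = (\<lambda>x. x + s) ` {0..<p}"
    using image_add_int_atLeastLessThan[of s "s + p"] by simp
  moreover have "inj_on (\<lambda>x. x + s) {0..<p}" by (simp add: inj_on_def)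
  ultimately have "(\<Sum>x\<in>{s..<s + p}. F x) = (\<Sum>x\<in>{0..<p}. F (x + s))"
    by (simp only: sum.reindex o_def)
  then show ?thesis using sum_add[of F s, OF assms] by simp
qed

lemma sz_arc:
  assumes "per D" "t \<le> s + p"
  shows "sz (D \<inter> arc s t) = card (D \<inter> {s..<t})"
proof -
  have "sz (D \<inter> arc s t) = (\<Sum>x\<in>{s..<s + p}. of_bool (x \<in> D \<inter> arc s t))"
    unfolding sz_def using perD[OF per_Int[OF assms(1) per_arc]]
    by (intro sum_window[symmetric]) simp
  also have "\<dots> = (\<Sum>x\<in>{s..<s + p}. of_bool (x \<in> D \<and> x < t))"
    by (intro sum.cong refl) (auto simp: arc_def)
  also have "\<dots> = card ({s..<s + p} \<inter> {x. x \<in> D \<and> x < t})"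
    by (rule sum_of_bool_eq) simp_all
  also have "{s..<s + p} \<inter> {x. x \<in> D \<and> x < t} = D \<inter> {s..<t}"
    using assms(2) by auto
  finally show ?thesis .
qed

lemma card_le_sz: "per D \<Longrightarrow> t \<le> s + p \<Longrightarrow> card (D \<inter> {s..<t}) \<le> sz D"
  using sz_arc[of D t s] sz_mono[of "D \<inter> arc s t" D] by simp

text \<open>The sums with the smallest and with the largest element of an arc meet only once.\<close>

lemma two_rows:
  assumes per: "per A" "per B" "per R" and B: "B \<subseteq> A" "B \<subseteq> arc s t" "0 < sz B"
    and len: "2 * (t - s) \<le> p" and rows: "\<And>x. x \<in> A \<Longrightarrow> sz {y \<in> A. x + y \<notin> R} \<le> d"
  shows "2 * sz B - 1 - 2 * d \<le> sz (R \<inter> arc (2 * s) (2 * t))"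
proof -
  define B' where "B' = B \<inter> {s..<t}"
  have fin: "finite B'" by (simp add: B'_def)
  have "B \<inter> arc s t = B" using B by blast
  then have szB: "sz B = card B'"
    using sz_arc[OF per(2), of t s] len p_pos by (cases "s \<le> t") (auto simp: B'_def)
  then have ne: "B' \<noteq> {}" using B(3) by auto
  define a b where "a = Min B'" and "b = Max B'"
  have ab: "a \<in> B'" "b \<in> B'" "\<And>x. x \<in> B' \<Longrightarrow> a \<le> x \<and> x \<le> b"
    using fin ne by (auto simp: a_def b_def)
  define S where "S = (+) a ` B' \<union> (+) b ` B'"
  have "(+) a ` B' \<inter> (+) b ` B' \<subseteq> {a + b}"
  proof
    fix x assume "x \<in> (+) a ` B' \<inter> (+) b ` B'"
    then obtain u w where "x = a + u" "x = b + w" "u \<in> B'" "w \<in> B'" by blast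
    then show "x \<in> {a + b}" using ab(3)[of u] ab(3)[of w] by simp
  qed
  then have "card ((+) a ` B' \<inter> (+) b ` B') \<le> 1"
    using card_mono[of "{a + b}"] by fastforce
  moreover have "card ((+) a ` B') = card B'" "card ((+) b ` B') = card B'"
    by (simp_all add: card_image)
  ultimately have cS: "2 * card B' - 1 \<le> card S"
    using card_Un_Int[of "(+) a ` B'" "(+) b ` B'"] fin by (simp add: S_def)
  have row: "real (card ((+) x ` B' - R)) \<le> d" if "x \<in> B'" for x
  proof -
    define D where "D = {y \<in> A. x + y \<notin> R}"
    have "x + (y + p) = (x + y) + p" for y by simp
    then have perD: "per D" using perD[OF per(1)] perD[OF per(3)] by (simp only: per_def D_def mem_Collect_eq simp_thms)
    have "(+) x ` B' - R \<subseteq> (+) x ` (D \<inter> {s..<t})"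
      using B(1) by (auto simp: B'_def D_def)
    then have "card ((+) x ` B' - R) \<le> card (D \<inter> {s..<t})"
      by (metis card_image_le card_mono finite_Int finite_atLeastLessThan_int finite_imageI order_trans)
    also have "real \<dots> \<le> sz D"
    proof (rule card_le_sz[OF perD])
      show "t \<le> s + p" using len ab(1) p_pos by (auto simp: B'_def)
    qed
    also have "\<dots> \<le> d" unfolding D_def using that B(1) by (intro rows) (auto simp: B'_def)
    finally show ?thesis by simp
  qed
  have "S \<subseteq> (R \<inter> {2 * s..<2 * t}) \<union> ((+) a ` B' - R) \<union> ((+) b ` B' - R)"
    using ab(1,2) by (auto simp: S_def B'_def)
  then have "card S \<le> card ((R \<inter> {2 * s..<2 * t}) \<union> ((+) a ` B' - R) \<union> ((+) b ` B' - R))"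
    using fin by (intro card_mono) auto
  also have "\<dots> \<le> card (R \<inter> {2 * s..<2 * t}) + card ((+) a ` B' - R) + card ((+) b ` B' - R)"
    by (meson add_right_mono card_Un_le order_trans)
  finally have "real (card S) \<le> card (R \<inter> {2 * s..<2 * t}) + 2 * d"
    using row[OF ab(1)] row[OF ab(2)] by linarith
  \<comment> \<open>The doubled arc has length at most \<open>p\<close>, so distinct integers in it
    are distinct residues.\<close>
  moreover have "card (R \<inter> {2 * s..<2 * t}) = sz (R \<inter> arc (2 * s) (2 * t))"
    using sz_arc[OF per(3), of "2 * t" "2 * s"] len by simp
  ultimately show ?thesis using cS szB by linarith
qed

end

locale arc_sums = arc_critical p X A Z e m N
  for p :: int and X A Z :: "int set" and e m :: real and N :: int +
  fixes R :: "int set" and d :: real and v L :: int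
  assumes per_R: "per R" and rows: "\<And>x. x \<in> A \<Longrightarrow> sz {y \<in> A. x + y \<notin> R} \<le> d"
    and N_le_p: "N \<le> p" and L: "1 \<le> L" "L < N" and A_pos: "2 * N * e < sz A"
    and outside: "sz {a \<in> A. L \<le> idx v a} \<le> 2 * N * e"
    and inside: "\<And>j. 0 < j \<Longrightarrow> j < L - 1 \<Longrightarrow> sz X - 6 * e - m \<le> win v j"
begin

text \<open>\<open>cl w\<close> is the ceiling of \<open>w/N\<close>.\<close>

definition cl :: "int \<Rightarrow> int" where
  "cl w = - ((- w) div N)"

lemma cl_le_iff: "cl w \<le> x \<longleftrightarrow> w \<le> x * N"
proof -
  have "cl w \<le> x \<longleftrightarrow> - x \<le> (- w) div N" by (auto simp: cl_def)
  also have "\<dots> \<longleftrightarrow> (- x) * N \<le> - w" using N_gt_1 by (simp add: le_div_iff_mult_le)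
  finally show ?thesis by simp
qed

lemma less_cl_iff: "x < cl w \<longleftrightarrow> x * N < w"
  using cl_le_iff[of w x] by linarith

lemma idx_cong: "x mod p = y mod p \<Longrightarrow> idx u x = idx u y"
  using periodic_cong[of "idx u" x y, OF idx_add_p] .

text \<open>For the representative of \<open>x\<close> in the period starting at \<open>s\<close>,
  the index before reduction modulo \<open>N\<close> lies between \<open>j\<close> and
  \<open>j + N - 1\<close>; there the reduction does not affect the two comparisons.\<close>

lemma idx_arc:
  assumes "0 \<le> j" "j \<le> k" "k \<le> N"
  shows "{x. j \<le> idx u x \<and> idx u x < k} = arc (cl (u + j * p)) (cl (u + k * p))"
proof -
  define s t where "s = cl (u + j * p)" and "t = cl (u + k * p)"
  have "j \<le> idx u x \<and> idx u x < k \<longleftrightarrow> (x - s) mod p < t - s" for x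
  proof -
    define y where "y = s + (x - s) mod p"
    have y: "s \<le> y" "y < s + p" using p_pos by (simp_all add: y_def)
    have "x mod p = y mod p" by (simp add: y_def mod_simps)
    then have idx: "idx u x = idx u y" by (rule idx_cong)
    define q where "q = (y * N - u) div p"
    have q: "c \<le> q \<longleftrightarrow> u + c * p \<le> y * N" for c
    proof -
      have "c \<le> q \<longleftrightarrow> c * p \<le> y * N - u" using p_pos by (simp add: q_def le_div_iff_mult_le)
      then show ?thesis by auto
    qed
    have "j \<le> q" using y(1) q[of j] cl_le_iff by (simp add: s_def)
    moreover have "q < j + N"
    proof -
      have "y - p < s" using y by simp
      then have "(y - p) * N < u + j * p" unfolding s_def less_cl_iff .
      then have "\<not> u + (j + N) * p \<le> y * N" by (simp add: algebra_simps)
      then show ?thesis using q[of "j + N"] by simp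
    qed
    moreover have "idx u x = q mod N" unfolding idx by (simp add: idx_def q_def)
    ultimately have "j \<le> idx u x \<and> idx u x < k \<longleftrightarrow> q < k"
    proof (cases "q < N")
      case True
      then have "q mod N = q" using \<open>j \<le> q\<close> assms by (intro mod_pos_pos_trivial) auto
      then show ?thesis using \<open>idx u x = q mod N\<close> \<open>j \<le> q\<close> by simp
    next
      case False
      have "q mod N = (q - N) mod N" by simp
      also have "\<dots> = q - N" using False \<open>q < j + N\<close> assms by (intro mod_pos_pos_trivial) auto
      finally show ?thesis using \<open>idx u x = q mod N\<close> \<open>q < j + N\<close> False assms by auto
    qed
    also have "q < k \<longleftrightarrow> y < t"
      using q[of k] less_cl_iff[of y "u + k * p"] by (auto simp: t_def)
    finally show ?thesis by (auto simp: y_def)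
  qed
  then show ?thesis by (simp add: arc_def s_def t_def)
qed

lemma cl_diff: "(cl (u + k * p) - cl (u + j * p)) * N < (k - j) * p + N"
proof -
  have "(cl (u + k * p) - 1) * N < u + k * p" using less_cl_iff[of "cl (u + k * p) - 1" "u + k * p"] by simp
  moreover have "u + j * p \<le> cl (u + j * p) * N" using cl_le_iff by blast
  ultimately show ?thesis by (simp add: algebra_simps)
qed

lemma sz_idx:
  assumes "0 \<le> j" "j \<le> k" "k \<le> N"
  shows "sz {x. j \<le> idx u x \<and> idx u x < k} \<le> (k - j) * p / N + 1"
proof -
  define s t where "s = cl (u + j * p)" and "t = cl (u + k * p)"
  have "(t - s) * N < (p + 1) * N"
  proof -
    have "(k - j) * p \<le> N * p" using assms p_pos by (intro mult_right_mono) auto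
    then show ?thesis using cl_diff[of u k j] by (simp add: s_def t_def algebra_simps)
  qed
  then have "t \<le> s + p" using N_gt_1 by simp
  have "s \<le> t" 
  proof -
    have "u + j * p \<le> u + k * p" using assms p_pos by simp
    also have "\<dots> \<le> t * N" using cl_le_iff t_def by blast
    finally show ?thesis unfolding s_def cl_le_iff .
  qed
  have "sz {x. j \<le> idx u x \<and> idx u x < k} = real (card {s..<t})"
    using sz_arc[of UNIV t s] \<open>t \<le> s + p\<close> unfolding idx_arc[OF assms] s_def[symmetric] t_def[symmetric]
    by (simp add: per_def)
  also have "\<dots> = t - s" using \<open>s \<le> t\<close> by simp
  also have "\<dots> \<le> (k - j) * p / N + 1"
  proof -
    have "real_of_int ((t - s) * N) \<le> (k - j) * p + N"
      using cl_diff[of u k j] unfolding s_def t_def by linarith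
    then have "real_of_int (t - s) * N \<le> (k - j) * p + N" by simp
    then show ?thesis using N_gt_1 by (simp add: field_simps)
  qed
  finally show ?thesis .
qed

text \<open>The remainders of the two positions inside their windows may produce a carry of one
  window.\<close>

lemma idx_add: "idx (u + w) (x + y) = (idx u x + idx w y) mod N \<or>
  idx (u + w) (x + y) = (idx u x + idx w y + 1) mod N"
proof -
  define a b where "a = x * N - u" and "b = y * N - w"
  have ab: "(x + y) * N - (u + w) = a + b" by (simp add: a_def b_def algebra_simps)
  have "(a + b) div p = a div p + b div p + (a mod p + b mod p) div p"
    by (rule div_add1_eq)
  moreover have "(a mod p + b mod p) div p = 0 \<or> (a mod p + b mod p) div p = 1"
  proof -
    have "0 \<le> a mod p" "a mod p < p" "0 \<le> b mod p" "b mod p < p" using p_pos by simp_all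
    then show ?thesis
    proof (cases "a mod p + b mod p < p")
      case False
      have "(a mod p + b mod p) div p = (a mod p + b mod p - p) div p + 1"
        using div_add_self2[of p "a mod p + b mod p - p"] p_pos by simp
      also have "(a mod p + b mod p - p) div p = 0"
        using False \<open>a mod p < p\<close> \<open>b mod p < p\<close> by (intro div_pos_pos_trivial) auto
      finally show ?thesis by simp
    qed (auto intro: div_pos_pos_trivial)
  qed
  ultimately have "(a + b) div p = a div p + b div p \<or> (a + b) div p = a div p + b div p + 1"
    by auto
  then show ?thesis
    unfolding idx_def ab a_def[symmetric] b_def[symmetric]
    by (metis mod_add_eq mod_add_left_eq)
qed

text \<open>Sums of elements from \<open>K\<close> consecutive windows occupy at most
  \<open>2 * K + 1\<close> windows. The spare window in the condition on \<open>N\<close> pays for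
  rounding the endpoints to integers.\<close>

lemma two_rows_idx:
  assumes B: "B \<subseteq> A" "per B" "0 < sz B" "\<And>x. x \<in> B \<Longrightarrow> idx u x < K" and K: "0 \<le> K" "2 * (K + 1) \<le> N"
  shows "2 * sz B - 1 - 2 * d \<le> sz (R \<inter> {y. idx (2 * u) y \<le> 2 * K})"
proof -
  define s t where "s = cl (u + 0 * p)" and "t = cl (u + K * p)"
  have "B \<subseteq> {x. 0 \<le> idx u x \<and> idx u x < K}" using B idx_range by auto
  then have "B \<subseteq> arc s t" using idx_arc[of 0 K u] K by (simp add: s_def t_def)
  moreover have "2 * (t - s) \<le> p"
  proof -
    have "(t - s) * N < K * p + N" using cl_diff[of u K 0] by (simp add: s_def t_def)
    then have "2 * ((t - s) * N) \<le> 2 * (K * p + N)" by simp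
    then have "2 * (t - s) * N \<le> 2 * (K * p + N)" by (simp only: mult.assoc)
    also have "\<dots> \<le> 2 * (K + 1) * p" using N_le_p by (simp add: algebra_simps)
    also have "\<dots> \<le> N * p" using K p_pos by (intro mult_right_mono) auto
    finally show ?thesis using N_gt_1 by (simp add: mult.commute)
  qed
  ultimately have "2 * sz B - 1 - 2 * d \<le> sz (R \<inter> arc (2 * s) (2 * t))"
    using two_rows[OF per_A B(2) per_R B(1)] B(3) rows by blast
  also have "arc (2 * s) (2 * t) \<subseteq> {y. idx (2 * u) y \<le> 2 * K}"
  proof
    fix y assume y: "y \<in> arc (2 * s) (2 * t)"
    define x where "x = 2 * s + (y - 2 * s) mod p"
    have x: "2 * s \<le> x" "x \<le> 2 * t - 1" using y p_pos by (simp_all add: x_def arc_def)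
    have "y mod p = x mod p" by (simp add: x_def mod_simps)
    then have idx: "idx (2 * u) y = idx (2 * u) x" by (rule idx_cong)
    have "u \<le> s * N" using cl_le_iff[of "u + 0 * p" s] by (simp add: s_def)
    moreover have "2 * s * N \<le> x * N" using x(1) N_gt_1 by (intro mult_right_mono) auto
    ultimately have lo: "0 \<le> x * N - 2 * u" by linarith
    have "(t - 1) * N < u + K * p" using less_cl_iff[of "t - 1" "u + K * p"] by (simp add: t_def)
    moreover have "x * N \<le> (2 * (t - 1) + 1) * N" using x(2) N_gt_1 by (intro mult_right_mono) auto
    ultimately have "x * N - 2 * u < 2 * (K * p) + N" by (simp only: distrib_right mult.assoc)
    then have hi: "x * N - 2 * u < (2 * K + 1) * p"
      using N_le_p by (simp only: distrib_right mult.assoc)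
    have "0 \<le> (x * N - 2 * u) div p" using lo p_pos by (simp add: pos_imp_zdiv_nonneg_iff)
    moreover have "(x * N - 2 * u) div p < 2 * K + 1" using hi p_pos le_div_iff_mult_le[of p "2 * K + 1" "x * N - 2 * u"] by linarith
    ultimately have "((x * N - 2 * u) div p) mod N = (x * N - 2 * u) div p"
      using K by (intro mod_pos_pos_trivial) auto
    then show "y \<in> {y. idx (2 * u) y \<le> 2 * K}"
      unfolding mem_Collect_eq idx using \<open>(x * N - 2 * u) div p < 2 * K + 1\<close> by (simp add: idx_def)
  qed
  then have "sz (R \<inter> arc (2 * s) (2 * t)) \<le> sz (R \<inter> {y. idx (2 * u) y \<le> 2 * K})"
    by (intro sz_mono) blast
  finally show ?thesis by simp
qed

section \<open>An arc shorter than half of the circle\<close>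

definition core :: "int set" where
  "core = {a \<in> A. idx v a < L}"

lemma per_core: "per core"
  unfolding core_def using per_idx_Int[OF per_A, of "\<lambda>i. i < L" v] .

lemma sz_core: "sz A - 2 * N * e \<le> sz core"
proof -
  have "sz A = sz core + sz {a \<in> A. L \<le> idx v a}"
    unfolding sz_def core_def sum.distrib[symmetric] by (intro sum.cong) auto
  then show ?thesis using outside by simp
qed

text \<open>An element far from the arc would contribute a substantial set of sums outside the arc
  that contains the sums of the core.\<close>

lemma far_element:
  assumes short: "2 * (L + 8) \<le> N" and z: "z \<in> A" "L + 4 \<le> idx v z" "idx v z < N - 4"
  shows "2 * sz core - 1 - 3 * d + min (sz X - 6 * e - m) (sz core) \<le> sz R"
proof -
  define \<zeta> where "\<zeta> = idx v z"
  define D where "D = {y. idx (2 * v) y \<le> 2 * L}"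
  have per_D: "per D" unfolding D_def by (rule per_idx)
  have core_pos: "0 < sz core" using sz_core A_pos by simp
  have in_D: "2 * sz core - 1 - 2 * d \<le> sz (R \<inter> D)"
    unfolding D_def by (rule two_rows_idx) (use core_pos per_core L short in \<open>auto simp: core_def\<close>)
  define A1 where "A1 = {a \<in> A. z + a \<notin> D}"
  have out: "a \<in> A1" if "a \<in> A" "2 * L + 1 \<le> \<zeta> + idx v a" "\<zeta> + idx v a + 1 < N" for a
  proof -
    have "idx (v + v) (z + a) = \<zeta> + idx v a \<or> idx (v + v) (z + a) = \<zeta> + idx v a + 1"
      using idx_add[of v v z a] that L by (simp add: \<zeta>_def)
    then have "\<not> idx (2 * v) (z + a) \<le> 2 * L" using that by auto
    then show ?thesis using that by (simp add: A1_def D_def)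
  qed
  \<comment> \<open>Adding \<open>z\<close> carries either the whole core, or at least one dense
    window, past the end of \<open>D\<close>, without wrapping round to its start.\<close>
  have A1: "min (sz X - 6 * e - m) (sz core) \<le> sz A1"
  proof (cases "2 * L + 1 \<le> \<zeta> \<and> \<zeta> + L < N")
    case True
    have "core \<subseteq> A1"
    proof
      fix a assume "a \<in> core"
      then show "a \<in> A1" using True out[of a] idx_range[of v a] by (simp add: core_def)
    qed
    then show ?thesis using sz_mono[of core A1] by simp
  next
    case False
    define i where "i = max 1 (2 * L + 1 - \<zeta>)"
    have "0 < i" "i < L - 1" "2 * L + 1 \<le> \<zeta> + i" "\<zeta> + i + 1 < N"
      using False z short by (auto simp: i_def \<zeta>_def max_def split: if_splits)
    then have "sz X - 6 * e - m \<le> win v i" and "{a \<in> A. idx v a = i} \<subseteq> A1"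
      using inside out by auto
    then show ?thesis using sz_mono[of "{a \<in> A. idx v a = i}" A1] by (simp add: win_def)
  qed
  have row: "sz {y \<in> A. z + y \<notin> R} \<le> d" using rows z by blast
  have perA1: "per A1" and perrow: "per {y \<in> A. z + y \<notin> R}"
  proof -
    have "z + (y + p) = (z + y) + p" for y by simp
    then show "per A1" "per {y \<in> A. z + y \<notin> R}"
      using perD[OF per_A] perD[OF per_D] perD[OF per_R]
      by (simp_all only: per_def A1_def mem_Collect_eq simp_thms)
  qed
  have "sz A1 \<le> sz ((A1 - {y \<in> A. z + y \<notin> R}) \<union> {y \<in> A. z + y \<notin> R})"
    by (rule sz_mono) auto
  also have "\<dots> \<le> sz (A1 - {y \<in> A. z + y \<notin> R}) + d"
    using sz_Un_Int[of "A1 - {y \<in> A. z + y \<notin> R}" "{y \<in> A. z + y \<notin> R}"] row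
      sz_nonneg[of "(A1 - {y \<in> A. z + y \<notin> R}) \<inter> {y \<in> A. z + y \<notin> R}"] by linarith
  also have "sz (A1 - {y \<in> A. z + y \<notin> R}) = sz (shift z (A1 - {y \<in> A. z + y \<notin> R}))"
    using perA1 perrow by simp
  also have "\<dots> \<le> sz (R - D)"
    by (rule sz_mono) (auto simp: A1_def)
  finally have "sz A1 - d \<le> sz (R - D)" by simp
  then show ?thesis using in_D A1 sz_Int_Diff[of R D] by linarith
qed

text \<open>Widened by four windows on either side, the arc contains all of \<open>A\<close> and is
  still at most half of the circle, so \<open>two_rows_idx\<close> applies to \<open>A\<close>
  itself instead of its core.\<close>

lemma near_imp_bound:
  assumes short: "2 * (L + 9) \<le> N" and near: "\<And>z. z \<in> A \<Longrightarrow> idx v z < L + 4 \<or> N - 4 \<le> idx v z"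
  shows "2 * sz A - 1 - 2 * d \<le> sz R"
proof -
  have "0 \<le> real_of_int (2 * N)" using N_gt_1 by simp
  then have "0 \<le> 2 * N * e" using e_ge_1 by (intro mult_nonneg_nonneg) auto
  then have A0: "0 < sz A" using A_pos by linarith
  have "2 * sz A - 1 - 2 * d \<le> sz (R \<inter> {y. idx (2 * (v + (- 4) * p)) y \<le> 2 * (L + 8)})"
  proof (rule two_rows_idx)
    fix z assume "z \<in> A"
    have "idx (v + (- 4) * p) z = (idx v z - (- 4)) mod N" by (rule idx_shift)
    moreover have "idx v z - (- 4) = idx v z + 4" by simp
    moreover have "(idx v z + 4) mod N < L + 8"
    proof (cases "idx v z + 4 < N")
      case True
      then have "(idx v z + 4) mod N = idx v z + 4"
        using idx_range[of v z] by (intro mod_pos_pos_trivial) auto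
      then show ?thesis using near[OF \<open>z \<in> A\<close>] True by linarith
    next
      case False
      have "(idx v z + 4) mod N = (idx v z + 4 - N) mod N" by simp
      also have "\<dots> = idx v z + 4 - N"
        using False idx_range[of v z] L short by (intro mod_pos_pos_trivial) auto
      finally show ?thesis using idx_range[of v z] L by linarith
    qed
    ultimately show "idx (v + (- 4) * p) z < L + 8" by (simp only:)
  qed (use per_A A0 L short in auto)
  also have "\<dots> \<le> sz R" by (rule sz_mono) auto
  finally show ?thesis .
qed

text \<open>If the arc is long but \<open>A\<close> has local density more than \<open>1/2\<close> on it, then almost every
  residue has many representations.\<close>

lemma dense_imp_large:
  fixes M :: nat
  assumes long: "N < 2 * (L + 9)" and dense: "p / N \<le> 2 * (sz X - 6 * e - m)" and M: "1 \<le> M"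
    and \<rho>: "0 < \<rho>" "\<rho> \<le> M * (2 * (sz X - 6 * e - m) - p / N) - (sz X - 6 * e - m) - 1"
  shows "p - (2 * M + 22) * (p / N + 1) - d * sz A / \<rho> \<le> sz R"
proof -
  define c where "c = sz X - 6 * e - m"
  have c_pos: "0 \<le> c" 
  proof -
    have "0 \<le> real_of_int p / real_of_int N" using p_pos N_gt_1 by (intro divide_nonneg_nonneg) auto
    from order_trans[OF this dense] show ?thesis unfolding c_def by simp
  qed
  have many: "\<rho> \<le> conv A A z" if z: "M + 1 \<le> idx (2 * v) z" "idx (2 * v) z \<le> 2 * L - 2 - M" for z
  proof -
    define Q where "Q = idx (2 * v) z"
    \<comment> \<open>\<open>BJ\<close> has one window fewer than \<open>AI\<close> because of the
      carry: reflected in \<open>z\<close>, each of its windows meets two consecutive ones, and all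
      of them have to stay in \<open>W\<close>. Once \<open>c\<close> exceeds half of the length of
      a window, the two sets must overlap in \<open>W\<close>, and the overlap grows with the number
      of windows, which is at least \<open>M\<close>.\<close>
    define i0 i1 where "i0 = max 1 (Q - L + 1)" and "i1 = min (L - 2) (Q - 1)"
    define W where "W = {x. i0 \<le> idx v x \<and> idx v x < i1 + 1}"
    define AI where "AI = {a \<in> A. idx v a \<in> {i0..i1}}"
    define BJ where "BJ = {b \<in> A. idx v b \<in> {Q - i1..Q - 1 - i0}}"
    have i: "1 \<le> i0" "i1 \<le> L - 2" "1 \<le> Q - i1" "Q - 1 - i0 \<le> L - 2" "M \<le> i1 - i0 + 1"
      using z M by (auto simp: i0_def i1_def Q_def)
    have szAI: "(i1 - i0 + 1) * c \<le> sz AI"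
    proof -
      have "(\<Sum>j\<in>{i0..i1}. c) \<le> (\<Sum>j\<in>{i0..i1}. win v j)"
        using i by (intro sum_mono) (auto simp: c_def intro!: inside)
      moreover have "sz AI = (\<Sum>j\<in>{i0..i1}. win v j)"
        unfolding AI_def win_def by (rule sz_partition) simp
      ultimately show ?thesis using i(5) M by simp
    qed
    have szBJ: "(i1 - i0) * c \<le> sz BJ"
    proof -
      have "(\<Sum>j\<in>{Q - i1..Q - 1 - i0}. c) \<le> (\<Sum>j\<in>{Q - i1..Q - 1 - i0}. win v j)"
        using i by (intro sum_mono) (auto simp: c_def intro!: inside)
      moreover have "sz BJ = (\<Sum>j\<in>{Q - i1..Q - 1 - i0}. win v j)"
        unfolding BJ_def win_def by (rule sz_partition) simp
      ultimately show ?thesis using i(5) M by (simp add: algebra_simps)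
    qed
    have perBJ: "per BJ" unfolding BJ_def by (rule per_idx_Int[OF per_A])
    have "AI \<subseteq> W" by (auto simp: AI_def W_def)
    moreover have "{x. z - x \<in> BJ} \<subseteq> W"
    proof
      fix x assume x: "x \<in> {x. z - x \<in> BJ}"
      have "idx (v + v) ((z - x) + x) = (idx v (z - x) + idx v x) mod N \<or>
          idx (v + v) ((z - x) + x) = (idx v (z - x) + idx v x + 1) mod N"
        by (rule idx_add)
      then have "(idx v (z - x) + idx v x) mod N = Q \<or> (idx v (z - x) + idx v x + 1) mod N = Q"
        by (auto simp: Q_def)
      then have "(Q - idx v (z - x)) mod N = idx v x mod N \<or> (Q - idx v (z - x) - 1) mod N = idx v x mod N"
        using mod_diff_left_eq[of "idx v (z - x) + idx v x" N "idx v (z - x)"]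
          mod_diff_left_eq[of "idx v (z - x) + idx v x + 1" N "idx v (z - x) + 1"]
        by (auto simp: diff_diff_eq)
      moreover have "Q - idx v (z - x) \<in> {i0 + 1..i1}" using x by (auto simp: BJ_def)
      moreover have "idx v x mod N = idx v x" using idx_range[of v x] by (intro mod_pos_pos_trivial) auto
      ultimately have "idx v x = Q - idx v (z - x) \<or> idx v x = Q - idx v (z - x) - 1"
        using i L by (auto)
      then show "x \<in> W" using \<open>Q - idx v (z - x) \<in> {i0 + 1..i1}\<close> by (auto simp: W_def)
    qed
    ultimately have "sz AI + sz BJ \<le> sz W + sz (AI \<inter> {x. z - x \<in> BJ})"
      using sz_Un_Int[of AI "{x. z - x \<in> BJ}"] sz_mono[of "AI \<union> {x. z - x \<in> BJ}" W]
        sz_reflect[OF perBJ, of z] by simp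
    moreover have "sz (AI \<inter> {x. z - x \<in> BJ}) \<le> conv A A z"
      unfolding conv_def sz_def by (intro sum_mono) (auto simp: AI_def BJ_def)
    moreover have "sz W \<le> (i1 - i0 + 1) * p / N + 1"
      unfolding W_def using sz_idx[of i0 "i1 + 1" v] i L M by (simp add: algebra_simps)
    ultimately have "(i1 - i0 + 1) * c + (i1 - i0) * c - (i1 - i0 + 1) * p / N - 1 \<le> conv A A z"
      using szAI szBJ by linarith
    moreover have "(i1 - i0 + 1) * c + (i1 - i0) * c - (i1 - i0 + 1) * p / N - 1 =
        (i1 - i0 + 1) * (2 * c - p / N) - c - 1"
      by (simp add: algebra_simps add_divide_distrib diff_divide_distrib)
    moreover have "M * (2 * c - p / N) \<le> (i1 - i0 + 1) * (2 * c - p / N)"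
      using i(5) dense by (intro mult_right_mono) (auto simp: c_def)
    ultimately show ?thesis using \<rho>(2) by (simp add: c_def)
  qed
  \<comment> \<open>Double counting: a good residue missing from \<open>R\<close> has at least
    \<rho> representations, all by excluded pairs, of which every row has at most \<open>d\<close>.
    At most \<open>2 * M + 20\<close> windows are not good.\<close>
  define Good where "Good = {z. M + 1 \<le> idx (2 * v) z \<and> idx (2 * v) z \<le> 2 * L - 2 - M}"
  have "\<rho> * sz (Good - R) = (\<Sum>z\<in>{0..<p}. of_bool (z \<in> Good - R) * \<rho>)"
    by (simp add: sz_def sum_distrib_left mult.commute)
  also have "\<dots> \<le> (\<Sum>z\<in>{0..<p}. of_bool (z \<notin> R) * conv A A z)"
    using many by (intro sum_mono) (auto simp: Good_def of_bool_def)
  also have "\<dots> = (\<Sum>x\<in>{0..<p}. of_bool (x \<in> A) * sz {y \<in> A. x + y \<notin> R})"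
  proof -
    have "sz {y \<in> A. x + y \<notin> R} = (\<Sum>z\<in>{0..<p}. of_bool (z \<notin> R) * of_bool (z - x \<in> A))" for x
    proof -
      have "x + (y + p) = (x + y) + p" for y by simp
      then have per': "per {y \<in> A. x + y \<notin> R}"
        using perD[OF per_A] perD[OF per_R] by (simp only: per_def mem_Collect_eq simp_thms)
      have "sz {y \<in> A. x + y \<notin> R} = sz (shift x {y \<in> A. x + y \<notin> R})" using per' by simp
      then show ?thesis unfolding sz_def by (auto simp: of_bool_def intro!: sum.cong)
    qed
    then have "(\<Sum>x\<in>{0..<p}. of_bool (x \<in> A) * sz {y \<in> A. x + y \<notin> R}) =
        (\<Sum>x\<in>{0..<p}. \<Sum>z\<in>{0..<p}. of_bool (z \<notin> R) * (of_bool (x \<in> A) * of_bool (z - x \<in> A)))"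
      by (simp add: sum_distrib_left mult_ac)
    also have "\<dots> = (\<Sum>z\<in>{0..<p}. of_bool (z \<notin> R) * conv A A z)"
      unfolding conv_def sum_distrib_left by (rule sum.swap)
    finally show ?thesis by simp
  qed
  also have "\<dots> \<le> (\<Sum>x\<in>{0..<p}. of_bool (x \<in> A) * d)"
    using rows by (intro sum_mono) (auto simp: of_bool_def)
  also have "\<dots> = d * sz A" by (simp add: sz_def sum_distrib_left mult.commute)
  finally have "sz (Good - R) \<le> d * sz A / \<rho>" using \<rho>(1) by (simp add: field_simps)
  moreover have "sz (- Good) \<le> (2 * M + 22) * (p / N + 1)"
  proof -
    define k where "k = min N (M + 1)"
    define l where "l = max 0 (min N (2 * L - 1 - M))"
    have "- Good \<subseteq> {z. 0 \<le> idx (2 * v) z \<and> idx (2 * v) z < k} \<union> {z. l \<le> idx (2 * v) z \<and> idx (2 * v) z < N}"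
      using idx_range by (auto simp: Good_def k_def l_def)
    then have "sz (- Good) \<le> sz ({z. 0 \<le> idx (2 * v) z \<and> idx (2 * v) z < k} \<union> {z. l \<le> idx (2 * v) z \<and> idx (2 * v) z < N})"
      by (rule sz_mono)
    also have "\<dots> \<le> sz {z. 0 \<le> idx (2 * v) z \<and> idx (2 * v) z < k} + sz {z. l \<le> idx (2 * v) z \<and> idx (2 * v) z < N}"
      using sz_Un_Int[of "{z. 0 \<le> idx (2 * v) z \<and> idx (2 * v) z < k}" "{z. l \<le> idx (2 * v) z \<and> idx (2 * v) z < N}"]
        sz_nonneg[of "{z. 0 \<le> idx (2 * v) z \<and> idx (2 * v) z < k} \<inter> {z. l \<le> idx (2 * v) z \<and> idx (2 * v) z < N}"]
      by linarith
    also have "\<dots> \<le> (k * p / N + 1) + ((N - l) * p / N + 1)"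
      using sz_idx[of 0 k "2 * v"] sz_idx[of l N "2 * v"] N_gt_1 by (simp add: k_def l_def)
    also have "\<dots> = (k + (N - l)) * (p / N) + 2"
      by (simp add: algebra_simps add_divide_distrib diff_divide_distrib)
    also have "\<dots> \<le> (2 * M + 20) * (p / N) + 2"
    proof -
      have "k + (N - l) \<le> 2 * M + 20" using long by (auto simp: k_def l_def)
      then have "real_of_int (k + (N - l)) \<le> 2 * M + 20" by linarith
      then show ?thesis using p_pos N_gt_1 by (intro add_right_mono mult_right_mono) auto
    qed
    also have "\<dots> \<le> (2 * M + 22) * (p / N + 1)"
    proof -
      obtain y where y: "real_of_int p / real_of_int N = y" by blast
      then have "0 \<le> y" using p_pos N_gt_1 by (auto intro!: divide_nonneg_nonneg)
      then show ?thesis unfolding y by (simp add: algebra_simps)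
    qed
    finally show ?thesis .
  qed
  moreover have "p - sz R \<le> sz (- Good) + sz (Good - R)"
  proof -
    have "p - sz R = sz (- R)" by (simp add: sz_Compl)
    also have "\<dots> \<le> sz (- Good \<union> (Good - R))" by (rule sz_mono) auto
    also have "\<dots> \<le> sz (- Good) + sz (Good - R)"
      using sz_Un_Int[of "- Good" "Good - R"] sz_nonneg[of "- Good \<inter> (Good - R)"] by linarith
    finally show ?thesis .
  qed
  ultimately show ?thesis by linarith
qed

end

section \<open>Rectification by dilation\<close>

text \<open>The mean value theorem with a half-angle bound for the cosine. At \<open>pi / N\<close>
  with \<open>N\<close> huge, the sine is within one percent of its argument.\<close>

lemma sin_lower_bound:
  fixes x :: real
  assumes "0 \<le> x" "x \<le> 1"
  shows "x * (1 - x\<^sup>2 / 2) \<le> sin x"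
proof (cases "x = 0")
  case False
  then have x: "0 < x" using assms by simp
  have "\<exists>z>0. z < x \<and> sin x - sin 0 = (x - 0) * cos z"
    using x by (intro MVT2) (auto intro!: derivative_eq_intros)
  then obtain z where z: "0 < z" "z < x" "sin x = x * cos z" by auto
  have "1 - x\<^sup>2 / 2 \<le> cos z"
  proof -
    have "\<bar>sin (z / 2)\<bar> \<le> \<bar>z / 2\<bar>" by (rule abs_sin_x_le_abs_x)
    then have "(sin (z / 2))\<^sup>2 \<le> (z / 2)\<^sup>2" by (simp only: abs_le_square_iff)
    moreover have "cos z = 1 - 2 * (sin (z / 2))\<^sup>2" using cos_double_sin[of "z / 2"] by simp
    moreover have "z\<^sup>2 \<le> x\<^sup>2" using z by (intro power_mono) auto
    ultimately show ?thesis by (simp add: power_divide)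
  qed
  then show ?thesis using z x by (simp add: mult_left_mono)
qed simp

text \<open>The known cosine of \<pi>/6, expressed by the sine of \<pi>/12, bounds \<pi> from below.
  The final constants need \<open>99/100 * pi * 332/1000\<close> to exceed 1, for which 3 would be
  too small.\<close>

lemma pi_ge_31_tenths: "31 / 10 \<le> pi"
proof -
  have "\<bar>sin (pi / 12)\<bar> \<le> \<bar>pi / 12\<bar>" by (rule abs_sin_x_le_abs_x)
  then have "(sin (pi / 12))\<^sup>2 \<le> (pi / 12)\<^sup>2" by (simp only: abs_le_square_iff)
  moreover have "sqrt 3 / 2 = 1 - 2 * (sin (pi / 12))\<^sup>2"
    using cos_double_sin[of "pi / 12"] cos_30 by simp
  moreover have "sqrt 3 \<le> 17321 / 10000"
    by (rule real_le_lsqrt) (simp_all add: power2_eq_square)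
  ultimately have "(31 / 10)\<^sup>2 \<le> pi\<^sup>2"
    by (simp add: power2_eq_square)
  then show ?thesis by (rule power2_le_imp_le) simp
qed

context prime_modulus
begin

lemma exists_subset_sz:
  assumes "per B" "real k \<le> sz B"
  shows "\<exists>S\<subseteq>B. per S \<and> sz S = k"
proof -
  have "k \<le> card (B \<inter> {0..<p})" using assms by (simp add: sz_card)
  then obtain S0 where S0: "S0 \<subseteq> B \<inter> {0..<p}" "card S0 = k"
    using obtain_subset_with_card_n by blast
  define S where "S = {x. x mod p \<in> S0}"
  have "S \<inter> {0..<p} = S0" using S0 by (auto simp: S_def)
  then have "sz S = k" using S0 by (simp add: sz_card)
  moreover have "per S" by (simp add: per_def S_def)
  moreover have "S \<subseteq> B"
  proof
    fix x assume "x \<in> S"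
    then have "x mod p \<in> B" using S0 by (auto simp: S_def)
    then show "x \<in> B" using per_cong[OF assms(1), of "x mod p" x] by simp
  qed
  ultimately show ?thesis by blast
qed

text \<open>A solution picks a pair whose sum is outside \<open>R\<close>, so the row bounds limit
  the number of solutions.\<close>

lemma triples_le_rows:
  assumes "\<And>x. x \<in> A \<Longrightarrow> sz {y \<in> B. x + y \<notin> R} \<le> d" and "C \<subseteq> {z. - z \<notin> R}"
  shows "triples A B C \<le> d * sz A"
proof -
  have "triples A B C \<le> (\<Sum>x\<in>{0..<p}. of_bool (x \<in> A) * sz {y \<in> B. x + y \<notin> R})"
    unfolding triples_def sz_def sum_distrib_left
  proof (intro sum_mono)
    fix x y :: int
    have eq: "- (- x - y) = x + y" by simp
    have "- x - y \<in> C \<Longrightarrow> - (- x - y) \<notin> R" using assms(2) by blast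
    then show "of_bool (x \<in> A) * of_bool (y \<in> B) * of_bool (- x - y \<in> C) \<le>
        (of_bool (x \<in> A) * of_bool (y \<in> {y \<in> B. x + y \<notin> R}) :: real)" unfolding eq by auto
  qed
  also have "\<dots> \<le> (\<Sum>x\<in>{0..<p}. of_bool (x \<in> A) * d)"
    using assms(1) by (intro sum_mono) (auto simp: of_bool_def)
  also have "\<dots> = d * sz A" by (simp add: sz_def sum_distrib_left mult.commute)
  finally show ?thesis .
qed

text \<open>For \<open>c\<close> not divisible by \<open>p\<close> this is dilation by the inverse
  of \<open>c\<close>; a preimage keeps membership and periodicity immediate.\<close>

definition dil :: "int \<Rightarrow> int set \<Rightarrow> int set" where
  "dil c A = {x. c * x \<in> A}"

lemma per_dil [intro]: "per A \<Longrightarrow> per (dil c A)"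
  using per_mult[of A _ c] by (simp add: per_def dil_def ring_distribs mult.commute)

lemma sz_dil: "per A \<Longrightarrow> \<not> p dvd c \<Longrightarrow> sz (dil c A) = sz A"
  using sum_mult[of "\<lambda>x. of_bool (x \<in> A)" c] perD by (simp add: sz_def dil_def)

lemma triples_dil:
  assumes "per A" "per B" "per C" "\<not> p dvd c"
  shows "triples (dil c A) (dil c B) (dil c C) = triples A B C"
proof -
  define F :: "int \<Rightarrow> int \<Rightarrow> real" where
    "F x y = of_bool (x \<in> A) * of_bool (y \<in> B) * of_bool (- x - y \<in> C)" for x y
  have C: "- (x + p) - y \<in> C \<longleftrightarrow> - x - y \<in> C" "- x - (y + p) \<in> C \<longleftrightarrow> - x - y \<in> C" for x y
  proof -
    have "- (x + p) - y = (- x - y) - p" "- x - (y + p) = (- x - y) - p" by simp_all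
    then show "- (x + p) - y \<in> C \<longleftrightarrow> - x - y \<in> C" "- x - (y + p) \<in> C \<longleftrightarrow> - x - y \<in> C"
      using perD_minus[OF assms(3), of "- x - y"] by (simp_all only:)
  qed
  have F: "F (x + p) y = F x y" "F x (y + p) = F x y" for x y
    unfolding F_def C perD[OF assms(1)] perD[OF assms(2)] by (rule refl)+
  have "triples (dil c A) (dil c B) (dil c C) = (\<Sum>x\<in>{0..<p}. \<Sum>y\<in>{0..<p}. F (c * x) (c * y))"
    unfolding triples_def dil_def F_def by (simp add: right_diff_distrib)
  also have "\<dots> = (\<Sum>x\<in>{0..<p}. \<Sum>y\<in>{0..<p}. F (c * x) y)"
  proof (rule sum.cong[OF refl])
    show "(\<Sum>y\<in>{0..<p}. F (c * x) (c * y)) = (\<Sum>y\<in>{0..<p}. F (c * x) y)" for x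
      by (rule sum_mult[of "F (c * x)", OF F(2) assms(4)])
  qed
  also have "\<dots> = (\<Sum>x\<in>{0..<p}. \<Sum>y\<in>{0..<p}. F x y)"
    by (rule sum_mult[of "\<lambda>x. \<Sum>y\<in>{0..<p}. F x y", OF _ assms(4)]) (simp add: F(1))
  finally show ?thesis by (simp add: triples_def F_def)
qed

lemma abs_sin_cong: "x mod p = y mod p \<Longrightarrow> \<bar>sin (pi * x / p)\<bar> = \<bar>sin (pi * y / p)\<bar>"
proof -
  assume xy: "x mod p = y mod p"
  have sq: "(sin (pi * x / p))\<^sup>2 = (1 - Re (chi x)) / 2" for x
    using cos_double_sin[of "pi * x / p"] by (simp add: chi_def mult.assoc)
  have "chi (x + p) = chi x" for x using chi_add_p[of 1 x] by simp
  then have "chi x = chi y" using periodic_cong[of chi] xy by blast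
  then have "(sin (pi * x / p))\<^sup>2 = (sin (pi * y / p))\<^sup>2" by (simp only: sq)
  then show ?thesis by (simp add: power2_eq_iff abs_eq_iff)
qed

text \<open>The sine increases up to \<pi>/2, so once \<open>h\<close> is reduced to its residue of
  least absolute value, a small sine means a small residue.\<close>

lemma small_sin_imp_small:
  fixes N :: int
  assumes "2 \<le> N" "\<bar>sin (pi * h / p)\<bar> < sin (pi / N)"
  shows "\<exists>r. p dvd h - r \<and> \<bar>r\<bar> * N < p"
proof -
  have key: "r * N < p" if r: "0 \<le> r" "2 * r \<le> p" "sin (pi * r / p) < sin (pi / N)" for r :: int
  proof (rule ccontr)
    assume "\<not> r * N < p"
    then have "real_of_int p \<le> r * N" by linarith
    then have "pi / N \<le> pi * r / p"
      using assms(1) p_pos by (simp add: field_simps)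
    moreover have "pi * r / p \<le> pi / 2"
    proof -
      have "real_of_int (2 * r) \<le> p" using r by linarith
      then show ?thesis using p_pos by (simp add: field_simps)
    qed
    moreover have "- (pi / 2) \<le> pi / N" using assms(1) by (intro order_trans[OF _ divide_nonneg_nonneg]) auto
    ultimately have "sin (pi / N) \<le> sin (pi * r / p)" by (intro sin_monotone_2pi_le)
    then show False using r by simp
  qed
  define r where "r = h mod p"
  have r: "0 \<le> r" "r < p" using p_pos by (simp_all add: r_def)
  have "\<bar>sin (pi * h / p)\<bar> = \<bar>sin (pi * r / p)\<bar>"
    by (rule abs_sin_cong) (simp add: r_def)
  then have s: "sin (pi * r / p) < sin (pi / N)" using assms(2) by simp
  show ?thesis
  proof (cases "2 * r \<le> p")
    case True
    then show ?thesis using key[of r] r s by (intro exI[of _ r]) (auto simp: r_def)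
  next
    case False
    have "pi * (p - r) / p = pi - pi * r / p" using p_pos by (simp add: field_simps)
    then have "sin (pi * (p - r) / p) = sin (pi * r / p)" by simp
    then have "(p - r) * N < p" using key[of "p - r"] False r s by simp
    moreover have "p dvd h - (r - p)"
      using dvd_add[OF dvd_minus_mod[of p h] dvd_refl[of p]] by (simp add: r_def algebra_simps)
    ultimately show ?thesis using r by (intro exI[of _ "r - p"]) auto
  qed
qed

text \<open>The start is the leftmost point of \<open>X\<close> near \<open>x0\<close>. The three
  offsets involved are shorter than \<open>p / N\<close>; as \<open>N\<close> is at least 3, their
  congruence is an equation of integers, and so the offset from the start is not negative.\<close>

lemma exists_arc_start:
  fixes N :: int
  assumes "per X" "x0 \<in> X" "3 \<le> N" and close: "\<And>x y. x \<in> X \<Longrightarrow> y \<in> X \<Longrightarrow> \<exists>r. p dvd x - y - r \<and> \<bar>r\<bar> * N < p"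
  shows "\<exists>u. \<forall>x\<in>X. ((x - u) mod p) * N \<le> p"
proof -
  define O' where "O' = {r. \<bar>r\<bar> * N < p \<and> x0 + r \<in> X}"
  have "O' \<subseteq> {- p..p}"
  proof
    fix r assume "r \<in> O'"
    then have "\<bar>r\<bar> * N < p" by (simp add: O'_def)
    moreover have "\<bar>r\<bar> * 1 \<le> \<bar>r\<bar> * N" using assms(3) by (intro mult_left_mono) auto
    ultimately show "r \<in> {- p..p}" by auto
  qed
  then have fin: "finite O'" by (rule finite_subset) simp
  have "0 \<in> O'" using assms(2) p_pos by (simp add: O'_def)
  then have ne: "O' \<noteq> {}" by blast
  define r1 where "r1 = Min O'"
  have r1: "r1 \<in> O'" "\<And>r. r \<in> O' \<Longrightarrow> r1 \<le> r" using fin ne by (auto simp: r1_def)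
  have "((x - (x0 + r1)) mod p) * N \<le> p" if x: "x \<in> X" for x
  proof -
    obtain r where r: "p dvd x - x0 - r" "\<bar>r\<bar> * N < p" using close[OF x assms(2)] by blast
    obtain r' where r': "p dvd x - (x0 + r1) - r'" "\<bar>r'\<bar> * N < p"
      using close[OF x, of "x0 + r1"] r1(1) by (auto simp: O'_def)
    have "(x0 + r) mod p = x mod p" using r(1) by (metis mod_eq_dvd_iff diff_diff_eq)
    then have "x0 + r \<in> X" using per_cong[OF assms(1)] x by blast
    then have "r \<in> O'" using r by (simp add: O'_def)
    then have le: "r1 \<le> r" by (rule r1)
    have "p dvd (x - (x0 + r1) - r') - (x - x0 - r)" by (rule dvd_diff[OF r'(1) r(1)])
    then have dv: "p dvd r - r1 - r'" by (simp add: algebra_simps)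
    have "\<bar>r - r1 - r'\<bar> * N \<le> (\<bar>r\<bar> + \<bar>r1\<bar> + \<bar>r'\<bar>) * N"
      using assms(3) by (intro mult_right_mono) auto
    also have "\<dots> < p * 3" 
    proof -
      have "\<bar>r1\<bar> * N < p" using r1(1) by (simp add: O'_def)
      then show ?thesis using r(2) r'(2) unfolding distrib_right by linarith
    qed
    also have "\<dots> \<le> p * N" using assms(3) p_pos by (intro mult_left_mono) auto
    finally have "\<bar>r - r1 - r'\<bar> < p" using assms(3) by (simp only: mult_less_cancel_right)
    then have "\<not> 0 < \<bar>r - r1 - r'\<bar>" using dv zdvd_not_zless dvd_abs_iff by blast
    then have "r - r1 - r' = 0" by simp
    then have r'_eq: "r' = r - r1" by simp
    then have "0 \<le> r'" using le by simp
    have "r' < p"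
    proof -
      have "r' * 1 \<le> r' * N" using \<open>0 \<le> r'\<close> assms(3) by (intro mult_left_mono) auto
      then show ?thesis using r'(2) \<open>0 \<le> r'\<close> by simp
    qed
    have "(x - (x0 + r1)) mod p = r' mod p" using r'(1) by (simp add: mod_eq_dvd_iff)
    also have "\<dots> = r'" using \<open>0 \<le> r'\<close> \<open>r' < p\<close> by simp
    finally show ?thesis using r'(2) \<open>0 \<le> r'\<close> by simp
  qed
  then show ?thesis by blast
qed

text \<open>\<open>alt\<close> offers two ways to exclude a long arc: its dense windows would hold
  more than all of \<open>A\<close>, or \<open>dense_imp_large\<close> yields at least
  \<open>2 * sz A\<close> sums. A short arc is settled by \<open>far_element\<close> and
  \<open>near_imp_bound\<close>.\<close>

lemma rectified_bound:
  fixes e m d \<rho> :: real and N :: int and M :: nat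
  assumes per: "per X" "per A" "per Z" "per R" and e: "1 \<le> e" "triples X A Z \<le> e * (e - 1)"
    and crit: "p - m \<le> sz X + sz A + sz Z" and N: "1 < N" "N \<le> p"
    and arc: "\<And>x. x \<in> X \<Longrightarrow> (x mod p) * N \<le> p"
    and X: "2 * e \<le> sz X" "sz X + sz A \<le> p"
    and rows: "\<And>x. x \<in> A \<Longrightarrow> sz {y \<in> A. x + y \<notin> R} \<le> d" and d: "0 \<le> d"
    and gap: "sz A + 2 * sz X + 2 * m + 2 * N * e < N * sz X" "2 * N * e < sz A"
    and far: "4 * N * e + d < sz X - 6 * e - m" "6 * N * e + d < sz A"
    and alt: "sz A \<le> (N / 2 - 11) * (sz X - 6 * e - m) \<or>
      p / N \<le> 2 * (sz X - 6 * e - m) \<and> 1 \<le> M \<and> 0 < \<rho> \<and>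
      \<rho> \<le> M * (2 * (sz X - 6 * e - m) - p / N) - (sz X - 6 * e - m) - 1 \<and>
      2 * sz A \<le> p - (2 * M + 22) * (p / N + 1) - d * sz A / \<rho>"
  shows "2 * sz A - 1 - 2 * d \<le> sz R"
proof (rule ccontr)
  assume neg: "\<not> ?thesis"
  interpret arc_critical p X A Z e m N
    by unfold_locales (use per e crit N arc X in auto)
  obtain v L where vL: "1 \<le> L" "L < N" "sz {a \<in> A. L \<le> idx v a} \<le> 2 * N * e"
      "\<And>j. 0 < j \<Longrightarrow> j < L - 1 \<Longrightarrow> sz X - 6 * e - m \<le> win v j"
    using arc_structure[OF gap] by blast
  interpret arc_sums p X A Z e m N R d v L
    by unfold_locales (use per rows N vL gap in auto)
  have Ne: "0 \<le> N * e" using e N by simp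
  show False
  proof (cases "2 * (L + 9) \<le> N")
    case True
    have "idx v z < L + 4 \<or> N - 4 \<le> idx v z" if z: "z \<in> A" for z
    proof (rule ccontr)
      assume "\<not> ?thesis"
      then have "2 * sz core - 1 - 3 * d + min (sz X - 6 * e - m) (sz core) \<le> sz R"
        using True z by (intro far_element[of z]) auto
      then show False using neg far sz_core Ne unfolding min_def by (auto split: if_splits)
    qed
    then show False using near_imp_bound[OF True] neg by blast
  next
    case False
    from alt show False
    proof
      assume small: "sz A \<le> (N / 2 - 11) * (sz X - 6 * e - m)"
      have c: "0 < sz X - 6 * e - m" using far(1) Ne d by linarith
      have "(\<Sum>j\<in>{1..L - 2}. sz X - 6 * e - m) \<le> (\<Sum>j\<in>{1..L - 2}. win v j)"
        by (intro sum_mono inside) auto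
      also have "\<dots> \<le> (\<Sum>j\<in>{0..<N}. win v j)"
        using vL by (intro sum_mono2) (auto simp: win_def)
      finally have "real (nat (L - 2)) * (sz X - 6 * e - m) \<le> sz A" by (simp add: win_sum)
      moreover have "N / 2 - 11 < real (nat (L - 2))"
      proof -
        have "real_of_int N < real_of_int (2 * (L + 9))" using False by (simp only: of_int_less_iff not_le)
        moreover have "real_of_int (L - 2) \<le> real (nat (L - 2))" by linarith
        ultimately show ?thesis by simp
      qed
      moreover have "(N / 2 - 11) * (sz X - 6 * e - m) < real (nat (L - 2)) * (sz X - 6 * e - m)"
        using calculation(2) c by (rule mult_strict_right_mono)
      ultimately show False using small by linarith
    next
      assume *: "p / N \<le> 2 * (sz X - 6 * e - m) \<and> 1 \<le> M \<and> 0 < \<rho> \<and>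
        \<rho> \<le> M * (2 * (sz X - 6 * e - m) - p / N) - (sz X - 6 * e - m) - 1 \<and>
        2 * sz A \<le> p - (2 * M + 22) * (p / N + 1) - d * sz A / \<rho>"
      then have "p - (2 * M + 22) * (p / N + 1) - d * sz A / \<rho> \<le> sz R"
        using False by (intro dense_imp_large) auto
      then show False using * neg d by linarith
    qed
  qed
qed


section \<open>A biased small component\<close>

lemma exists_nontrivial_difference:
  assumes "1 < sz X"
  shows "\<exists>x\<in>X. \<exists>y\<in>X. \<not> p dvd x - y"
proof -
  have "\<not> card (X \<inter> {0..<p}) \<le> Suc 0" using assms by (simp add: sz_card)
  then obtain x y where "x \<in> X" "y \<in> X" "x \<noteq> y" "x \<in> {0..<p}" "y \<in> {0..<p}"
    by (subst (asm) card_le_Suc0_iff_eq) auto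
  then show ?thesis using eq_of_cong[of x y] by blast
qed

text \<open>Above density \<open>1/3\<close> the triple \<open>(A, A, S)\<close> is first replaced by a balanced one, because
  otherwise its largest Fourier coefficient may be too small.\<close>

lemma exists_fourier_bias_dense:
  fixes e \<tau> T P D :: real and i1 i2 :: nat
  assumes per: "per A" "per S" and S: "sz S = p - 2 * sz A" "16 * \<tau> * p \<le> p - 2 * sz A"
    and e: "1 \<le> e" "64 * P * T \<le> e * (e - 1)" and T: "triples A A S \<le> T"
    and P: "P = 2 ^ (i1 + 2 * i2)" "1 \<le> 4 * \<tau> * i2"
    and \<tau>: "0 < \<tau>" "\<tau> \<le> 1 / 100000"
    and q: "64 * P * e \<le> \<tau> * sz A / 10 ^ 7"
    and g: "\<not> p dvd g" "defect A g \<le> D" and D: "D \<le> \<tau> * p" and big: "p < 3 * sz A"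
  shows "\<exists>k. \<not> p dvd k \<and> (\<forall>h. defect A h \<le> D \<longrightarrow> 166 / 1000 * p * \<bar>sin (pi * of_int (k * h) / p)\<bar> \<le> D + 10 * (P * e))"
proof -
  define n where "n = sz A"
  define \<delta> where "\<delta> = 4 * \<tau>"
  define w where "w = (2::real) ^ i2"
  define r where "r = real_of_int p"
  define t where "t = \<tau> * r"
  have r: "0 < r" using p_pos by (simp add: r_def)
  have w: "1 \<le> w" "w * w \<le> P"
  proof -
    have "w * w * 1 \<le> w * w * 2 ^ i1" by (intro mult_left_mono) (auto simp: w_def)
    then show "w * w \<le> P" by (simp add: P w_def power_add power_mult power2_eq_square mult_ac)
  qed (simp add: w_def)
  have wP: "w \<le> P"
  proof -
    have "w * 1 \<le> w * w" using w(1) by (intro mult_left_mono) auto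
    then show ?thesis using w(2) by linarith
  qed
  have P1: "1 \<le> P" using w wP by simp
  have t: "0 < t" "t \<le> r / 100000" using \<tau> r mult_right_mono[of \<tau> "1 / 100000" r] by (auto simp: t_def)
  have n: "r / 3 < n" "2 * n + 16 * t \<le> r" using big S(2) by (simp_all add: n_def r_def t_def)
  have \<tau>n: "\<tau> * n \<le> t" using n t(1) \<tau> by (auto simp: t_def intro!: mult_left_mono)
  have q': "64 * (P * e) \<le> t / 10000000" using q \<tau>n by (simp add: n_def)
  have eq: "e \<le> P * e" "w * e \<le> P * e" "w * (w * e) \<le> P * e"
    using e P1 wP w mult_right_mono[of 1 P e] mult_right_mono[of w P e] mult_right_mono[of "w * w" P e]
    by (simp_all add: mult.assoc)
  have T0: "0 \<le> T" using T triples_nonneg[of A A S] by linarith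
  have PT: "P * T \<le> e * (e - 1) / 64" using e by simp
  have wT: "T \<le> P * T" "w * T \<le> P * T" "w * (w * T) \<le> P * T"
    using T0 P1 wP w mult_right_mono[of 1 P T] mult_right_mono[of w P T] mult_right_mono[of "w * w" P T]
    by (simp_all add: mult.assoc)
  have e0: "0 \<le> e * (e - 1)" using e by simp
  have wA: "w * triples A A S \<le> w * T" using T w by (intro mult_left_mono) auto
  have "\<exists>A1 C1. per A1 \<and> per C1 \<and> p / 3 - 2 * \<delta> * p \<le> sz A1 \<and> sz A1 \<le> p / 3 \<and>
    triples A1 A C1 \<le> 2 ^ i2 * triples A A S \<and> p - 2 ^ i2 * (0 + 2 * e) \<le> sz A1 + sz A + sz C1"
  proof (rule critical_balance[OF per(1,1,2) e(1) _ _ _ g(1)])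
    show "2 ^ i2 * triples A A S \<le> e * (e - 1)"
      using wA wT PT e0 unfolding w_def[symmetric] by linarith
    show "defect A g \<le> \<delta> * p / 2" using g D t by (simp add: \<delta>_def t_def r_def)
    show "sz A \<le> p / 3 + i2 * (\<delta> * p)"
    proof -
      have "1 * r \<le> (4 * \<tau> * i2) * r" using P(2) r by (intro mult_right_mono) auto
      also have "\<dots> = i2 * (\<delta> * p)" by (simp add: \<delta>_def r_def)
      finally show ?thesis using n t r unfolding n_def r_def by linarith
    qed
    show "2 ^ i2 * (0 + 2 * e) \<le> \<delta> * p / 2"
      using eq q' t unfolding w_def[symmetric] by (simp add: \<delta>_def t_def r_def)
  qed (use n t r S \<tau> in \<open>auto simp: n_def \<delta>_def t_def r_def\<close>)
  then obtain A1 C1 where 1: "per A1" "per C1" "r / 3 - 8 * t \<le> sz A1" "sz A1 \<le> r / 3"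
    "triples A1 A C1 \<le> w * triples A A S" "r - 2 * (w * e) \<le> sz A1 + n + sz C1"
    by (auto simp: \<delta>_def t_def r_def n_def w_def mult_ac)
  have T1: "triples A A1 C1 \<le> w * T" using 1(5) wA triples_swap12[of A A1 C1] by linarith
  have "sz A + sz A1 + sz C1 \<le> p + 2 * e"
  proof (rule critical_le)
    show "triples A A1 C1 \<le> e * (e - 1)" using T1 wT PT e0 by linarith
    show "2 * e \<le> sz A" "2 * e \<le> sz A1" "sz A + sz A1 \<le> p"
      using 1(3,4) n t q' eq unfolding n_def r_def by linarith+
  qed (use per 1 e in auto)
  then have C1: "sz A + sz C1 \<le> p" "2 * e \<le> sz C1"
    using 1(3,4,6) n t eq q' unfolding n_def r_def by linarith+
  have def1: "defect A1 h \<le> D + 2 * (w * e) + 2 * e" if "defect A h \<le> D" for h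
  proof -
    have "defect A1 h \<le> defect A h + 2 * (w * e) + 2 * e"
    proof (rule critical_defect[where B = C1])
      show "2 * triples A C1 A1 \<le> e * (e - 1)"
        using T1 wT PT e0 triples_swap23[of A1 C1 A] 1 by linarith
      show "2 * e + defect A h \<le> sz A" using that D n t eq q' unfolding n_def r_def t_def by linarith
    qed (use per 1 e C1 in \<open>auto simp: n_def r_def\<close>)
    then show ?thesis using that by linarith
  qed
  \<comment> \<open>The roles are exchanged: the remaining copy of \<open>A\<close> is shrunk
    against \<open>A1\<close>. Both sets then have size about \<open>p / 3\<close>, and criticality
    makes \<open>C2\<close> at least nearly as large.\<close>
  have "\<exists>A2 C2. per A2 \<and> per C2 \<and> p / 3 - 2 * \<delta> * p \<le> sz A2 \<and> sz A2 \<le> p / 3 \<and>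
    triples A2 A1 C2 \<le> 2 ^ i2 * triples A A1 C1 \<and> p - 2 ^ i2 * (2 * (w * e) + 2 * e) \<le> sz A2 + sz A1 + sz C2"
  proof (rule critical_balance[OF per(1) 1(1,2) e(1) _ _ _ g(1)])
    have "w * triples A A1 C1 \<le> w * (w * T)" using T1 w by (intro mult_left_mono) auto
    then show "2 ^ i2 * triples A A1 C1 \<le> e * (e - 1)"
      using wT PT e0 unfolding w_def[symmetric] by linarith
    show "defect A1 g \<le> \<delta> * p / 2"
      using def1[OF g(2)] D eq q' t by (simp add: \<delta>_def t_def r_def)
    show "sz A \<le> p / 3 + i2 * (\<delta> * p)"
    proof -
      have "1 * r \<le> (4 * \<tau> * i2) * r" using P(2) r by (intro mult_right_mono) auto
      also have "\<dots> = i2 * (\<delta> * p)" by (simp add: \<delta>_def r_def)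
      finally show ?thesis using n t r unfolding n_def r_def by linarith
    qed
    show "2 ^ i2 * (2 * (w * e) + 2 * e) \<le> \<delta> * p / 2"
      using eq q' t unfolding w_def[symmetric] by (simp add: \<delta>_def t_def r_def ring_distribs)
    show "p / 4 \<le> sz A1" "sz A + sz A1 + 2 * \<delta> * p \<le> p"
      using 1(3,4) n t unfolding \<delta>_def n_def t_def r_def by linarith+
  qed (use 1 n t r S \<tau> e w in \<open>auto simp: n_def \<delta>_def t_def r_def\<close>)
  then obtain A2 C2 where 2: "per A2" "per C2" "r / 3 - 8 * t \<le> sz A2" "sz A2 \<le> r / 3"
    "triples A2 A1 C2 \<le> w * triples A A1 C1" "r - (2 * (w * (w * e)) + 2 * (w * e)) \<le> sz A2 + sz A1 + sz C2"
    by (auto simp: \<delta>_def t_def r_def n_def w_def[symmetric] ring_distribs mult_ac)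
  have T2: "triples A1 A2 C2 \<le> P * T"
  proof -
    have "w * triples A A1 C1 \<le> w * (w * T)" using T1 w by (intro mult_left_mono) auto
    then show ?thesis using 2(5) wT triples_swap12[of A1 A2 C2] by linarith
  qed
  have def2: "defect C2 h \<le> D + 10 * (P * e)" if "defect A h \<le> D" for h
  proof -
    have "defect C2 h \<le> defect A1 h + (2 * (w * (w * e)) + 2 * (w * e)) + 2 * e"
    proof (rule critical_defect[where B = A2])
      show "2 * triples A1 A2 C2 \<le> e * (e - 1)" using T2 PT e0 by linarith
      show "2 * e + defect A1 h \<le> sz A1"
        using def1[OF that] 1(3) D t eq q' unfolding n_def r_def t_def by linarith
      show "sz A1 + sz A2 \<le> p" "2 * e \<le> sz A2"
        using 1(4) 2(3,4) r t eq q' unfolding r_def by linarith+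
    qed (use per 1 2 e eq q' t in \<open>auto simp: r_def\<close>)
    then show ?thesis using def1[OF that] eq by linarith
  qed
  obtain k where k: "\<not> p dvd k" "sz A1 * sz A2 * sz C2 - p * triples A1 A2 C2 \<le>
    norm (ft C2 k) * ((sz A1 * (p - sz A1) + sz A2 * (p - sz A2)) / 2)"
    using large_fourier_coefficient[OF 1(1) 2(1,2)] by blast
  have lowC2: "3333 / 10000 * r \<le> sz C2" using 1(4) 2(4,6) eq q' t by linarith
  \<comment> \<open>With three sets of size \<open>p / 3\<close> the product is
    \<open>p^3 / 27\<close> and the Parseval factor is \<open>2 p^2 / 9\<close>, with quotient
    \<open>p / 6\<close>; 166/1000 leaves a margin for the errors.\<close>
  have "3332 / 10000 * r * (3332 / 10000 * r) * (3333 / 10000 * r) \<le> sz A1 * sz A2 * sz C2"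
    using 1(3) 2(3) lowC2 t r by (intro mult_mono) auto
  moreover have "r * triples A1 A2 C2 \<le> r * (r * r / 1000000)"
  proof (intro mult_left_mono)
    have "e \<le> r / 1000" using eq q' t by linarith
    then have "e * e \<le> (r / 1000) * (r / 1000)" using e by (intro mult_mono) auto
    moreover have "e * (e - 1) \<le> e * e" using e by (intro mult_left_mono) auto
    ultimately show "triples A1 A2 C2 \<le> r * r / 1000000" using T2 PT e0 by simp
  qed (use r in auto)
  moreover have "norm (ft C2 k) * ((sz A1 * (p - sz A1) + sz A2 * (p - sz A2)) / 2) \<le> norm (ft C2 k) * (2 / 9 * (r * r))"
  proof (intro mult_left_mono)
    have "x * (r - x) \<le> 2 / 9 * (r * r)" if "x \<le> r / 3" for x
    proof -
      have "0 \<le> (r / 3 - x) * (2 * r / 3 - x)" using that r by (intro mult_nonneg_nonneg) auto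
      then show ?thesis by (simp add: field_simps)
    qed
    from this[OF 1(4)] this[OF 2(4)]
    show "(sz A1 * (p - sz A1) + sz A2 * (p - sz A2)) / 2 \<le> 2 / 9 * (r * r)" by (simp add: r_def)
  qed simp
  moreover have "3332 / 10000 * r * (3332 / 10000 * r) * (3333 / 10000 * r) = 3332 * 3332 * 3333 / 10 ^ 12 * (r * r * r)"
    "166 / 1000 * r * (2 / 9 * (r * r)) = 332 / 9000 * (r * r * r)"
    "r * (r * r / 1000000) = r * r * r / 1000000" by simp_all
  moreover have "0 < r * r * r" using r by simp
  moreover note k(2)[folded r_def]
  ultimately have "166 / 1000 * r * (2 / 9 * (r * r)) \<le> norm (ft C2 k) * (2 / 9 * (r * r))"
    unfolding r_def[symmetric] by linarith
  then have M: "166 / 1000 * r \<le> norm (ft C2 k)" using r by simp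
  have "166 / 1000 * p * \<bar>sin (pi * of_int (k * h) / p)\<bar> \<le> D + 10 * (P * e)" if "defect A h \<le> D" for h
  proof -
    have "166 / 1000 * r * \<bar>sin (pi * of_int (k * h) / p)\<bar> \<le> norm (ft C2 k) * \<bar>sin (pi * of_int (k * h) / p)\<bar>"
      using M by (intro mult_right_mono) auto
    also have "\<dots> \<le> defect C2 h" by (rule ft_near_period[OF 2(2)])
    finally show ?thesis using def2[OF that] by (simp add: r_def)
  qed
  then show ?thesis using k(1) by blast
qed

text \<open>For n = \<open>sz A\<close> the coefficient of \<open>S\<close> is at least
  \<open>n (p - 2 n) / (p - n)\<close> up to an error. This is at least \<open>2 n / 3\<close> up to
  n = \<open>p / 4\<close>, then at least \<open>p / 6\<close> up to n = \<open>p / 3\<close>, with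
  equality at both ends of that range, and smaller beyond it. The constants in \<open>M\<close> are
  slightly below 2/3 and 1/6.\<close>

lemma exists_fourier_bias_sparse:
  fixes e T D :: real
  assumes per: "per A" "per S" and S: "sz S = p - 2 * sz A"
    and e: "1 \<le> e" "64 * T \<le> e * (e - 1)" "1000 * e \<le> sz A" and T: "triples A A S \<le> T"
    and D: "1000 * D \<le> sz A" and small: "3 * sz A \<le> p"
    and M: "M = (if 4 * sz A \<le> p then 664 / 1000 * sz A else 166 / 1000 * p)"
  shows "\<exists>k. \<not> p dvd k \<and> (\<forall>h. defect A h \<le> D \<longrightarrow> M * \<bar>sin (pi * of_int (k * h) / p)\<bar> \<le> D + 2 * e)"
proof -
  define n where "n = sz A"
  define r where "r = real_of_int p"
  have n: "0 < n" "3 * n \<le> r" using e small by (simp_all add: n_def r_def)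
  have e0: "0 \<le> e * (e - 1)" using e by simp
  have Tn: "r * triples A A S \<le> r * (n * n / 1000000)"
  proof (intro mult_left_mono)
    have "e * e \<le> (n / 1000) * (n / 1000)" using e by (intro mult_mono) (auto simp: n_def)
    moreover have "e * (e - 1) \<le> e * e" using e by (intro mult_left_mono) auto
    ultimately show "triples A A S \<le> n * n / 1000000" using T e(2) e0 by simp
  qed (use n in auto)
  obtain k where k: "\<not> p dvd k" "n * n * (r - 2 * n) - r * triples A A S \<le> norm (ft S k) * (n * (r - n))"
    using large_fourier_coefficient[OF per(1,1,2)] S by (auto simp: n_def r_def)
  have "M * (n * (r - n)) \<le> n * n * (r - 2 * n) - r * (n * n / 1000000)"
  proof (cases "4 * n \<le> r")
    case True
    have "664 / 1000 * (r - n) \<le> (r - 2 * n) - r / 1000000" using True n by simp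
    then have "n * n * (664 / 1000 * (r - n)) \<le> n * n * ((r - 2 * n) - r / 1000000)"
      using n by (intro mult_left_mono) auto
    moreover have Mn: "M = 664 / 1000 * n" using True M by (simp add: n_def r_def)
    ultimately show ?thesis unfolding Mn by (simp add: algebra_simps)
  next
    case False
    \<comment> \<open>The product equals \<open>6 n (r - 2 n) - r (r - n)\<close>.\<close>
    have "0 \<le> (r - 3 * n) * (4 * n - r)" using False n by (intro mult_nonneg_nonneg) auto
    moreover have "n * r * 3 \<le> r * r" using n by (simp add: mult.commute mult_left_mono)
    ultimately have "r * r + 12 * (n * n) \<le> 7 * (n * r)" "3 * (n * r) \<le> r * r"
      by (simp_all add: algebra_simps)
    moreover have "0 \<le> r * r" by simp
    ultimately have "166 / 1000 * (r * r) - 166 / 1000 * (n * r) \<le> n * r - 2 * (n * n) - n * r / 1000000"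
      by linarith
    then have "166 / 1000 * r * (r - n) \<le> n * (r - 2 * n) - r * n / 1000000"
      by (simp add: field_simps)
    then have "n * (166 / 1000 * r * (r - n)) \<le> n * (n * (r - 2 * n) - r * n / 1000000)"
      using n by (intro mult_left_mono) auto
    moreover have Mr: "M = 166 / 1000 * r" using False M by (simp add: n_def r_def)
    ultimately show ?thesis unfolding Mr by (simp add: algebra_simps)
  qed
  then have "M * (n * (r - n)) \<le> norm (ft S k) * (n * (r - n))" using k(2) Tn by linarith
  then have M': "M \<le> norm (ft S k)" using n by simp
  have "M * \<bar>sin (pi * of_int (k * h) / p)\<bar> \<le> D + 2 * e" if "defect A h \<le> D" for h
  proof -
    have "M * \<bar>sin (pi * of_int (k * h) / p)\<bar> \<le> norm (ft S k) * \<bar>sin (pi * of_int (k * h) / p)\<bar>"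
      using M' by (intro mult_right_mono) auto
    also have "\<dots> \<le> defect S h" by (rule ft_near_period[OF per(2)])
    also have "\<dots> \<le> defect A h + 0 + 2 * e"
    proof (rule critical_defect[where B = A])
      show "2 * triples A A S \<le> e * (e - 1)" using T e(2) e0 by linarith
      show "2 * e + defect A h \<le> sz A" using that D e by linarith
    qed (use per e S n in \<open>auto simp: n_def r_def\<close>)
    finally show ?thesis using that by linarith
  qed
  then show ?thesis using k(1) by blast
qed

text \<open>Shrinking has to begin with \<open>2 * sz X + sz A \<le> p\<close>, so it begins with
  \<open>A\<close> up to density 1/3 and with \<open>S\<close> above it. The result is thinned until
  all its differences are almost periods of \<open>A\<close>, at which the biased coefficient then
  forces small sines.\<close>

lemma exists_fourier_bias:
  fixes e \<tau> T P M :: real and i1 i2 :: nat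
  assumes per: "per A" "per S" and S: "sz S = p - 2 * sz A" "16 * \<tau> * p \<le> p - 2 * sz A"
    and e: "1 \<le> e" "64 * P * T \<le> e * (e - 1)" and T: "triples A A S \<le> T"
    and P: "P = 2 ^ (i1 + 2 * i2)" "1 \<le> 4 * \<tau> * i2" "1 \<le> \<tau> * (4 / 3) ^ i1"
    and \<tau>: "0 < \<tau>" "\<tau> \<le> 1 / 100000"
    and q: "64 * P * e \<le> \<tau> ^ 4 * sz A / 10 ^ 7"
    and M: "M = (if 4 * sz A \<le> p then 664 / 1000 * sz A else 166 / 1000 * p)"
  shows "\<exists>X Z k. per X \<and> per Z \<and> \<not> p dvd k \<and> \<tau>\<^sup>2 * sz A \<le> 17 * sz X \<and> sz X \<le> \<tau> * sz A \<and>
    triples X A Z \<le> e * (e - 1) \<and> p - 64 * (P * e) \<le> sz X + sz A + sz Z \<and>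
    (\<forall>x\<in>X. \<forall>y\<in>X. M * \<bar>sin (pi * of_int (k * (x - y)) / p)\<bar> \<le> sz X + 64 * (P * e))"
proof -
  define n where "n = sz A"
  define w where "w = (2::real) ^ i1"
  have w: "1 \<le> w" "w \<le> P"
  proof -
    have "w * 1 \<le> w * 2 ^ (2 * i2)" by (intro mult_left_mono) (auto simp: w_def)
    then show "w \<le> P" by (simp add: P w_def power_add)
  qed (simp add: w_def)
  have P1: "1 \<le> P" using w by simp
  have eq: "e \<le> P * e" "w * e \<le> P * e"
    using e P1 w mult_right_mono[of 1 P e] mult_right_mono[of w P e] by simp_all
  have n0: "0 \<le> n" by (simp add: n_def)
  have \<tau>2: "\<tau>\<^sup>2 * n \<le> \<tau> * n / 100000" "\<tau> ^ 4 * n \<le> \<tau>\<^sup>2 * n / 1000" "\<tau> * n \<le> n / 100000" "0 \<le> \<tau>\<^sup>2 * n"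
  proof -
    have "\<tau> * (\<tau> * n) \<le> 1 / 100000 * (\<tau> * n)" using \<tau> n0 by (intro mult_right_mono) auto
    then show "\<tau>\<^sup>2 * n \<le> \<tau> * n / 100000" by (simp add: power2_eq_square)
    have "\<tau>\<^sup>2 \<le> 1 / 1000" using \<tau> power_mono[of \<tau> "1 / 100000" 2] by (simp add: power2_eq_square)
    then have "\<tau>\<^sup>2 * (\<tau>\<^sup>2 * n) \<le> 1 / 1000 * (\<tau>\<^sup>2 * n)" using n0 by (intro mult_right_mono) auto
    then show "\<tau> ^ 4 * n \<le> \<tau>\<^sup>2 * n / 1000" by (simp add: power2_eq_square power4_eq_xxxx)
    show "\<tau> * n \<le> n / 100000" using mult_right_mono[OF \<tau>(2) n0] by simp
    show "0 \<le> \<tau>\<^sup>2 * n" using n0 by simp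
  qed
  have "64 * (P * e) \<le> \<tau> ^ 4 * n / 10000000" using q by (simp add: n_def)
  then have q': "64 * (P * e) \<le> \<tau>\<^sup>2 * n / 1000000000" using \<tau>2(2,4) by linarith
  have T0: "0 \<le> T" using T triples_nonneg[of A A S] by linarith
  have e0: "0 \<le> e * (e - 1)" using e by simp
  have wT: "w * triples A A S \<le> P * T" "T \<le> P * T"
  proof -
    have "w * triples A A S \<le> w * T" using T w by (intro mult_left_mono) auto
    moreover have "w * T \<le> P * T" "1 * T \<le> P * T" using w P1 T0 by (intro mult_right_mono; simp)+
    ultimately show "w * triples A A S \<le> P * T" "T \<le> P * T" by linarith+
  qed
  have wA: "w * triples A A S \<le> e * (e - 1)" using wT e(2) e0 by linarith
  have p0: "0 < \<tau> * p" using \<tau> p_pos by simp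
  then have np: "2 * n \<le> p" using S(2) by (simp add: n_def)
  have init: "\<tau>\<^sup>2 / 16 * n \<le> x \<Longrightarrow> x \<le> n \<Longrightarrow> x \<le> \<tau> * n * (4 / 3) ^ i1" for x
  proof -
    assume "x \<le> n"
    also have "1 * n \<le> (\<tau> * (4 / 3) ^ i1) * n" using P(3) n0 by (rule mult_right_mono)
    finally show "x \<le> \<tau> * n * (4 / 3) ^ i1" by (simp add: mult_ac)
  qed
  have "2 * (w * e) \<le> n" using eq q' \<tau>2 n0 by linarith
  then have we: "2 ^ i1 * (0 + 2 * e) \<le> sz A" by (simp add: w_def n_def mult_ac)
  have "\<exists>X Z. per X \<and> per Z \<and> \<tau>\<^sup>2 / 16 * n \<le> sz X \<and> sz X \<le> \<tau> * n \<and>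
    triples X A Z \<le> w * triples A A S \<and> p - w * (0 + 2 * e) \<le> sz X + n + sz Z"
  proof (cases "3 * n \<le> p")
    case True
    show ?thesis unfolding n_def w_def
    proof (rule exists_small_critical[OF per(1,1,2) e(1)])
      show "8 \<le> \<tau> * sz A" "2 * e \<le> \<tau>\<^sup>2 / 16 * sz A" "2 ^ i1 * (0 + 2 * e) \<le> sz A"
        using \<tau>2 q' eq e n0 we unfolding n_def w_def by linarith+
      show "sz A \<le> \<tau> * sz A * (4 / 3) ^ i1" "\<tau>\<^sup>2 / 16 * sz A \<le> sz A"
        using init[of n] \<tau>2 n0 unfolding n_def by linarith+
    qed (use wA \<tau> True S in \<open>auto simp: n_def w_def\<close>)
  next
    case False
    have sym: "triples S A A = triples A A S"
      using triples_swap23[of A S A] triples_swap12[of A S A] per by simp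
    have S': "\<tau>\<^sup>2 / 16 * n \<le> sz S" "sz S \<le> n"
    proof -
      have "16 * (\<tau> * n) \<le> 16 * (\<tau> * p)" using \<tau> np n0 by (intro mult_left_mono) auto
      moreover have "16 * (\<tau> * p) \<le> sz S" using S by simp
      ultimately show "\<tau>\<^sup>2 / 16 * n \<le> sz S" using \<tau>2 n0 by linarith
      show "sz S \<le> n" using False S by (simp add: n_def)
    qed
    have "\<exists>X Z. per X \<and> per Z \<and> \<tau>\<^sup>2 / 16 * sz A \<le> sz X \<and> sz X \<le> \<tau> * sz A \<and>
      triples X A Z \<le> 2 ^ i1 * triples S A A \<and> p - 2 ^ i1 * (0 + 2 * e) \<le> sz X + sz A + sz Z"
    proof (rule exists_small_critical[OF per(2,1,1) e(1)])
      show "8 \<le> \<tau> * sz A" "2 * e \<le> \<tau>\<^sup>2 / 16 * sz A" "2 ^ i1 * (0 + 2 * e) \<le> sz A"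
        using \<tau>2 q' eq e n0 we unfolding n_def w_def by linarith+
      show "sz S \<le> \<tau> * sz A * (4 / 3) ^ i1" "\<tau>\<^sup>2 / 16 * sz A \<le> sz S" "sz S \<le> sz A"
        using init[OF S'] S' unfolding n_def by simp_all
    qed (use wA \<tau> False S sym in \<open>auto simp: n_def w_def\<close>)
    then show ?thesis by (simp only: sym n_def w_def)
  qed
  then obtain X0 Z where X0: "per X0" "per Z" "\<tau>\<^sup>2 / 16 * n \<le> sz X0" "sz X0 \<le> \<tau> * n"
    "triples X0 A Z \<le> w * triples A A S" "p - 2 * (w * e) \<le> sz X0 + n + sz Z"
    by (auto simp: mult_ac)
  have TX0: "triples X0 A Z \<le> e * (e - 1)" using X0(5) wA by linarith
  obtain X where X: "X \<subseteq> X0" "per X" "sz X0 - e \<le> sz X"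
    "\<And>x y. x \<in> X \<Longrightarrow> y \<in> X \<Longrightarrow> defect A (x - y) \<le> sz X0 + 2 * (w * e) + 2 * e"
    using critical_near_periods[OF X0(1) per(1) X0(2) e(1) TX0, of "2 * (w * e)"] X0(6)
    unfolding n_def by blast
  define D where "D = sz X0 + 2 * (w * e) + 2 * e"
  have szX: "sz X \<le> sz X0" using X(1) by (rule sz_mono)
  have "\<exists>k. \<not> p dvd k \<and> (\<forall>h. defect A h \<le> D \<longrightarrow> M * \<bar>sin (pi * of_int (k * h) / p)\<bar> \<le> D + 10 * (P * e))"
  proof (cases "3 * n \<le> p")
    case True
    have "\<exists>k. \<not> p dvd k \<and> (\<forall>h. defect A h \<le> D \<longrightarrow> M * \<bar>sin (pi * of_int (k * h) / p)\<bar> \<le> D + 2 * e)"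
    proof (rule exists_fourier_bias_sparse[OF per S(1) e(1) _ _ T _ _ M])
      show "64 * T \<le> e * (e - 1)" using wT(2) e(2) T0 by simp
      show "1000 * e \<le> sz A" using \<tau>2 q' eq n0 unfolding n_def by linarith
      have "D \<le> \<tau> * n + 4 * (P * e)" using X0(4) eq unfolding D_def by linarith
      then show "1000 * D \<le> sz A" using \<tau>2 q' n0 unfolding n_def by linarith
      show "3 * sz A \<le> p" using True by (simp add: n_def)
    qed
    then obtain k where k: "\<not> p dvd k" "\<And>h. defect A h \<le> D \<Longrightarrow> M * \<bar>sin (pi * of_int (k * h) / p)\<bar> \<le> D + 2 * e"
      by blast
    have "D + 2 * e \<le> D + 10 * (P * e)" using eq e by linarith
    then show ?thesis using k order_trans by blast
  next
    case False
    have "1 < sz X" using X(3) X0(3) q' eq e by linarith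
    then obtain x y where xy: "x \<in> X" "y \<in> X" "\<not> p dvd x - y"
      using exists_nontrivial_difference by blast
    have M': "M = 166 / 1000 * p" 
    proof -
      have "\<not> 4 * sz A \<le> p" using False n0 unfolding n_def by linarith
      then show ?thesis using M by simp
    qed
    show ?thesis unfolding M'
    proof (rule exists_fourier_bias_dense[OF per S e T P(1,2) \<tau> _ xy(3)])
      have "64 * (P * e) \<le> \<tau> * n / 10000000" using q' \<tau>2 by linarith
      then show "64 * P * e \<le> \<tau> * sz A / 10 ^ 7" by (simp add: n_def)
      show "defect A (x - y) \<le> D" using X(4)[OF xy(1,2)] by (simp add: D_def)
      have "2 * (\<tau> * n) \<le> \<tau> * p" using mult_left_mono[OF np, of \<tau>] \<tau> by simp
      then show "D \<le> \<tau> * p" using X0(4) q' \<tau>2 eq unfolding D_def by linarith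
      show "p < 3 * sz A" using False by (simp add: n_def)
    qed
  qed
  then obtain k where k: "\<not> p dvd k" "\<And>h. defect A h \<le> D \<Longrightarrow> M * \<bar>sin (pi * of_int (k * h) / p)\<bar> \<le> D + 10 * (P * e)"
    by blast
  have "M * \<bar>sin (pi * of_int (k * (x - y)) / p)\<bar> \<le> sz X + 64 * (P * e)" if "x \<in> X" "y \<in> X" for x y
    using k(2)[of "x - y"] X(3) X(4)[OF that] eq e unfolding D_def by linarith
  moreover have "triples X A Z \<le> e * (e - 1)"
    using triples_mono[OF X(1) order_refl order_refl, of A Z] TX0 by linarith
  moreover have "p - 64 * (P * e) \<le> sz X + sz A + sz Z"
    using X0(6) X(3) eq e(1) unfolding n_def by linarith
  moreover have "\<tau>\<^sup>2 * sz A \<le> 17 * sz X"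
    using X(3) X0(3) q' eq e(1) \<tau>2(4) unfolding n_def by linarith
  moreover have "sz X \<le> \<tau> * sz A" using X0(4) szX by (simp add: n_def)
  ultimately show ?thesis using X(2) X0(2) k(1) by blast
qed


section \<open>Choice of the parameters\<close>

text \<open>Each of the \<open>i\<close> shrinking steps and of the \<open>2j\<close> balancing steps may double the number of
  solutions, hence the factor \<open>P\<close>.\<close>

lemma restricted_sumset_bound:
  fixes \<beta> \<tau> e d P :: real and i j :: nat
  assumes per: "per A" "per R" and rows: "\<And>x. x \<in> A \<Longrightarrow> sz {y \<in> A. x + y \<notin> R} \<le> d" and d: "0 \<le> d"
    and \<beta>: "0 < \<beta>" "\<beta> \<le> 1" "\<beta> * p \<le> p - 2 * sz A" and \<tau>: "\<beta> = 100000 * \<tau>"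
    and e: "1 \<le> e" "64 * P * (d * sz A) \<le> e * (e - 1)"
    and P: "P = 2 ^ (i + 2 * j)" "1 \<le> 4 * \<tau> * j" "1 \<le> \<tau> * (4 / 3) ^ i"
    and q: "64 * P * e \<le> \<tau> ^ 4 * sz A / 10 ^ 7"
  shows "2 * sz A - 1 - 2 * d \<le> sz R"
proof (rule ccontr)
  assume neg: "\<not> ?thesis"
  define n where "n = sz A"
  define r where "r = real_of_int p"
  define M where "M = (if 4 * n \<le> r then 664 / 1000 * n else 166 / 1000 * r)"
  have r: "0 < r" using p_pos by (simp add: r_def)
  have \<tau>0: "0 < \<tau>" "\<tau> \<le> 1 / 100000" using \<beta> \<tau> by simp_all
  have \<beta>r: "\<beta> * r = 100000 * (\<tau> * r)" "0 < \<tau> * r" using \<tau> \<tau>0 r by simp_all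
  have nr: "\<beta> * r \<le> r - 2 * n" using \<beta> by (simp add: n_def r_def)
  then have n: "0 \<le> n" "2 * n \<le> r" using \<beta>r by (simp_all add: n_def)
  \<comment> \<open>\<open>S\<close> is trimmed to make the total size of the triple
    \<open>(A, A, S)\<close> exactly \<open>p\<close>, so that its deficit is 0.\<close>
  obtain S where S: "S \<subseteq> {z. - z \<notin> R}" "per S" "sz S = p - 2 * sz A"
  proof -
    define k where "k = nat (p - 2 * int (card (A \<inter> {0..<p})))"
    have "real_of_int (2 * int (card (A \<inter> {0..<p}))) \<le> p" using n by (simp add: n_def r_def sz_card)
    then have "2 * int (card (A \<inter> {0..<p})) \<le> p" by (simp only: of_int_le_iff)
    then have k: "real k = p - 2 * sz A" by (simp add: k_def sz_card)
    have "sz {z. - z \<notin> R} = p - sz R" using sz_uminus[of "- R"] per by (simp add: sz_Compl)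
    then have "real k \<le> sz {z. - z \<notin> R}" using k neg d by simp
    moreover have "per {z. - z \<notin> R}" using per_uminus[of "- R"] per by simp
    ultimately show ?thesis using exists_subset_sz[of "{z. - z \<notin> R}" k] k that by auto
  qed
  have T: "triples A A S \<le> d * sz A" by (rule triples_le_rows[OF rows S(1)])
  have "16 * (\<tau> * r) \<le> r - 2 * n" using nr \<beta>r by linarith
  then have S': "16 * \<tau> * p \<le> p - 2 * sz A" by (simp add: n_def r_def)
  have M_eq: "M = (if 4 * sz A \<le> p then 664 / 1000 * sz A else 166 / 1000 * p)"
    by (simp only: M_def n_def r_def)
  obtain X Z k where X: "per X" "per Z" "\<not> p dvd k" "\<tau>\<^sup>2 * n \<le> 17 * sz X" "sz X \<le> \<tau> * n"
    "triples X A Z \<le> e * (e - 1)" "p - 64 * (P * e) \<le> sz X + sz A + sz Z"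
    and bias: "\<And>x y. x \<in> X \<Longrightarrow> y \<in> X \<Longrightarrow> M * \<bar>sin (pi * of_int (k * (x - y)) / p)\<bar> \<le> sz X + 64 * (P * e)"
    using exists_fourier_bias[OF per(1) S(2,3) S' e T P \<tau>0 q M_eq] unfolding n_def by blast
  define x where "x = sz X"
  define \<psi> where "\<psi> = 64 * (P * e)"
  have P1: "1 \<le> P" by (simp add: P)
  have e\<psi>: "64 * e \<le> \<psi>" using mult_right_mono[OF P1, of e] e by (simp add: \<psi>_def)
  have \<psi>: "\<psi> \<le> \<tau> ^ 4 * n / 10000000" using q by (simp add: \<psi>_def n_def)
  have n0: "0 < n"
  proof (rule ccontr)
    assume "\<not> 0 < n"
    then have "n = 0" using n by simp
    then show False using \<psi> e\<psi> e by simp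
  qed
  have x: "\<tau>\<^sup>2 * n \<le> 17 * x" "x \<le> \<tau> * n" "\<tau> * n \<le> n / 100000" "2 * (\<tau> * n) \<le> \<tau> * r"
    using X(4,5) mult_right_mono[OF \<tau>0(2) n(1)] mult_left_mono[OF n(2), of \<tau>] \<tau>0 by (simp_all add: x_def)
  have \<tau>4: "\<tau> ^ 4 * n = \<tau>\<^sup>2 * (\<tau>\<^sup>2 * n)" by (simp add: power2_eq_square power4_eq_xxxx)
  have \<tau>2: "\<tau>\<^sup>2 \<le> 1 / 1000"
    using power_mono[of \<tau> "1 / 100000" 2] \<tau>0 by (simp add: power2_eq_square)
  have \<tau>4n: "\<tau> ^ 4 * n \<le> \<tau>\<^sup>2 * n / 1000"
    using mult_right_mono[OF \<tau>2, of "\<tau>\<^sup>2 * n"] n unfolding \<tau>4 by simp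
  have \<psi>x: "100000 * \<psi> \<le> x" using \<psi> \<tau>4n x(1) e\<psi> e by linarith
  have x0: "0 < x" using \<psi>x e\<psi> e by linarith
  have M: "332 / 1000 * n \<le> M" "M \<le> n" using n by (auto simp: M_def)
  have M0: "0 < M" using M n0 by linarith
  define \<phi> where "\<phi> = x + \<psi>"
  have \<phi>: "0 < \<phi>" "\<phi> \<le> 100001 / 100000 * x" using x0 \<psi>x e\<psi> e by (simp_all add: \<phi>_def)
  \<comment> \<open>The sines confine the differences of \<open>X\<close> to about
    \<open>p * \<phi> / (pi * M)\<close>, and \<open>N\<close> is the number of arcs of this length
    in the circle. The factor 99/100 makes room for
    \<open>\<phi> / M < sin (pi / N)\<close>.\<close>
  define N where "N = \<lfloor>99 / 100 * pi * M / \<phi>\<rfloor>"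
  have N1: "N * \<phi> \<le> 99 / 100 * pi * M"
  proof -
    have "real_of_int N \<le> 99 / 100 * pi * M / \<phi>" by (simp add: N_def)
    then show ?thesis using \<phi> by (simp add: pos_le_divide_eq)
  qed
  have N2: "99 / 100 * pi * M \<le> N * \<phi> + \<phi>"
  proof -
    have "99 / 100 * pi * M / \<phi> \<le> real_of_int N + 1" unfolding N_def by linarith
    then show ?thesis using \<phi> by (simp add: pos_divide_le_eq ring_distribs)
  qed
  have piM: "31 / 10 * M \<le> pi * M" "pi * M \<le> 4 * M"
    using pi_ge_31_tenths pi_less_4 M0 by (intro mult_right_mono; simp)+
  have "0 \<le> 99 / 100 * pi * M / \<phi>" using M0 \<phi> by simp
  then have N0: "0 \<le> real_of_int N" by (simp add: N_def)
  have N\<phi>: "N * \<phi> \<le> N * (100001 / 100000 * x)" using \<phi>(2) N0 by (rule mult_left_mono)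
  \<comment> \<open>\<open>99/100 * 31/10\<close> is 3.069; lowering it to 3.05 absorbs the floor
    and the difference between \<phi> and \<open>x\<close>. As \<open>M\<close> is at least
    \<open>332/1000 * n\<close>, \<open>N * x\<close> exceeds \<open>n\<close>, which
    \<open>thin_window\<close> needs.\<close>
  have Nx: "305 / 100 * M \<le> N * x" "N * x \<le> 4 * n"
  proof -
    have "N * (100001 / 100000 * x) = 100001 / 100000 * (N * x)" by simp
    then show "305 / 100 * M \<le> N * x" using N2 piM N\<phi> \<phi>(2) x M n0 by linarith
    have "N * x \<le> N * \<phi>" using N0 \<psi>x x0 e\<psi> e by (intro mult_left_mono) (auto simp: \<phi>_def)
    then show "N * x \<le> 4 * n" using N1 piM M by linarith
  qed
  have N\<tau>: "N * \<tau>\<^sup>2 \<le> 68"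
  proof -
    have "N * (\<tau>\<^sup>2 * n) \<le> N * (17 * x)" using x(1) N0 by (rule mult_left_mono)
    also have "\<dots> = 17 * (N * x)" by simp
    also have "\<dots> \<le> 68 * n" using Nx(2) by linarith
    finally have "(N * \<tau>\<^sup>2) * n \<le> 68 * n" by (simp add: mult.assoc)
    then show ?thesis using n0 by simp
  qed
  \<comment> \<open>\<open>N\<close> may be of order \<open>1 / \<tau>\<^sup>2\<close> and
    \<open>x\<close> of order \<open>\<tau>\<^sup>2 * n\<close>. Keeping \<open>N\<close> times the
    loss below \<open>x\<close> is the reason for \<open>\<tau> ^ 4\<close> in the bound on
    \<open>e\<close>.\<close>
  have N\<psi>: "1000 * (N * \<psi>) \<le> x"
  proof -
    have "N * \<psi> \<le> N * (\<tau> ^ 4 * n / 10000000)" using \<psi> N0 by (rule mult_left_mono)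
    also have "\<dots> = (N * \<tau>\<^sup>2) * (\<tau>\<^sup>2 * n) / 10000000" by (simp only: \<tau>4 mult.assoc times_divide_eq_right)
    also have "(N * \<tau>\<^sup>2) * (\<tau>\<^sup>2 * n) / 10000000 \<le> 68 * (\<tau>\<^sup>2 * n) / 10000000"
      using N\<tau> n by (intro divide_right_mono mult_right_mono) auto
    finally show ?thesis using x(1) x0 by linarith
  qed
  have Ne: "64 * (N * e) \<le> N * \<psi>" using mult_left_mono[OF e\<psi> N0] by simp
  have N_le_x: "real_of_int N \<le> N * e" using mult_left_mono[OF e(1) N0] by simp
  have N_big: "100000 \<le> real_of_int N"
  proof (rule ccontr)
    assume "\<not> ?thesis"
    then have "N * x \<le> 100000 * x" using x0 by (intro mult_right_mono) auto
    then show False using Nx(1) M x n0 by linarith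
  qed
  have "real_of_int N \<le> real_of_int p" using N_le_x Ne N\<psi> x n x0 unfolding r_def by linarith
  then have N_le_p: "N \<le> p" by (simp only: of_int_le_iff)
  have N_int: "100000 \<le> N" using N_big by simp
  have d_le: "d \<le> e"
  proof -
    have "1 * (d * n) \<le> P * (d * n)" using P1 d n by (intro mult_right_mono) auto
    moreover have "P * (d * n) \<le> e * (e - 1)"
    proof -
      have "0 \<le> P * (d * n)" using P1 d n by simp
      moreover have "64 * (P * (d * n)) \<le> e * (e - 1)" using e(2) by (simp add: n_def)
      ultimately show ?thesis by linarith
    qed
    moreover have "e - 1 \<le> n" using e(1) e\<psi> \<psi>x x n0 by linarith
    then have "e * (e - 1) \<le> e * n" using e(1) by (intro mult_left_mono) auto
    ultimately have "d * n \<le> e * n" by linarith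
    then show ?thesis using n0 by simp
  qed
  have sine: "\<phi> / M < sin (pi / N)"
  proof -
    have piN: "0 < pi / N" "pi / N \<le> 4 / 100000"
      using N_big pi_less_4 by (auto intro!: frac_le)
    have "(pi / N)\<^sup>2 \<le> (4 / 100000)\<^sup>2" using piN by (intro power_mono) auto
    moreover have "(4 / 100000)\<^sup>2 \<le> (1 / 1000 :: real)" by (simp add: power2_eq_square)
    ultimately have "99 / 100 < 1 - (pi / N)\<^sup>2 / 2" by linarith
    then have "pi / N * (99 / 100) < pi / N * (1 - (pi / N)\<^sup>2 / 2)"
      using piN by (intro mult_strict_left_mono) auto
    also have "\<dots> \<le> sin (pi / N)"
    proof (rule sin_lower_bound)
      show "0 \<le> pi / N" "pi / N \<le> 1" using piN by linarith+
    qed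
    finally have "pi / N * (99 / 100) < sin (pi / N)" .
    moreover have "\<phi> / M \<le> pi / N * (99 / 100)"
      using N1 M0 N_big by (simp add: field_simps)
    ultimately show ?thesis by simp
  qed
  \<comment> \<open>The preimage under the inverse \<open>c\<close> of \<open>k\<close> turns the
    frequency \<open>k\<close> into 1.\<close>
  have "coprime k p" using X(3) prime_p by (metis coprime_commute prime_imp_coprime)
  then obtain c where c: "[k * c = 1] (mod p)" using cong_solve_coprime_int by blast
  have nd: "\<not> p dvd c"
  proof
    assume "p dvd c"
    then have "p dvd k * c" by simp
    then have "p dvd 1" using c cong_dvd_iff by blast
    then show False using p_gt_1 by simp
  qed
  define X1 where "X1 = dil c X"
  have per1: "per X1" "per (dil c A)" "per (dil c Z)" "per (dil c R)"
    using X per by (auto simp: X1_def)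
  have szX1: "sz X1 = x" using sz_dil[OF X(1) nd] by (simp add: X1_def x_def)
  have close: "\<exists>s. p dvd a - b - s \<and> \<bar>s\<bar> * N < p" if "a \<in> X1" "b \<in> X1" for a b
  proof (rule small_sin_imp_small)
    have "M * \<bar>sin (pi * of_int (k * (c * a - c * b)) / p)\<bar> \<le> \<phi>"
      using bias[of "c * a" "c * b"] that by (simp add: X1_def dil_def \<phi>_def x_def \<psi>_def)
    moreover have "\<bar>sin (pi * of_int (k * (c * a - c * b)) / p)\<bar> = \<bar>sin (pi * of_int (a - b) / p)\<bar>"
    proof (rule abs_sin_cong)
      have "[(k * c) * (a - b) = 1 * (a - b)] (mod p)" using c by (rule cong_scalar_right)
      then show "(k * (c * a - c * b)) mod p = (a - b) mod p" by (simp add: cong_def algebra_simps)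
    qed
    ultimately have "M * \<bar>sin (pi * of_int (a - b) / p)\<bar> \<le> \<phi>" by simp
    then have "\<bar>sin (pi * of_int (a - b) / p)\<bar> \<le> \<phi> / M" using M0 by (simp add: pos_le_divide_eq mult.commute)
    then show "\<bar>sin (pi * of_int (a - b) / p)\<bar> < sin (pi / N)" using sine by simp
  qed (use N_int in simp)
  have "X1 \<noteq> {}" using szX1 x0 by (auto simp: sz_def)
  then obtain x1 where "x1 \<in> X1" by blast
  obtain u where u: "\<And>y. y \<in> X1 \<Longrightarrow> ((y - u) mod p) * N \<le> p"
    using exists_arc_start[OF per1(1) \<open>x1 \<in> X1\<close> _ close] N_int by auto
  define X2 where "X2 = shift (- u) X1"
  define Z2 where "Z2 = shift u (dil c Z)"
  have szs: "sz X2 = x" "sz Z2 = sz Z" "sz (dil c A) = n" "sz (dil c R) = sz R"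
    using szX1 per1 X per nd by (simp_all add: X2_def Z2_def sz_dil n_def)
  have "triples X2 (dil c A) Z2 = triples X A Z"
    using triples_shift[of X1 "dil c Z" "- u" "dil c A"] triples_dil[OF X(1) per(1) X(2) nd] per1
    by (simp add: X2_def Z2_def X1_def)
  then have tri: "triples X2 (dil c A) Z2 \<le> e * (e - 1)" using X(6) by simp
  \<comment> \<open>Giving up about \<open>\<beta> * N / 8\<close> windows at each end costs about
    \<open>\<beta> * p / 4\<close> residues, well within the room \<open>\<beta> * p\<close> of the
    density assumption. An excess of one percent of a window, collected over that many windows,
    gives \<open>\<beta> * r / 800\<close> representations, of which
    \<open>\<beta> * r / 1000\<close> remain after the end effects.\<close>
  have "2 * sz (dil c A) - 1 - 2 * d \<le> sz (dil c R)"
  proof (rule rectified_bound[where e = e and m = \<psi> and N = N and M = "nat \<lceil>\<beta> * N / 8\<rceil>" and \<rho> = "\<beta> * r / 1000"])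
    show "per X2" "per Z2" using per1 by (simp_all add: X2_def Z2_def)
    show "p - \<psi> \<le> sz X2 + sz (dil c A) + sz Z2" using X(7) by (simp add: szs x_def n_def \<psi>_def)
    show "(y mod p) * N \<le> p" if "y \<in> X2" for y using u[of "y + u"] that by (simp add: X2_def)
    show "2 * e \<le> sz X2" "sz X2 + sz (dil c A) \<le> p"
      using e\<psi> \<psi>x e x n n0 unfolding szs r_def by linarith+
    show "sz {y \<in> dil c A. z + y \<notin> dil c R} \<le> d" if "z \<in> dil c A" for z
    proof -
      have "{y \<in> dil c A. z + y \<notin> dil c R} = dil c {y \<in> A. c * z + y \<notin> R}"
        by (auto simp: dil_def ring_distribs)
      moreover have "per {y \<in> A. c * z + y \<notin> R}"
      proof -
        have "c * z + (y + p) = (c * z + y) + p" for y by simp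
        then show ?thesis using perD[OF per(1)] perD[OF per(2)] by (simp only: per_def mem_Collect_eq simp_thms)
      qed
      ultimately have "sz {y \<in> dil c A. z + y \<notin> dil c R} = sz {y \<in> A. c * z + y \<notin> R}"
        using sz_dil nd by simp
      also have "\<dots> \<le> d" using rows[of "c * z"] that by (simp add: dil_def)
      finally show ?thesis .
    qed
    have small: "64000 * (N * e) \<le> x" "x \<le> n / 100000" "0 \<le> N * \<psi>" "0 \<le> N * e"
      using Ne N\<psi> x N0 e\<psi> e by (auto intro: mult_nonneg_nonneg) 
    show "sz (dil c A) + 2 * sz X2 + 2 * \<psi> + 2 * N * e < N * sz X2"
      using Nx(1) M(1) small \<psi>x n0 x0 unfolding szs by simp
    show "2 * N * e < sz (dil c A)" "6 * N * e + d < sz (dil c A)"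
      using small n0 d_le e\<psi> \<psi>x unfolding szs by simp_all
    show "4 * N * e + d < sz X2 - 6 * e - \<psi>"
      using small x0 d_le e\<psi> \<psi>x unfolding szs by simp
    define g where "g = x - 6 * e - \<psi>"
    have Ng: "N * g = N * x - 6 * (N * e) - N * \<psi>" by (simp add: g_def algebra_simps)
    have g: "0 < g" "g + 1 \<le> x" using e\<psi> \<psi>x x0 e by (simp_all add: g_def)
    show "sz (dil c A) \<le> (N / 2 - 11) * (sz X2 - 6 * e - \<psi>) \<or>
      p / N \<le> 2 * (sz X2 - 6 * e - \<psi>) \<and> 1 \<le> nat \<lceil>\<beta> * N / 8\<rceil> \<and> 0 < \<beta> * r / 1000 \<and>
      \<beta> * r / 1000 \<le> nat \<lceil>\<beta> * N / 8\<rceil> * (2 * (sz X2 - 6 * e - \<psi>) - p / N) - (sz X2 - 6 * e - \<psi>) - 1 \<and>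
      2 * sz (dil c A) \<le> p - (2 * nat \<lceil>\<beta> * N / 8\<rceil> + 22) * (p / N + 1) - d * sz (dil c A) / (\<beta> * r / 1000)"
      unfolding szs g_def[symmetric] r_def[symmetric]
    proof (cases "4 * n \<le> r")
      case True
      then have "M = 664 / 1000 * n" by (simp add: M_def)
      \<comment> \<open>\<open>3.05 * 0.664\<close> is just above 2, so half of the windows, with
        \<open>g\<close> elements each, would hold more than \<open>n\<close>.\<close>
      then have "n + 11 * g \<le> N * g / 2" using Nx(1) Ng small N\<psi> Ne g n0 by linarith
      then have "n \<le> (N / 2 - 11) * g" by (simp add: algebra_simps)
      then show "n \<le> (N / 2 - 11) * g \<or> r / N \<le> 2 * g \<and> 1 \<le> nat \<lceil>\<beta> * N / 8\<rceil> \<and> 0 < \<beta> * r / 1000 \<and>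
        \<beta> * r / 1000 \<le> nat \<lceil>\<beta> * N / 8\<rceil> * (2 * g - r / N) - g - 1 \<and>
        2 * n \<le> r - (2 * nat \<lceil>\<beta> * N / 8\<rceil> + 22) * (r / N + 1) - d * n / (\<beta> * r / 1000)" by blast
    next
      case False
      define y where "y = r / N"
      define l where "l = real (nat \<lceil>\<beta> * N / 8\<rceil>)"
      have Ny: "N * y = r" using N_big by (simp add: y_def)
      have y0: "0 < y" using r N_big by (simp add: y_def)
      have "M = 166 / 1000 * r" using False by (simp add: M_def)
      \<comment> \<open>\<open>2 * 3.05 * 0.166\<close> is about 1.0126, so the local density
        \<open>g / y\<close> will exceed 1/2.\<close>
      then have "101 / 100 * r \<le> 2 * (N * g)" using Nx(1) Ng small N\<psi> Ne n0 n by linarith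
      then have "N * (101 / 100 * y) \<le> N * (2 * g)" using Ny by (simp add: mult.left_commute)
      then have gy: "101 / 100 * y \<le> 2 * g" using N_big by simp
      have \<beta>N: "0 < \<beta> * N" using \<beta> N_big by simp
      have l: "\<beta> * N / 8 \<le> l" "l \<le> \<beta> * N / 8 + 1"
        using \<beta>N unfolding l_def by linarith+
      have "1 \<le> nat \<lceil>\<beta> * N / 8\<rceil>" using \<beta>N by (simp add: Suc_le_eq)
      moreover have "r / N \<le> 2 * g" using gy y0 by (simp add: y_def)
      moreover have "0 < \<beta> * r / 1000" using \<beta>(1) r by simp
      moreover have "\<beta> * r / 1000 \<le> l * (2 * g - r / N) - g - 1"
      proof -
        have "\<beta> * N / 8 * (y / 100) \<le> l * (2 * g - y)"
          using l gy y0 \<beta>N by (intro mult_mono) auto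
        moreover have "\<beta> * N / 8 * (y / 100) = \<beta> * r / 800" using Ny by (simp add: mult.assoc)
        ultimately show ?thesis using g x \<beta>r unfolding y_def[symmetric] by linarith
      qed
      moreover have "2 * n \<le> r - (2 * l + 22) * (r / N + 1) - d * n / (\<beta> * r / 1000)"
      proof -
        have "(2 * l + 22) * (y + 1) \<le> (\<beta> * N / 4 + 24) * (y + 1)"
          using l y0 by (intro mult_right_mono) auto
        also have "\<dots> = \<beta> * r / 4 + 24 * y + \<beta> * N / 4 + 24"
          using Ny by (simp add: algebra_simps)
        finally have 1: "(2 * l + 22) * (y + 1) \<le> \<beta> * r / 4 + 24 * y + \<beta> * N / 4 + 24" .
        have 2: "\<beta> * N \<le> 1 * real_of_int N" using \<beta> N0 by (intro mult_right_mono) auto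
        have 3: "y \<le> \<tau> * r" using gy g x y0 by linarith
        have 4: "real_of_int N \<le> \<tau> * r" "24 \<le> \<tau> * r" using N_le_x small x x0 N_big \<tau>0 n by linarith+
        have 5: "d * n / (\<beta> * r / 1000) \<le> \<tau> * r"
        proof -
          have "d \<le> \<tau>\<^sup>2 * n" using d_le e\<psi> \<psi> \<tau>4n e by linarith
          moreover have "\<tau>\<^sup>2 * n \<le> \<tau>\<^sup>2 * r" using n by (intro mult_left_mono) auto
          ultimately have "d \<le> \<tau>\<^sup>2 * r" by linarith
          then have "d * n \<le> (\<tau>\<^sup>2 * r) * r" using n d by (intro mult_mono) auto
          also have "\<dots> \<le> \<tau> * r * (\<beta> * r / 1000)"
            using \<tau>0 r unfolding \<beta>r(1) by (simp add: power2_eq_square)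
          finally show ?thesis using \<beta>(1) r by (simp only: pos_divide_le_eq mult_pos_pos divide_pos_pos zero_less_numeral)
        qed
        show ?thesis using 1 2 3 4 5 nr \<beta>r unfolding y_def[symmetric] by linarith
      qed
      ultimately show "n \<le> (N / 2 - 11) * g \<or> r / N \<le> 2 * g \<and> 1 \<le> nat \<lceil>\<beta> * N / 8\<rceil> \<and> 0 < \<beta> * r / 1000 \<and>
        \<beta> * r / 1000 \<le> nat \<lceil>\<beta> * N / 8\<rceil> * (2 * g - r / N) - g - 1 \<and>
        2 * n \<le> r - (2 * nat \<lceil>\<beta> * N / 8\<rceil> + 22) * (r / N + 1) - d * n / (\<beta> * r / 1000)"
        unfolding l_def by simp
    qed
  qed (use per1 e tri N_int N_le_p d in auto)
  then show False using neg by (simp add: szs n_def)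
qed

end

theorem theorem9:
  fixes \<beta> :: real and d :: nat
  assumes "\<beta> > 0"
  shows "\<exists>n\<^sub>0 :: nat. \<forall>(p :: nat) (A :: int set) (F :: int \<Rightarrow> int set) (n :: nat).
           Factorial_Ring.prime p \<and>
           A \<subseteq> carrier (integer_mod_group p) \<and>
           card A = n \<and> n\<^sub>0 \<le> n \<and> real n < (1 - \<beta>) * real p / 2 \<and>
           (\<forall>a\<in>A. F a \<subseteq> A \<and> card (F a) = d) \<longrightarrow>
           int (card (restricted_sumset (integer_mod_group p) A F)) \<ge> 2 * int n - 1 - 2 * int d"
proof -
  \<comment> \<open>A smaller \<beta> only weakens the density condition, and the constants are
    tuned for values up to 1.\<close>
  define \<beta>' where "\<beta>' = min \<beta> 1"
  define \<tau> where "\<tau> = \<beta>' / 100000"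
  have \<beta>': "0 < \<beta>'" "\<beta>' \<le> 1" "\<beta>' \<le> \<beta>" using assms by (auto simp: \<beta>'_def)
  then have \<tau>: "0 < \<tau>" by (simp add: \<tau>_def)
  obtain i1 :: nat where "1 / \<tau> < (4 / 3) ^ i1" using real_arch_pow[of "4 / 3" "1 / \<tau>"] by auto
  then have i1: "1 \<le> \<tau> * (4 / 3) ^ i1" using \<tau> by (simp add: field_simps)
  obtain i2 :: nat where "1 / (4 * \<tau>) < i2" using reals_Archimedean2 by blast
  then have i2: "1 \<le> 4 * \<tau> * i2" using \<tau> by (simp add: field_simps)
  define P where "P = (2::real) ^ (i1 + 2 * i2)"
  define \<epsilon> where "\<epsilon> = \<tau> ^ 4 / (64 * P * 10 ^ 7)"
  have P: "0 < P" by (simp add: P_def)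
  have \<epsilon>: "0 < \<epsilon>" using \<tau> P by (simp add: \<epsilon>_def)
  \<comment> \<open>The first summand makes \<open>e = \<epsilon> * n\<close> at least 2, so
    \<open>e * (e - 1)\<close> is at least \<open>e * e / 2\<close>; the second makes
    \<open>64 * P * d * n\<close> at most that.\<close>
  define n0 where "n0 = nat \<lceil>2 / \<epsilon> + 128 * P * d / \<epsilon>\<^sup>2\<rceil>"
  show ?thesis
  proof (intro exI[of _ n0] allI impI; elim conjE)
    fix p :: nat and A :: "int set" and F :: "int \<Rightarrow> int set" and n :: nat
    assume p: "Factorial_Ring.prime p" and A: "A \<subseteq> carrier (integer_mod_group p)" and n: "card A = n" "n0 \<le> n"
      and np: "real n < (1 - \<beta>) * real p / 2" and F: "\<forall>a\<in>A. F a \<subseteq> A \<and> card (F a) = d"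
    interpret prime_modulus "int p" by unfold_locales (use p in simp)
    have p0: "0 < p" using p by (simp add: prime_gt_0_nat)
    have A: "A \<subseteq> {0..<int p}" using A p0 by (simp add: carrier_integer_mod_group)
    define R where "R = restricted_sumset (integer_mod_group p) A F"
    define A' R' where "A' = {x. x mod int p \<in> A}" and "R' = {x. x mod int p \<in> R}"
    have R_eq: "R = {(a + b) mod int p | a b. a \<in> A \<and> b \<in> A - F a}"
      by (simp add: R_def restricted_sumset_def integer_mod_group_def)
    have R: "R \<subseteq> {0..<int p}" using p0 by (auto simp: R_eq)
    have per: "per A'" "per R'" by (simp_all add: per_def A'_def R'_def)
    have "A' \<inter> {0..<int p} = A" "R' \<inter> {0..<int p} = R" using A R by (auto simp: A'_def R'_def)
    then have szs: "sz A' = n" "sz R' = card R" using n by (simp_all add: sz_card)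
    have finA: "finite A" using A by (rule finite_subset) simp
    define e where "e = \<epsilon> * n"
    have "2 / \<epsilon> + 128 * P * d / \<epsilon>\<^sup>2 \<le> n" using n(2) unfolding n0_def by linarith
    moreover have "0 \<le> 2 / \<epsilon>" "0 \<le> 128 * P * d / \<epsilon>\<^sup>2" using \<epsilon> P by simp_all
    ultimately have "2 / \<epsilon> \<le> n" "128 * P * d / \<epsilon>\<^sup>2 \<le> n" by linarith+
    then have e: "2 \<le> e" "128 * P * d \<le> \<epsilon> * e"
      using \<epsilon> by (simp_all add: e_def field_simps power2_eq_square)
    have "2 * sz A' - 1 - 2 * real d \<le> sz R'"
    proof (rule restricted_sumset_bound[where \<beta> = \<beta>' and \<tau> = \<tau> and e = e and P = P and i = i1 and j = i2])
      fix x assume x: "x \<in> A'"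
      \<comment> \<open>A \<open>y\<close> in \<open>A\<close> that is not forbidden for
        \<open>x\<close> has its sum in \<open>R\<close>, so only forbidden values can be missing
        from the row.\<close>
      have "{y \<in> A'. x + y \<notin> R'} \<inter> {0..<int p} \<subseteq> F (x mod int p)"
      proof
        fix y assume y: "y \<in> {y \<in> A'. x + y \<notin> R'} \<inter> {0..<int p}"
        then have "y mod int p = y" by simp
        then have "y \<in> A" using y by (simp add: A'_def)
        moreover have "(x mod int p + y) mod int p \<notin> R" using y by (simp add: R'_def mod_simps)
        ultimately show "y \<in> F (x mod int p)" using x by (auto simp: R_eq A'_def)
      qed
      moreover have F': "F (x mod int p) \<subseteq> A" "card (F (x mod int p)) = d"
        using x F by (simp_all add: A'_def)
      moreover have "finite (F (x mod int p))" by (rule finite_subset[OF F'(1) finA])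
      ultimately show "sz {y \<in> A'. x + y \<notin> R'} \<le> real d"
        unfolding sz_card by (metis card_mono of_nat_le_iff)
    next
      show "\<beta>' * real_of_int (int p) \<le> real_of_int (int p) - 2 * sz A'"
      proof -
        have "\<beta>' * real p \<le> \<beta> * real p" using \<beta>' by (intro mult_right_mono) auto
        then show ?thesis using np szs by (simp add: algebra_simps)
      qed
      show "64 * P * (real d * sz A') \<le> e * (e - 1)"
      proof -
        have "128 * P * d * n \<le> \<epsilon> * e * n" using e(2) by (intro mult_right_mono) auto
        then have "128 * P * d * n \<le> e * e" by (simp add: e_def mult_ac)
        moreover have "e * 2 \<le> e * e" using e by (intro mult_left_mono) auto
        ultimately show ?thesis using szs by (simp add: algebra_simps)
      qed
      show "64 * P * e \<le> \<tau> ^ 4 * sz A' / 10 ^ 7" using P szs by (simp add: e_def \<epsilon>_def)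
    qed (use per \<beta>' e i1 i2 in \<open>auto simp: \<tau>_def P_def\<close>)
    then have "2 * real n - 1 - 2 * real d \<le> card R" using szs by simp
    then show "2 * int n - 1 - 2 * int d \<le> int (card (restricted_sumset (integer_mod_group p) A F))"
      unfolding R_def by linarith
  qed
qed

end
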